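(* Let $n\ge1$ be an integer, $\ell\ge1$, $\rho\in\mathbb{R}$ and $1\le p\le\infty$. If $0<\beta<2\alpha$ then the Bergman projection $P_\alpha$ is bounded from $L^{p}_{\beta,\rho}$ onto $F^{p}_{\alpha^2/(2\alpha-\beta),\rho}$; that is, $P_\alpha$ is a bounded linear operator from $L^{p}_{\beta,\rho}$ to $F^{p}_{\alpha^2/(2\alpha-\beta),\rho}$ and it is surjective.
   Context: $dV$ is Lebesgue measure on $\mathbb{C}^n$ normalized so that the unit ball has measure 1. For $1\le p<\infty$, $\alpha>0$, $\rho\in\mathbb{R}$, $L^p_{\alpha,\rho}$ (depending also on $\ell$) is the space of measurable functions $f$ on $\mathbb{C}^n$ with $\|f\|^p_{L^p_{\alpha,\rho}}=\int_{\mathbb{C}^n}\bigl|f(z)(1+|z|)^{\rho}e^{-\frac{\alpha}{2}|z|^{2\ell}}\bigr|^p\,dV(z)<\infty$; $L^\infty_{\alpha,\rho}$ is the space of measurable $f$ with $\|f\|_{L^\infty_{\alpha,\rho}}=\operatorname{ess\,sup}_{z}|f(z)|(1+|z|)^\rho e^{-\frac{\alpha}{2}|z|^{2\ell}}<\infty$. $F^p_{\alpha,\rho}$ is the subspace of entire functions in $L^p_{\alpha,\rho}$, with the same norm; $L^2_\alpha=L^2_{\alpha,0}$, $F^2_\alpha=F^2_{\alpha,0}$. The Bergman projection $P_\alpha$ (the orthogonal projection of $L^2_\alpha$ onto $F^2_\alpha$) is given by $P_\alpha f(z)=\int_{\mathbb{C}^n}f(w)K_\alpha(z,w)e^{-\alpha|w|^{2\ell}}dV(w)$,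 and is defined on $L^p_{\beta,\rho}$ by this (absolutely convergent) integral when $\beta<2\alpha$. Here $K_\alpha(z,w)=H_\alpha\bigl(\sum_j z_j\overline{w}_j\bigr)$ is the reproducing (Bergman) kernel of $F^2_\alpha$, with $H_\alpha(\lambda)=\frac{\ell\alpha^{n/\ell}}{n!}\sum_{k\ge0}\frac{(n-1+k)!}{k!}\frac{\alpha^{k/\ell}\lambda^k}{\Gamma((k+n)/\ell)}$. *)

theory Defs
  imports "HOL-Analysis.Analysis" "HOL-Probability.Essential_Supremum"
begin

definition dV :: "(complex ^ 'n) measure" where
  "dV = density lebesgue (\<lambda>_. ennreal (1 / measure lebesgue (ball (0 :: complex ^ 'n) 1)))"

lemma sets_dV: "sets dV = sets lebesgue"
  by (simp add: dV_def)

lemma emeasure_dV_unit_ball: "emeasure dV (ball (0 :: complex ^ 'n) 1) = 1"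
proof -
  have pos: "0 < measure lebesgue (ball (0 :: complex ^ 'n) 1)"
    by (simp add: content_ball_pos)
  have "emeasure dV (ball (0 :: complex ^ 'n) 1)
      = ennreal (1 / measure lebesgue (ball (0 :: complex ^ 'n) 1)) * emeasure lebesgue (ball (0 :: complex ^ 'n) 1)"
    unfolding dV_def by (subst emeasure_density_const) auto
  also have "emeasure lebesgue (ball (0 :: complex ^ 'n) 1)
      = ennreal (measure lebesgue (ball (0 :: complex ^ 'n) 1))"
    by (intro emeasure_eq_measure2) simp
  finally show ?thesis
    using pos by (simp flip: ennreal_mult')
qed

definition fock_weight :: "real \<Rightarrow> real \<Rightarrow> real \<Rightarrow> complex ^ 'n \<Rightarrow> real" where
  "fock_weight l \<alpha> \<rho> z = (1 + norm z) powr \<rho> * exp (- (\<alpha> / 2) * norm z powr (2 * l))"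

text \<open>The \<open>p\<close>-th power of the norm if \<open>p < \<infinity>\<close>, and the norm itself if \<open>p = \<infinity>\<close>;
  here it may still be infinite.\<close>

definition fock_modular ::
    "real \<Rightarrow> ennreal \<Rightarrow> real \<Rightarrow> real \<Rightarrow> (complex ^ 'n \<Rightarrow> complex) \<Rightarrow> ennreal" where
  "fock_modular l p \<alpha> \<rho> f =
     (if p = \<infinity> then esssup dV (\<lambda>z. ennreal (cmod (f z) * fock_weight l \<alpha> \<rho> z))
      else (\<integral>\<^sup>+ z. ennreal ((cmod (f z) * fock_weight l \<alpha> \<rho> z) powr enn2real p) \<partial>dV))"

text \<open>The elements of the following spaces are functions, not classes of functions modulo
  equality almost everywhere, so \<open>fock_norm\<close> is only a seminorm on \<open>L_space\<close>.\<close>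

definition L_space ::
    "real \<Rightarrow> ennreal \<Rightarrow> real \<Rightarrow> real \<Rightarrow> (complex ^ 'n \<Rightarrow> complex) set" where
  "L_space l p \<alpha> \<rho> = {f. f \<in> borel_measurable dV \<and> fock_modular l p \<alpha> \<rho> f < \<infinity>}"

definition fock_norm ::
    "real \<Rightarrow> ennreal \<Rightarrow> real \<Rightarrow> real \<Rightarrow> (complex ^ 'n \<Rightarrow> complex) \<Rightarrow> real" where
  "fock_norm l p \<alpha> \<rho> f =
     (if p = \<infinity> then enn2real (fock_modular l p \<alpha> \<rho> f)
      else enn2real (fock_modular l p \<alpha> \<rho> f) powr (1 / enn2real p))"

text \<open>Holomorphy in several variables: the real Frechet derivative exists everywhere and is
  complex linear.\<close>

definition entire :: "(complex ^ 'n \<Rightarrow> complex) \<Rightarrow> bool" where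
  "entire f \<longleftrightarrow>
     (\<forall>z. \<exists>D. (f has_derivative D) (at z) \<and> (\<forall>c v. D (c *s v) = c * D v))"

definition F_space ::
    "real \<Rightarrow> ennreal \<Rightarrow> real \<Rightarrow> real \<Rightarrow> (complex ^ 'n \<Rightarrow> complex) set" where
  "F_space l p \<alpha> \<rho> = {f \<in> L_space l p \<alpha> \<rho>. entire f}"

definition bergman_H :: "nat \<Rightarrow> real \<Rightarrow> real \<Rightarrow> complex \<Rightarrow> complex" where
  "bergman_H n l \<alpha> x =
     of_real (l * \<alpha> powr (real n / l) / fact n) *
     (\<Sum>k. of_real (fact (n - 1 + k) / fact k * \<alpha> powr (real k / l)
                    / Gamma (real (k + n) / l)) * x ^ k)"

definition bergman_kernel :: "real \<Rightarrow> real \<Rightarrow> complex ^ 'n \<Rightarrow> complex ^ 'n \<Rightarrow> complex" where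
  "bergman_kernel l \<alpha> z w = bergman_H CARD('n) l \<alpha> (\<Sum>j\<in>UNIV. z $ j * cnj (w $ j))"

definition bergman_integrand ::
    "real \<Rightarrow> real \<Rightarrow> (complex ^ 'n \<Rightarrow> complex) \<Rightarrow> complex ^ 'n \<Rightarrow> complex ^ 'n \<Rightarrow> complex" where
  "bergman_integrand l \<alpha> f z w =
     f w * bergman_kernel l \<alpha> z w * of_real (exp (- \<alpha> * norm w powr (2 * l)))"

definition bergman_projection ::
    "real \<Rightarrow> real \<Rightarrow> (complex ^ 'n \<Rightarrow> complex) \<Rightarrow> complex ^ 'n \<Rightarrow> complex" where
  "bergman_projection l \<alpha> f z = (\<integral> w. bergman_integrand l \<alpha> f z w \<partial>dV)"

end

(*  The kernel of P_alpha is a power series H in herm z w with positive coefficients c_k.  For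
    X = |x|^l large (alpha = 1), Stirling's lower bound for Gamma shows that the sequence
    c_k |x|^k is a bump of height about e^X X^(n - n/l - 1/2) and width about sqrt X around k = l X,
    and log-convexity of Gamma controls its differences.  Multiplication of H by 1 - u e^(it)
    takes these differences, so Parseval and Cauchy-Schwarz bound the L^1 mean of H over the
    circle |x| = const by the height of the bump; no asymptotics of H off the positive axis is
    needed.  After rotating z to a coordinate axis, the circle means and the inequality
    |z|^2l + |w|^2l - 2 |z|^l |w_1|^l >= c (1 + |z|)^(2l-2) |w - z|^2 - 1 (where w_1 >= 0) reduce
    the weighted L^1 norm of the kernel to a Gaussian integral, uniformly in z.  Dilations
    in z and w turn this into the two estimates of the Schur test for P_alpha, for every p.

    For surjectivity, the homogeneous parts of an entire function are reproduced in the weight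
    e^(-|w|^2) by the mean value property, and a homogeneous function has proportional integrals
    against e^(-|w|^2) and e^(-alpha |w|^2l), which gives P_alpha G = G.  Multiplying a dilate
    of F by an exponential exhibits a preimage of F.  *)

theory Submission
  imports Defs "HOL-Probability.Probability_Measure" "HOL-Complex_Analysis.Complex_Analysis" "HOL-Real_Asymp.Real_Asymp"
begin

section \<open>Lebesgue measure on the complex coordinate space\<close>

text \<open>The triangle inequality is too weak for the kernel. On the positive axis the bump adds
  up to height times width, which exceeds the circle mean by a factor of order sqrt X, and X is
  about |z|^(2l) for the w that matter, so this loss could not be uniform in z. The differences of
  the coefficients are smaller than the coefficients by the same factor; they express that the peak
  of H on a circle has angular width 1 / sqrt X, and this recovers the loss.

  Sharp powers are required because the circle mean contributes (1 + |z|)^(2n(l - 1) - l), the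
  Gaussian integral contributes (1 + |z|)^(2 - l - 2(l - 1)(n - 1)), and these two exponents add up
  to 0. Factors polynomial in |w - z|, in contrast, are harmless, since a part of the Gaussian
  absorbs them. Therefore rho may have either sign, and the two integrals of the Schur test differ
  only in the sign of rho.\<close>

lemma borel_measurable_pair:
  fixes f :: "'a::second_countable_topology \<times> 'b::second_countable_topology \<Rightarrow> 'c::topological_space"
  assumes f: "f \<in> borel_measurable borel"
    and M: "(\<lambda>x. x) \<in> measurable M borel" and N: "(\<lambda>x. x) \<in> measurable N borel"
  shows "f \<in> borel_measurable (M \<Otimes>\<^sub>M N)"
proof -
  have "(\<lambda>x. (fst x, snd x)) \<in> measurable (M \<Otimes>\<^sub>M N) (borel \<Otimes>\<^sub>M borel)"
    by (intro measurable_Pair measurable_compose[OF measurable_fst M] measurable_compose[OF measurable_snd N])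
  from measurable_compose[OF this, of f borel] show ?thesis using f by (simp add: borel_prod)
qed

lemma nn_integral_lborel_translate:
  fixes c :: "'a::euclidean_space"
  assumes [measurable]: "f \<in> borel_measurable borel"
  shows "(\<integral>\<^sup>+x. f (c + x) \<partial>lborel) = (\<integral>\<^sup>+x. f x \<partial>lborel)"
proof -
  have "(\<integral>\<^sup>+x. f x \<partial>lborel) = (\<integral>\<^sup>+x. f x \<partial>distr lborel borel ((+) c))"
    by (simp add: lborel_distr_plus)
  also have "\<dots> = (\<integral>\<^sup>+x. f (c + x) \<partial>lborel)"
    by (subst nn_integral_distr) auto
  finally show ?thesis by simp
qed

lemma nn_integral_lborel_scale:
  fixes f :: "'a::euclidean_space \<Rightarrow> ennreal"
  assumes [measurable]: "f \<in> borel_measurable borel" and "c > 0"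
  shows "(\<integral>\<^sup>+x. f x \<partial>lborel) = ennreal (c ^ DIM('a)) * (\<integral>\<^sup>+x. f (c *\<^sub>R x) \<partial>lborel)"
proof -
  have "(\<integral>\<^sup>+x. f x \<partial>lborel) =
      (\<integral>\<^sup>+x. f x \<partial>density (distr lborel borel (\<lambda>x. 0 + c *\<^sub>R x)) (\<lambda>_. ennreal (\<bar>c\<bar> ^ DIM('a))))"
    using lborel_affine[of c "0::'a"] assms(2) by simp
  also have "\<dots> = ennreal (c ^ DIM('a)) * (\<integral>\<^sup>+x. f (c *\<^sub>R x) \<partial>lborel)"
    using assms(2) by (simp add: nn_integral_density nn_integral_distr nn_integral_cmult)
  finally show ?thesis .
qed

lemma integral_lborel_scale:
  fixes f :: "'a::euclidean_space \<Rightarrow> 'b::{banach, second_countable_topology}"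
  assumes [measurable]: "f \<in> borel_measurable borel" and "c > 0"
  shows "(\<integral>x. f x \<partial>lborel) = (c ^ DIM('a)) *\<^sub>R (\<integral>x. f (c *\<^sub>R x) \<partial>lborel)"
proof -
  have "(\<integral>x. f x \<partial>lborel) =
      (\<integral>x. f x \<partial>density (distr lborel borel (\<lambda>x. 0 + c *\<^sub>R x)) (\<lambda>_. ennreal (\<bar>c\<bar> ^ DIM('a))))"
    using lborel_affine[of c "0::'a"] assms(2) by simp
  also have "\<dots> = (c ^ DIM('a)) *\<^sub>R (\<integral>x. f (c *\<^sub>R x) \<partial>lborel)"
    using assms(2) by (simp add: integral_density integral_distr)
  finally show ?thesis .
qed

text \<open>The uniqueness argument for Haar measure: both \<open>distr lborel borel T\<close> and \<open>lborel\<close> are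
  translation invariant, and they agree on the unit ball.\<close>

lemma lborel_distr_isometry:
  fixes T :: "'a::euclidean_space \<Rightarrow> 'a"
  assumes lin: "linear T" and nrm: "\<And>x. norm (T x) = norm x"
  shows "distr lborel borel T = lborel"
proof (rule measure_eqI)
  have "inj T"
    using nrm by (metis lin linear_injective_0 norm_eq_zero)
  then have "surj T" using lin linear_inj_imp_surj by blast
  have cont: "continuous_on UNIV T" using lin linear_continuous_on linear_conv_bounded_linear by blast
  then have Tm[measurable]: "T \<in> borel_measurable borel"
    by (rule borel_measurable_continuous_onI)
  fix A assume "A \<in> sets (distr lborel borel T)"
  then have A[measurable]: "A \<in> sets borel" by simp
  define B where "B = ball (0::'a) 1"
  have B[measurable]: "B \<in> sets borel" by (simp add: B_def)
  let ?b = "emeasure lborel B"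
  have Bfin: "?b \<noteq> \<infinity>" "?b \<noteq> 0"
  proof -
    show "?b \<noteq> \<infinity>" unfolding B_def using emeasure_lborel_ball_finite[of "0::'a" 1] by simp
    show "?b \<noteq> 0" unfolding B_def
      by (metis content_ball_pos emeasure_lborel_ball_finite enn2real_0 less_numeral_extra(1,3) measure_def)
  qed
  have Tdiff: "T x - T y = T (x - y)" for x y using lin by (simp add: linear_diff)
  \<comment> \<open>The double integral of \<open>indicator B x * indicator A (T u + x)\<close> is
    computed in both orders: one gives \<open>?b\<close> times the image measure of
    \<open>A\<close>, the other \<open>?b\<close> times its Lebesgue measure.\<close>
  have "?b * emeasure (distr lborel borel T) A
      = (\<integral>\<^sup>+x. indicator B x * (\<integral>\<^sup>+u. indicator A (T u) \<partial>lborel) \<partial>lborel)"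
  proof -
    have "emeasure (distr lborel borel T) A = (\<integral>\<^sup>+u. indicator A (T u) \<partial>lborel)"
      by (simp add: nn_integral_distr flip: nn_integral_indicator)
    then show ?thesis by (simp add: nn_integral_multc)
  qed
  also have "\<dots> = (\<integral>\<^sup>+x. indicator B x * (\<integral>\<^sup>+u. indicator A (T u + x) \<partial>lborel) \<partial>lborel)"
  proof (rule nn_integral_cong)
    fix x
    obtain y where "x = T y" using \<open>surj T\<close> by blast
    then have "(\<integral>\<^sup>+u. indicator A (T u + x) \<partial>lborel) = (\<integral>\<^sup>+u. indicator A (T (y + u)) \<partial>lborel)"
      by (simp add: linear_add[OF lin] add.commute)
    also have "\<dots> = (\<integral>\<^sup>+u. indicator A (T u) \<partial>lborel)"
      by (rule nn_integral_lborel_translate[where f="\<lambda>u. indicator A (T u)"]) simp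
    finally show "indicator B x * (\<integral>\<^sup>+u. indicator A (T u) \<partial>lborel)
        = indicator B x * (\<integral>\<^sup>+u. indicator A (T u + x) \<partial>lborel)" by simp
  qed
  also have "\<dots> = (\<integral>\<^sup>+x. \<integral>\<^sup>+u. indicator B x * indicator A (T u + x) \<partial>lborel \<partial>lborel)"
    by (simp add: nn_integral_cmult)
  also have "\<dots> = (\<integral>\<^sup>+u. \<integral>\<^sup>+x. indicator B x * indicator A (T u + x) \<partial>lborel \<partial>lborel)"
    by (rule lborel_pair.Fubini') measurable
  also have "\<dots> = (\<integral>\<^sup>+u. \<integral>\<^sup>+x. indicator B (x - T u) * indicator A x \<partial>lborel \<partial>lborel)"
  proof (rule nn_integral_cong)
    fix u
    show "(\<integral>\<^sup>+x. indicator B x * indicator A (T u + x) \<partial>lborel)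
        = (\<integral>\<^sup>+x. indicator B (x - T u) * indicator A x \<partial>lborel)"
      using nn_integral_lborel_translate[of "\<lambda>x. indicator B (x - T u) * indicator A x :: ennreal" "T u"]
      by simp
  qed
  also have "\<dots> = (\<integral>\<^sup>+x. \<integral>\<^sup>+u. indicator B (x - T u) * indicator A x \<partial>lborel \<partial>lborel)"
    by (rule lborel_pair.Fubini') measurable
  also have "\<dots> = (\<integral>\<^sup>+x. ?b * indicator A x \<partial>lborel)"
  proof (rule nn_integral_cong)
    fix x
    obtain y where y: "x = T y" using \<open>surj T\<close> by blast
    \<comment> \<open>As \<open>x - T u = T (y - u)\<close> and \<open>T\<close> preserves the norm,
      the condition on u describes the unit ball about y, whose measure does not depend on
      x.\<close>
    have "indicator B (x - T u) = (indicator B (- y + u) :: ennreal)" for u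
      using nrm[of "y - u"] by (simp add: y Tdiff B_def indicator_def norm_minus_commute)
    then have "(\<integral>\<^sup>+u. indicator B (x - T u) \<partial>lborel) = (\<integral>\<^sup>+u. indicator B (-y + u) \<partial>lborel)"
      by simp
    also have "\<dots> = ?b" by (subst nn_integral_lborel_translate) auto
    finally show "(\<integral>\<^sup>+u. indicator B (x - T u) * indicator A x \<partial>lborel) = ?b * indicator A x"
      by (simp add: nn_integral_multc)
  qed
  also have "\<dots> = ?b * emeasure lborel A"
    by (simp add: nn_integral_cmult)
  finally show "emeasure (distr lborel borel T) A = emeasure lborel A"
    using Bfin by (simp add: ennreal_mult_cancel_left)
qed simp

lemma nn_integral_lborel_isometry:
  fixes T :: "'a::euclidean_space \<Rightarrow> 'a"
  assumes "linear T" and "\<And>x. norm (T x) = norm x" and [measurable]: "f \<in> borel_measurable borel"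
  shows "(\<integral>\<^sup>+x. f (T x) \<partial>lborel) = (\<integral>\<^sup>+x. f x \<partial>lborel)"
proof -
  have [measurable]: "T \<in> borel_measurable borel"
    using assms(1) by (intro borel_measurable_continuous_onI linear_continuous_on)
       (simp add: linear_conv_bounded_linear)
  show ?thesis
    by (subst (2) lborel_distr_isometry[OF assms(1,2), symmetric]) (simp add: nn_integral_distr)
qed

lemma integral_lborel_isometry:
  fixes T :: "'a::euclidean_space \<Rightarrow> 'a" and f :: "'a \<Rightarrow> 'b::{banach, second_countable_topology}"
  assumes "linear T" and "\<And>x. norm (T x) = norm x" and [measurable]: "f \<in> borel_measurable borel"
  shows "(\<integral>x. f (T x) \<partial>lborel) = (\<integral>x. f x \<partial>lborel)"
proof -
  have [measurable]: "T \<in> borel_measurable borel"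
    using assms(1) by (intro borel_measurable_continuous_onI linear_continuous_on)
       (simp add: linear_conv_bounded_linear)
  show ?thesis
    by (subst (2) lborel_distr_isometry[OF assms(1,2), symmetric]) (simp add: integral_distr)
qed

section \<open>Complex scalars and coordinates\<close>

lemma norm_vector_smult: "norm (c *s w) = norm c * norm (w :: complex ^ 'n)"
  unfolding norm_vec_def by (simp add: norm_mult L2_set_right_distrib)

lemma linear_vector_smult: "linear (\<lambda>w :: complex ^ 'n. c *s w)"
  by (rule linearI) (simp_all add: vec_eq_iff algebra_simps scaleR_conv_of_real)

lemma borel_measurable_vec_lambda [measurable]:
  "vec_lambda \<in> borel_measurable (\<Pi>\<^sub>M i\<in>(UNIV :: 'n::finite set). (lborel :: complex measure))"
proof (subst borel_measurable_euclidean_space, intro ballI)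
  fix b :: "complex ^ 'n" assume "b \<in> Basis"
  then obtain i c where "b = axis i c" by (auto simp: Basis_vec_def)
  then show "(\<lambda>x. vec_lambda x \<bullet> b) \<in> borel_measurable (\<Pi>\<^sub>M i\<in>(UNIV :: 'n set). (lborel :: complex measure))"
    by (simp add: inner_axis)
qed

text \<open>\<open>lborel\<close> is characterized by its values on boxes, and a box is the product
  of the boxes of its coordinates because \<open>Basis\<close> consists of the vectors
  \<open>axis i b\<close>. This makes integrals of products over the complex coordinates
  factorize.\<close>

lemma lborel_vec_PiM:
  "(lborel :: (complex ^ 'n) measure) = distr (\<Pi>\<^sub>M i\<in>(UNIV::'n set). lborel) borel vec_lambda"
proof (rule lborel_eqI)
  interpret product_sigma_finite "\<lambda>i::'n. lborel :: complex measure" by standard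
  fix l u :: "complex ^ 'n" assume le: "\<And>b. b \<in> Basis \<Longrightarrow> l \<bullet> b \<le> u \<bullet> b"
  have le': "l $ i \<bullet> b \<le> u $ i \<bullet> b" if "b \<in> Basis" for i b
    using le[of "axis i b"] that by (simp add: inner_axis axis_in_Basis_iff)
  have vi: "vec_lambda -` box l u \<inter> space (\<Pi>\<^sub>M i\<in>(UNIV::'n set). (lborel :: complex measure))
      = (\<Pi>\<^sub>E i\<in>UNIV. box (l $ i) (u $ i))"
    by (auto simp: box_def Basis_vec_def inner_axis space_PiM)
  have "emeasure (distr (\<Pi>\<^sub>M i\<in>(UNIV::'n set). lborel) borel vec_lambda) (box l u)
      = emeasure (\<Pi>\<^sub>M i\<in>(UNIV::'n set). lborel) (\<Pi>\<^sub>E i\<in>UNIV. box (l $ i) (u $ i))"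
    by (simp add: emeasure_distr vi)
  also have "\<dots> = (\<Prod>i\<in>UNIV. emeasure lborel (box (l $ i) (u $ i)))"
    by (rule emeasure_PiM) auto
  also have "\<dots> = (\<Prod>i\<in>UNIV. ennreal (\<Prod>b\<in>Basis. (u $ i - l $ i) \<bullet> b))"
    using le' by (simp add: emeasure_lborel_box)
  also have "\<dots> = ennreal (\<Prod>i\<in>UNIV. \<Prod>b\<in>Basis. (u $ i - l $ i) \<bullet> b)"
    using le' by (subst prod_ennreal) (auto intro!: prod_nonneg simp: inner_diff_left)
  also have "(\<Prod>i\<in>UNIV. \<Prod>b\<in>Basis. (u $ i - l $ i) \<bullet> b) = (\<Prod>b\<in>Basis. (u - l) \<bullet> b)"
    unfolding Basis_vec_def
    by (subst prod.UNION_disjoint)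
       (auto simp: inner_axis axis_eq_axis prod.reindex inj_on_def Basis_complex_def
             intro!: prod.cong)
  finally show "emeasure (distr (\<Pi>\<^sub>M i\<in>(UNIV::'n set). lborel) borel vec_lambda) (box l u)
      = ennreal (\<Prod>b\<in>Basis. (u - l) \<bullet> b)" .
qed simp

lemma nn_integral_lborel_vec_prod:
  fixes f :: "'n::finite \<Rightarrow> complex \<Rightarrow> ennreal"
  assumes [measurable]: "\<And>i. f i \<in> borel_measurable borel"
  shows "(\<integral>\<^sup>+w. (\<Prod>i\<in>UNIV. f i (w $ i)) \<partial>lborel) = (\<Prod>i\<in>UNIV. \<integral>\<^sup>+u. f i u \<partial>lborel)"
proof -
  interpret product_sigma_finite "\<lambda>i::'n. lborel :: complex measure" by standard
  have [measurable]: "(\<lambda>w :: complex ^ 'n. w $ i) \<in> borel_measurable borel" for i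
    by (intro borel_measurable_continuous_onI continuous_intros)
  have "(\<integral>\<^sup>+w. (\<Prod>i\<in>UNIV. f i (w $ i)) \<partial>lborel)
      = (\<integral>\<^sup>+x. (\<Prod>i\<in>UNIV. f i (x i)) \<partial>(\<Pi>\<^sub>M i\<in>(UNIV::'n set). lborel))"
    by (subst lborel_vec_PiM, subst nn_integral_distr) auto
  also have "\<dots> = (\<Prod>i\<in>UNIV. \<integral>\<^sup>+u. f i u \<partial>lborel)"
    by (rule product_nn_integral_prod) auto
  finally show ?thesis .
qed

section \<open>The normalized measure in terms of \<open>lborel\<close>\<close>

definition dV_const :: "'n::finite itself \<Rightarrow> real" where
  "dV_const _ = 1 / measure lebesgue (ball (0 :: complex ^ 'n) 1)"

lemma dV_const_pos: "dV_const TYPE('n::finite) > 0"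
  by (simp add: dV_const_def content_ball_pos)

lemma nn_integral_dV:
  fixes f :: "complex ^ 'n \<Rightarrow> ennreal"
  assumes [measurable]: "f \<in> borel_measurable borel"
  shows "(\<integral>\<^sup>+x. f x \<partial>dV) = ennreal (dV_const TYPE('n)) * (\<integral>\<^sup>+x. f x \<partial>lborel)"
proof -
  have [measurable]: "f \<in> borel_measurable lebesgue" by (simp add: measurable_completion)
  show ?thesis
    unfolding dV_def dV_const_def
    by (simp add: nn_integral_density nn_integral_cmult nn_integral_completion)
qed

lemma integral_dV:
  fixes f :: "complex ^ 'n \<Rightarrow> 'b::{banach, second_countable_topology}"
  assumes [measurable]: "f \<in> borel_measurable borel"
  shows "(\<integral>x. f x \<partial>dV) = dV_const TYPE('n) *\<^sub>R (\<integral>x. f x \<partial>lborel)"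
proof -
  have [measurable]: "f \<in> borel_measurable lebesgue" by (simp add: measurable_completion)
  show ?thesis
    unfolding dV_def dV_const_def
    by (subst integral_density) (auto simp: integral_completion)
qed

lemma space_dV [simp]: "space dV = UNIV" by (simp add: dV_def)

lemma borel_measurable_dV [measurable (raw)]:
  "f \<in> borel_measurable borel \<Longrightarrow> f \<in> borel_measurable (dV :: (complex ^ 'n) measure)"
  by (simp add: measurable_completion dV_def)

lemma integrable_dV_iff:
  fixes f :: "complex ^ 'n \<Rightarrow> 'b::{banach, second_countable_topology}"
  assumes [measurable]: "f \<in> borel_measurable borel"
  shows "integrable dV f \<longleftrightarrow> integrable lborel f"
  using dV_const_pos[where 'n='n]
  by (auto simp: integrable_iff_bounded nn_integral_dV ennreal_mult_less_top borel_measurable_dV)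

lemma emeasure_dV:
  fixes A :: "(complex ^ 'n) set"
  assumes [measurable]: "A \<in> sets borel"
  shows "emeasure dV A = ennreal (dV_const TYPE('n)) * emeasure lborel A"
proof -
  have [measurable]: "A \<in> sets dV" by (simp add: sets_dV)
  show ?thesis
    using nn_integral_dV[of "indicator A"] by simp
qed

lemma sigma_finite_dV: "sigma_finite_measure (dV :: (complex ^ 'n) measure)"
proof (standard, intro exI conjI)
  let ?A = "range (\<lambda>n::nat. ball (0 :: complex ^ 'n) (real n))"
  show "countable ?A" "?A \<subseteq> sets dV" by (auto simp: sets_dV)
  show "\<Union>?A = space dV" using reals_Archimedean2 by fastforce
  have "emeasure dV (ball (0 :: complex ^ 'n) r) \<noteq> \<infinity>" for r
    using emeasure_lborel_ball_finite[of "0 :: complex ^ 'n" r]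
    by (simp add: emeasure_dV ennreal_mult_eq_top_iff)
  then show "\<forall>a\<in>?A. emeasure dV a \<noteq> \<infinity>" by blast
qed

section \<open>Gaussian mass around a circle in the plane\<close>

text \<open>The layer-cake identity: if a depends on w, Fubini's theorem reduces the integral of exp
  (- a w) over w to the measures of the sublevel sets of a.\<close>

lemma nn_integral_exp_layer:
  fixes a :: real assumes "a \<ge> 0"
  shows "(\<integral>\<^sup>+u. ennreal (exp (-u)) * indicator {a..} u \<partial>lborel) = ennreal (exp (-a))"
proof -
  have "(\<integral>\<^sup>+u. ennreal (exp (-u)) * indicator {a..} u \<partial>lborel) = ennreal (0 - (- exp (-a)))"
  proof (rule nn_integral_FTC_atLeast)
    have "((\<lambda>x::real. - exp (- x)) \<longlongrightarrow> 0) at_top"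
      by real_asymp
    then show "((\<lambda>x::real. - exp (- x)) \<longlongrightarrow> 0) at_top" .
  qed (auto intro!: derivative_eq_intros)
  then show ?thesis by simp
qed

text \<open>For t at most a the area is exactly 4 pi a t. Beyond that the annulus has become a disc,
  and the term with t^2 takes over.\<close>

lemma emeasure_complex_annulus_le:
  assumes "a \<ge> 0" "t \<ge> 0"
  shows "emeasure lborel {w::complex. \<bar>a - norm w\<bar> \<le> t} \<le> ennreal (4 * pi * (a * t + t\<^sup>2))"
proof (cases "t \<le> a")
  case True
  have "{w::complex. \<bar>a - norm w\<bar> \<le> t} = cball 0 (a + t) - ball 0 (a - t)"
    by (auto simp: abs_le_iff not_less)
  moreover have "emeasure lborel (cball (0::complex) (a + t) - ball 0 (a - t))
      = emeasure lborel (cball (0::complex) (a + t)) - emeasure lborel (ball (0::complex) (a - t))"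
  proof (rule emeasure_Diff)
    show "emeasure lborel (ball (0::complex) (a - t)) \<noteq> \<infinity>"
      using emeasure_lborel_ball_finite[of "0::complex" "a - t"] by (simp only: less_top infinity_ennreal_def)
    show "ball (0::complex) (a - t) \<subseteq> cball 0 (a + t)" using assms by (intro subsetI) simp
  qed simp_all
  ultimately have "emeasure lborel {w::complex. \<bar>a - norm w\<bar> \<le> t}
      = emeasure lborel (cball (0::complex) (a + t)) - emeasure lborel (ball (0::complex) (a - t))"
    by (simp only:)
  also have "\<dots> = ennreal (pi * (a + t)\<^sup>2 - pi * (a - t)\<^sup>2)"
    using assms True by (simp add: emeasure_ball emeasure_cball unit_ball_vol_2 ennreal_minus)
  also have "\<dots> \<le> ennreal (4 * pi * (a * t + t\<^sup>2))"
    using assms by (intro ennreal_leI) (simp add: power2_eq_square algebra_simps)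
  finally show ?thesis .
next
  case False
  have "emeasure lborel {w::complex. \<bar>a - norm w\<bar> \<le> t} \<le> emeasure lborel (cball (0::complex) (a + t))"
    by (intro emeasure_mono) (auto simp: abs_le_iff)
  also have "\<dots> = ennreal (pi * (a + t)\<^sup>2)"
    using assms False by (simp add: emeasure_cball unit_ball_vol_2)
  also have "\<dots> \<le> ennreal (4 * pi * (a * t + t\<^sup>2))"
  proof -
    have "(a + t)\<^sup>2 \<le> 4 * (a * t + t\<^sup>2)"
    proof -
      have "(a + t)\<^sup>2 \<le> 4 * (a * t + t\<^sup>2) \<longleftrightarrow> a * a \<le> t * (2 * a + 3 * t)"
        by (simp add: power2_eq_square algebra_simps)
      moreover have "a * a \<le> t * (2 * a + 3 * t)"
        using assms False by (intro mult_mono) auto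
      ultimately show ?thesis by blast
    qed
    then have "pi * (a + t)\<^sup>2 \<le> pi * (4 * (a * t + t\<^sup>2))" by (intro mult_left_mono) auto
    then show ?thesis by (intro ennreal_leI) (simp add: algebra_simps)
  qed
  finally show ?thesis .
qed

text \<open>At t = sqrt (u / kappa) the area bound for the annulus grows like sqrt u and u; these
  are the moments that remain after Fubini's theorem.\<close>

lemma nn_integral_exp_moments_finite:
  "(\<integral>\<^sup>+(u::real). ennreal (exp (-u) * (sqrt u + u)) * indicator {0..} u \<partial>lborel) < \<infinity>"
proof -
  have "(\<integral>\<^sup>+(u::real). ennreal (exp (-u) * (sqrt u + u)) * indicator {0..} u \<partial>lborel)
     \<le> (\<integral>\<^sup>+(u::real). ennreal 8 * (ennreal (exp (-(u/2))) * indicator {0..} u) \<partial>lborel)"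
  proof (rule nn_integral_mono)
    fix u :: real
    show "ennreal (exp (-u) * (sqrt u + u)) * indicator {0..} u
       \<le> ennreal 8 * (ennreal (exp (-(u/2))) * indicator {0..} u)"
    proof (cases "u \<ge> 0")
      case True
      have "sqrt u \<le> 1 + u"
        using True by (intro real_le_lsqrt) (auto simp: power2_eq_square algebra_simps)
      moreover have "1 + u / 2 \<le> exp (u / 2)" by (rule exp_ge_add_one_self)
      ultimately have "sqrt u + u \<le> 8 * exp (u / 2)" using True by (smt (verit) field_sum_of_halves)
      then have "exp (-u) * (sqrt u + u) \<le> exp (-u) * (8 * exp (u / 2))" by simp
      also have "\<dots> = 8 * exp (-(u/2))" by (simp add: exp_add[symmetric] mult_ac)
      finally have "ennreal (exp (-u) * (sqrt u + u)) \<le> ennreal (8 * exp (-(u/2)))" by (rule ennreal_leI)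
      also have "\<dots> = ennreal 8 * ennreal (exp (-(u/2)))" by (rule ennreal_mult) auto
      finally show ?thesis using True by simp
    qed simp
  qed
  also have "\<dots> = ennreal 8 * (\<integral>\<^sup>+(u::real). ennreal (exp (-(u/2))) * indicator {0..} u \<partial>lborel)"
    by (simp add: nn_integral_cmult)
  also have "(\<integral>\<^sup>+(u::real). ennreal (exp (-(u/2))) * indicator {0..} u \<partial>lborel) = ennreal (0 - (- 2 * exp (-(0/2))))"
  proof (rule nn_integral_FTC_atLeast)
    show "((\<lambda>x::real. - 2 * exp (- (x/2))) \<longlongrightarrow> 0) at_top" by real_asymp
  qed (auto intro!: derivative_eq_intros)
  finally show ?thesis by (simp add: ennreal_mult_less_top le_less_trans)
qed

text \<open>The mass sits in an annulus of thickness 1 / sqrt kappa around the circle of radius a,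
  whose area is of order a / sqrt kappa; the term 1 / kappa takes over when a is smaller than the
  thickness.\<close>

lemma gaussian_annulus_bound:
  "\<exists>C>0. \<forall>\<kappa>>0. \<forall>a\<ge>0. (\<integral>\<^sup>+(w::complex). ennreal (exp (- \<kappa> * (a - norm w)\<^sup>2)) \<partial>lborel)
      \<le> ennreal (C * (a / sqrt \<kappa> + 1 / \<kappa>))"
proof -
  define I where "I = (\<integral>\<^sup>+(u::real). ennreal (exp (-u) * (sqrt u + u)) * indicator {0..} u \<partial>lborel)"
  have I: "I = ennreal (enn2real I)" using nn_integral_exp_moments_finite by (simp add: I_def)
  have main: "(\<integral>\<^sup>+(w::complex). ennreal (exp (- \<kappa> * (a - norm w)\<^sup>2)) \<partial>lborel)
      \<le> ennreal (4 * pi * (a / sqrt \<kappa> + 1 / \<kappa>)) * I" if "\<kappa> > 0" "a \<ge> 0" for \<kappa> a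
  proof -
    have "(\<integral>\<^sup>+(w::complex). ennreal (exp (- \<kappa> * (a - norm w)\<^sup>2)) \<partial>lborel)
      = (\<integral>\<^sup>+(w::complex). (\<integral>\<^sup>+u. ennreal (exp (-u)) * indicator {\<kappa> * (a - norm w)\<^sup>2..} u \<partial>lborel) \<partial>lborel)"
      using that by (subst nn_integral_exp_layer) auto
    also have "\<dots> = (\<integral>\<^sup>+(w::complex). (\<integral>\<^sup>+u. ennreal (exp (-u)) * of_bool (\<kappa> * (a - norm w)\<^sup>2 \<le> u) \<partial>lborel) \<partial>lborel)"
      by (simp add: indicator_def)
    also have "\<dots> = (\<integral>\<^sup>+u. (\<integral>\<^sup>+(w::complex). ennreal (exp (-u)) * of_bool (\<kappa> * (a - norm w)\<^sup>2 \<le> u) \<partial>lborel) \<partial>lborel)"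
      by (rule lborel_pair.Fubini') measurable
    also have "\<dots> \<le> (\<integral>\<^sup>+u. ennreal (4 * pi * (a / sqrt \<kappa> + 1 / \<kappa>)) * (ennreal (exp (-u) * (sqrt u + u)) * indicator {0..} u) \<partial>lborel)"
    proof (rule nn_integral_mono)
      fix u :: real
      show "(\<integral>\<^sup>+(w::complex). ennreal (exp (-u)) * of_bool (\<kappa> * (a - norm w)\<^sup>2 \<le> u) \<partial>lborel)
         \<le> ennreal (4 * pi * (a / sqrt \<kappa> + 1 / \<kappa>)) * (ennreal (exp (-u) * (sqrt u + u)) * indicator {0..} u)"
      proof (cases "u \<ge> 0")
        case False
        have "\<not> \<kappa> * (a - norm w)\<^sup>2 \<le> u" for w :: complex
          using False that mult_nonneg_nonneg[of \<kappa> "(a - norm w)\<^sup>2"] by (smt (verit) zero_le_power2)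
        then show ?thesis using False by simp
      next
        case True
        define t where "t = sqrt (u / \<kappa>)"
        have t: "t \<ge> 0" "t\<^sup>2 = u / \<kappa>" "t = sqrt u / sqrt \<kappa>"
          using True that by (auto simp: t_def real_sqrt_divide power_divide)
        have "\<kappa> * (a - norm w)\<^sup>2 \<le> u \<longleftrightarrow> \<bar>a - norm w\<bar> \<le> t" for w :: complex
        proof -
          have "\<kappa> * (a - norm w)\<^sup>2 \<le> u \<longleftrightarrow> (a - norm w)\<^sup>2 \<le> t\<^sup>2"
            using that unfolding t(2) by (simp add: field_simps)
          then show ?thesis using t(1) by (simp add: abs_le_square_iff[symmetric])
        qed
        then have "(\<integral>\<^sup>+(w::complex). ennreal (exp (-u)) * of_bool (\<kappa> * (a - norm w)\<^sup>2 \<le> u) \<partial>lborel)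
          = (\<integral>\<^sup>+(w::complex). ennreal (exp (-u)) * indicator {w. \<bar>a - norm w\<bar> \<le> t} w \<partial>lborel)"
          by (simp add: indicator_def)
        also have "\<dots> = ennreal (exp (-u)) * emeasure lborel {w::complex. \<bar>a - norm w\<bar> \<le> t}"
          by (subst nn_integral_cmult) auto
        also have "\<dots> \<le> ennreal (exp (-u)) * ennreal (4 * pi * (a * t + t\<^sup>2))"
          using emeasure_complex_annulus_le[OF that(2) t(1)] by (intro mult_left_mono) auto
        also have "\<dots> = ennreal (exp (-u) * (4 * pi * (a * t + t\<^sup>2)))"
          by (simp add: ennreal_mult')
        also have "\<dots> \<le> ennreal (4 * pi * (a / sqrt \<kappa> + 1 / \<kappa>) * (exp (-u) * (sqrt u + u)))"
        proof (rule ennreal_leI)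
          have "a * t + t\<^sup>2 \<le> (a / sqrt \<kappa> + 1 / \<kappa>) * (sqrt u + u)"
            unfolding t(2) unfolding t(3) using that True by (simp add: field_simps)
          then have "(4 * pi * exp (-u)) * (a * t + t\<^sup>2) \<le> (4 * pi * exp (-u)) * ((a / sqrt \<kappa> + 1 / \<kappa>) * (sqrt u + u))"
            by (intro mult_left_mono) auto
          then show "exp (-u) * (4 * pi * (a * t + t\<^sup>2)) \<le> 4 * pi * (a / sqrt \<kappa> + 1 / \<kappa>) * (exp (-u) * (sqrt u + u))"
            by (simp add: mult_ac)
        qed
        also have "\<dots> = ennreal (4 * pi * (a / sqrt \<kappa> + 1 / \<kappa>)) * ennreal (exp (-u) * (sqrt u + u))"
          using that by (intro ennreal_mult') auto
        finally show ?thesis using True by simp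
      qed
    qed
    also have "\<dots> = ennreal (4 * pi * (a / sqrt \<kappa> + 1 / \<kappa>)) * I"
      unfolding I_def by (subst nn_integral_cmult) auto
    finally show ?thesis .
  qed
  show ?thesis
  proof (intro exI[of _ "4 * pi * (enn2real I + 1)"] conjI allI impI)
    show "4 * pi * (enn2real I + 1) > 0" by (simp add: add_nonneg_pos)
    fix \<kappa> a :: real assume \<kappa>: "\<kappa> > 0" and a: "a \<ge> 0"
    have "ennreal (4 * pi * (a / sqrt \<kappa> + 1 / \<kappa>)) * I
       = ennreal (4 * pi * (a / sqrt \<kappa> + 1 / \<kappa>) * enn2real I)"
      using \<kappa> a by (subst I) (simp add: ennreal_mult')
    also have "\<dots> \<le> ennreal (4 * pi * (enn2real I + 1) * (a / sqrt \<kappa> + 1 / \<kappa>))"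
      using \<kappa> a by (intro ennreal_leI) (simp add: algebra_simps)
    finally show "(\<integral>\<^sup>+(w::complex). ennreal (exp (- \<kappa> * (a - norm w)\<^sup>2)) \<partial>lborel)
        \<le> ennreal (4 * pi * (enn2real I + 1) * (a / sqrt \<kappa> + 1 / \<kappa>))"
      using main[OF \<kappa> a] by (rule order_trans[rotated])
  qed
qed

section \<open>Taylor coefficients of the kernel\<close>

lemma Gamma_real_plus1: "(s::real) > 0 \<Longrightarrow> Gamma (s + 1) = s * Gamma s"
  by (intro Gamma_plus1) (auto elim!: nonpos_Ints_cases)

lemma ln_one_plus_le_cubic:
  fixes t :: real assumes "t \<ge> 0"
  shows "ln (1 + t) \<le> t - t\<^sup>2 / 2 + t ^ 3 / 3"
proof -
  let ?f = "\<lambda>t::real. t - t\<^sup>2 / 2 + t ^ 3 / 3 - ln (1 + t)"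
  have "?f 0 \<le> ?f t"
  proof (rule DERIV_nonneg_imp_nondecreasing[OF assms])
    fix x :: real assume x: "0 \<le> x" "x \<le> t"
    have "(?f has_real_derivative (1 - x + x\<^sup>2 - 1 / (1 + x))) (at x)"
      using x by (auto intro!: derivative_eq_intros simp: field_simps)
    moreover have "1 - x + x\<^sup>2 - 1 / (1 + x) = x ^ 3 / (1 + x)"
      using x by (simp add: field_simps power2_eq_square power3_eq_cube)
    ultimately show "\<exists>y. (?f has_real_derivative y) (at x) \<and> 0 \<le> y"
      using x by (intro exI[of _ "x ^ 3 / (1 + x)"]) simp
  qed
  then show ?thesis by simp
qed

text \<open>The correction \<open>1 / (2 * s)\<close> in \<open>h\<close> makes the error of Stirling's formula increase along
  \<open>s \<mapsto> s + 1\<close>, so that it is bounded below by its minimum over \<open>{1..2}\<close>.\<close>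

lemma Gamma_Stirling_lower_ge_1:
  "\<exists>c>0. \<forall>s\<ge>1. Gamma s \<ge> c * s powr (s - 1/2) * exp (- s :: real)"
proof -
  define h where "h s = ln (Gamma s) - (s - 1/2) * ln s + s - 1 / (2 * s)" for s :: real
  have step: "h s \<le> h (s + 1)" if "s \<ge> 1" for s
  proof -
    define t where "t = 1 / s"
    have t: "0 < t" "t \<le> 1" "s = 1 / t" using that by (auto simp: t_def)
    have "ln (Gamma (s + 1)) = ln s + ln (Gamma s)"
    proof -
      have "Gamma (s + 1) = s * Gamma s"
        using that by (simp add: Gamma_real_plus1)
      moreover have "Gamma s > 0" using that by simp
      ultimately show ?thesis using that by (simp add: ln_mult_pos)
    qed
    moreover have "ln (s + 1) = ln s + ln (1 + t)"
    proof -
      have "s + 1 = s * (1 + t)" using that by (simp add: t_def field_simps)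
      then have "ln (s + 1) = ln (s * (1 + t))" by simp
      also have "\<dots> = ln s + ln (1 + t)" using that t(1) by (intro ln_mult_pos) auto
      finally show ?thesis .
    qed
    ultimately have "h (s + 1) - h s = 1 - (s + 1/2) * ln (1 + t) + 1 / (2 * s) - 1 / (2 * (s + 1))"
      unfolding h_def by (simp add: algebra_simps)
    moreover have "(s + 1/2) * ln (1 + t) \<le> (s + 1/2) * (t - t\<^sup>2 / 2 + t ^ 3 / 3)"
      using that t by (intro mult_left_mono ln_one_plus_le_cubic) auto
    \<comment> \<open>The terms linear in t cancel, so the defect is quadratic. Since t <= 1 it is
      at most t^2 / 4, which the change of the correction covers.\<close>
    moreover have "(s + 1/2) * (t - t\<^sup>2 / 2 + t ^ 3 / 3) = 1 + t\<^sup>2 / 12 + t ^ 3 / 6"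
      using t(1) unfolding t(3) by (simp add: field_simps power2_eq_square power3_eq_cube)
    moreover have "1 / (2 * s) - 1 / (2 * (s + 1)) = t\<^sup>2 / (2 * (1 + t))"
      using t(1) unfolding t(3) by (simp add: field_simps power2_eq_square)
    moreover have "t\<^sup>2 / 12 + t ^ 3 / 6 \<le> t\<^sup>2 / (2 * (1 + t))"
    proof -
      have "t\<^sup>2 / 12 + t ^ 3 / 6 \<le> t\<^sup>2 / 4"
      proof -
        have "t ^ 3 \<le> t\<^sup>2" using t by (simp add: power_decreasing)
        then show ?thesis by simp
      qed
      also have "\<dots> \<le> t\<^sup>2 / (2 * (1 + t))"
        using t by (intro divide_left_mono) auto
      finally show ?thesis .
    qed
    ultimately show ?thesis by linarith
  qed
  have "continuous_on {1..2} h"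
    unfolding h_def by (intro continuous_intros) (auto simp: Gamma_eq_zero_iff elim!: nonpos_Ints_cases)
  then obtain x0 where x0: "x0 \<in> {1..2}" "\<And>y. y \<in> {1..2} \<Longrightarrow> h x0 \<le> h y"
    using continuous_attains_inf[of "{1..2::real}" h] by auto
  have shift: "h x0 \<le> h (s + real m)" if "1 \<le> s" "s \<le> 2" for s m
  proof (induction m)
    case 0 then show ?case using x0 that by simp
  next
    case (Suc m)
    have "h (s + real m) \<le> h (s + real m + 1)" using that by (intro step) simp
    then show ?case using Suc by (simp add: add_ac)
  qed
  have hge: "h x0 \<le> h s" if "s \<ge> 1" for s
  proof -
    define m where "m = nat (\<lfloor>s\<rfloor> - 1)"
    have "real m = of_int \<lfloor>s\<rfloor> - 1" using that by (simp add: m_def)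
    then have "1 \<le> s - real m" "s - real m \<le> 2" by linarith+
    from shift[OF this, of m] show ?thesis by simp
  qed
  show ?thesis
  proof (intro exI[of _ "exp (h x0)"] conjI allI impI)
    fix s :: real assume s: "1 \<le> s"
    have "h x0 \<le> ln (Gamma s) - (s - 1/2) * ln s + s"
      using hge[OF s] s by (simp add: h_def) (smt (verit) divide_nonneg_pos)
    then have "h x0 + (s - 1/2) * ln s - s \<le> ln (Gamma s)" by simp
    then have "exp (h x0 + (s - 1/2) * ln s - s) \<le> exp (ln (Gamma s))" by (subst exp_le_cancel_iff)
    moreover have "exp (h x0 + (s - 1/2) * ln s - s) = exp (h x0) * s powr (s - 1/2) * exp (- s)"
      using s by (simp add: powr_def exp_add[symmetric])
    moreover have "Gamma s > 0" using s by simp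
    ultimately show "exp (h x0) * s powr (s - 1/2) * exp (- s) \<le> Gamma s"
      by (simp only: exp_ln)
  qed simp
qed

text \<open>Arguments below 1 occur because (k + n) / l may be small. There
  \<open>Gamma s = Gamma (s + 1) / s\<close>; the factor exp (-1) pays for the shift in the
  exponential, and 1 / s dominates the power of s.\<close>

lemma Gamma_Stirling_lower:
  "\<exists>c>0. \<forall>s>0. Gamma s \<ge> c * s powr (s - 1/2) * exp (- s :: real)"
proof -
  obtain c where c: "c > 0" "\<And>s. s \<ge> 1 \<Longrightarrow> Gamma s \<ge> c * s powr (s - 1/2) * exp (- s :: real)"
    using Gamma_Stirling_lower_ge_1 by blast
  show ?thesis
  proof (intro exI[of _ "c * exp (-1)"] conjI allI impI)
    fix s :: real assume s: "s > 0"
    show "c * exp (-1) * s powr (s - 1/2) * exp (- s) \<le> Gamma s"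
    proof (cases "s \<ge> 1")
      case True
      have "c * exp (-1) * (s powr (s - 1/2) * exp (- s)) \<le> c * 1 * (s powr (s - 1/2) * exp (- s))"
        using c(1) by (intro mult_right_mono mult_left_mono) auto
      with c(2)[OF True] show ?thesis by (simp add: mult_ac)
    next
      case False
      have "s powr (s - 1/2) \<le> s powr (-1)"
        using False s by (intro powr_mono') auto
      then have "c * exp (-1) * s powr (s - 1/2) * exp (- s) \<le> c * exp (-1) * s powr (-1) * exp (- s)"
        using c(1) by (intro mult_right_mono mult_left_mono) auto
      also have "\<dots> = c * 1 * exp (- (s + 1)) / s"
        using s by (simp add: powr_minus_divide exp_add[symmetric] mult_ac)
      also have "\<dots> \<le> c * (s + 1) powr (s + 1 - 1/2) * exp (- (s + 1)) / s"
        using c(1) s by (intro divide_right_mono mult_right_mono mult_left_mono ge_one_powr_ge_zero) auto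
      also have "\<dots> \<le> Gamma (s + 1) / s"
        using c(2)[of "s + 1"] s by (intro divide_right_mono) auto
      also have "Gamma (s + 1) = s * Gamma s"
        using s by (simp add: Gamma_real_plus1)
      also have "s * Gamma s / s = Gamma s" using s by simp
      finally show ?thesis .
    qed
  qed (use c in auto)
qed

text \<open>The rate function of the Poisson distribution dominates the squared Hellinger distance,
  by ln x <= x - 1 at x = sqrt (X / s). On the square root scale the bump thus has a Gaussian bound
  that holds for all s, not only near X.\<close>

lemma entropy_ge_sqrt_diff:
  fixes s X :: real assumes "s > 0" "X > 0"
  shows "(sqrt s - sqrt X)\<^sup>2 \<le> s * ln (s / X) - s + X"
proof -
  have "ln (sqrt (X / s)) \<le> sqrt (X / s) - 1"
    using assms by (intro ln_le_minus_one) auto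
  moreover have "ln (sqrt (X / s)) = - (ln (s / X) / 2)"
    using assms by (simp add: ln_sqrt ln_div diff_divide_distrib)
  ultimately have "s * ln (s / X) \<ge> s * (2 - 2 * sqrt (X / s))"
    using assms by (intro mult_left_mono) auto
  moreover have "s * sqrt (X / s) = sqrt s * sqrt X"
    using assms by (simp add: real_sqrt_divide field_simps) 
  ultimately show ?thesis using assms
    by (simp add: power2_eq_square algebra_simps)
qed

text \<open>In terms of u = |sqrt s - sqrt X|, both (s / X)^q and the polynomial factor grow at most
  exponentially in u, so the Gaussian factor wins. The lower bound \<open>s0\<close> controls X / s,
  which matters for negative q.\<close>

lemma power_exp_sqrt_bound:
  fixes q s0 :: real assumes "s0 > 0"
  shows "\<exists>C>0. \<forall>X\<ge>1. \<forall>s\<ge>s0.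
     s powr q * exp (- 2 * (sqrt s - sqrt X)\<^sup>2) * (1 + (s - X)\<^sup>2 / X)\<^sup>2 \<le> C * X powr q"
proof -
  \<comment> \<open>\<open>A\<close> is a rate with |ln (sqrt s / sqrt X)| <= A u on either side of
    X. In \<open>B\<close>, the summand 8 comes from the polynomial factor, and B^2 / 8 is the
    maximum of B u - 2 u^2.\<close>
  define A where "A = max 1 (1 / sqrt s0)"
  define B where "B = 2 * \<bar>q\<bar> * A + 8"
  have A: "A \<ge> 1" "1 / sqrt s0 \<le> A" by (auto simp: A_def)
  show ?thesis
  proof (intro exI[of _ "exp (B\<^sup>2 / 8)"] conjI allI impI)
    fix X s :: real assume X: "X \<ge> 1" and s: "s \<ge> s0"
    define u where "u = \<bar>sqrt s - sqrt X\<bar>"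
    have u: "u \<ge> 0" by (simp add: u_def)
    have sp: "s > 0" "sqrt s > 0" "sqrt X \<ge> 1" using s X assms by auto
    have "(s - X)\<^sup>2 / X = u\<^sup>2 * ((sqrt s + sqrt X) / sqrt X)\<^sup>2"
    proof -
      have "s - X = (sqrt s - sqrt X) * (sqrt s + sqrt X)"
        using sp X by (simp add: algebra_simps)
      then show ?thesis using X by (simp add: u_def power_mult_distrib power_divide)
    qed
    also have "\<dots> \<le> u\<^sup>2 * (2 + u)\<^sup>2"
    proof (intro mult_left_mono power_mono)
      have "sqrt s + sqrt X \<le> 2 * sqrt X + u * 1" by (simp add: u_def)
      also have "\<dots> \<le> 2 * sqrt X + u * sqrt X" using u sp by (intro add_left_mono mult_left_mono) auto
      finally show "(sqrt s + sqrt X) / sqrt X \<le> 2 + u" using sp by (simp add: field_simps)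
    qed (use sp in auto)
    finally have "1 + (s - X)\<^sup>2 / X \<le> 1 + (u * (2 + u))\<^sup>2" by (simp add: power_mult_distrib)
    also have "\<dots> \<le> (1 + u * (2 + u))\<^sup>2" using u by (simp add: power2_eq_square algebra_simps)
    also have "\<dots> = (1 + u) ^ 4" by (simp add: power2_eq_square power4_eq_xxxx algebra_simps)
    also have "\<dots> \<le> exp u ^ 4" using u by (intro power_mono) auto
    also have "\<dots> = exp (4 * u)" by (simp flip: exp_of_nat_mult)
    finally have e1: "(1 + (s - X)\<^sup>2 / X)\<^sup>2 \<le> exp (8 * u)"
    proof -
      assume "1 + (s - X)\<^sup>2 / X \<le> exp (4 * u)"
      then have "(1 + (s - X)\<^sup>2 / X)\<^sup>2 \<le> exp (4 * u) ^ 2" using X by (intro power_mono) auto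
      then show ?thesis by (simp flip: exp_of_nat_mult)
    qed
    have le1: "sqrt s / sqrt X \<le> exp (A * u)"
    proof -
      have "sqrt s \<le> sqrt X + u * 1" by (simp add: u_def)
      also have "\<dots> \<le> sqrt X + u * sqrt X" using u sp by (intro add_left_mono mult_left_mono) auto
      finally have "sqrt s / sqrt X \<le> 1 + u" using sp by (simp add: field_simps)
      also have "\<dots> \<le> 1 + A * u" using A u mult_right_mono[of 1 A u] by simp
      also have "\<dots> \<le> exp (A * u)" by simp
      finally show ?thesis .
    qed
    have le2: "sqrt X / sqrt s \<le> exp (A * u)"
    proof -
      have "sqrt X \<le> sqrt s + u" by (simp add: u_def)
      then have "sqrt X / sqrt s \<le> 1 + (1 / sqrt s) * u" using sp by (simp add: field_simps)
      also have "1 / sqrt s \<le> 1 / sqrt s0" using s assms by (intro divide_left_mono) auto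
      also have "\<dots> \<le> A" by (rule A)
      finally have "sqrt X / sqrt s \<le> 1 + A * u" using u by (simp add: mult_right_mono)
      also have "\<dots> \<le> exp (A * u)" by simp
      finally show ?thesis .
    qed
    have "\<bar>ln (sqrt s / sqrt X)\<bar> \<le> A * u"
    proof -
      have "ln (sqrt s / sqrt X) \<le> A * u" using le1 sp by (metis divide_pos_pos less_le_trans ln_exp ln_le_cancel_iff exp_gt_zero zero_less_one)
      moreover have "ln (sqrt X / sqrt s) \<le> A * u" using le2 sp by (metis divide_pos_pos less_le_trans ln_exp ln_le_cancel_iff exp_gt_zero zero_less_one)
      ultimately show ?thesis using sp by (simp add: ln_div)
    qed
    then have "\<bar>ln s - ln X\<bar> \<le> 2 * (A * u)" using sp X by (simp add: ln_div ln_sqrt)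
    then have "q * (ln s - ln X) \<le> \<bar>q\<bar> * (2 * (A * u))"
      by (metis abs_ge_zero abs_le_D1 abs_mult mult_left_mono)
    then have e2: "s powr q \<le> exp (2 * \<bar>q\<bar> * A * u) * X powr q"
      using sp X by (simp add: powr_def exp_add[symmetric] algebra_simps)
    have e3: "(sqrt s - sqrt X)\<^sup>2 = u\<^sup>2" by (simp add: u_def)
    have "s powr q * exp (- 2 * (sqrt s - sqrt X)\<^sup>2) * (1 + (s - X)\<^sup>2 / X)\<^sup>2
       \<le> (exp (2 * \<bar>q\<bar> * A * u) * X powr q) * exp (- 2 * u\<^sup>2) * exp (8 * u)"
      unfolding e3 using e1 e2 by (intro mult_mono) auto
    also have "\<dots> = exp (B * u - 2 * u\<^sup>2) * X powr q"
      by (simp add: B_def exp_add[symmetric] mult_ac) (simp add: exp_add[symmetric] exp_diff exp_minus field_simps)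
    also have "\<dots> \<le> exp (B\<^sup>2 / 8) * X powr q"
    proof (intro mult_right_mono)
      have "0 \<le> 2 * (u - B / 4)\<^sup>2" by simp
      then show "exp (B * u - 2 * u\<^sup>2) \<le> exp (B\<^sup>2 / 8)"
        by (simp add: power2_eq_square field_simps)
    qed simp
    finally show "s powr q * exp (- 2 * (sqrt s - sqrt X)\<^sup>2) * (1 + (s - X)\<^sup>2 / X)\<^sup>2 \<le> exp (B\<^sup>2 / 8) * X powr q" .
  qed simp
qed

text \<open>Comparison with the integral of the Cauchy kernel, whose primitive is arctan. Moving the
  argument by at most 1 / N, hence by at most 1, changes 1 + y^2 by a factor of at most 3.\<close>

lemma sum_cauchy_kernel_le:
  fixes b N :: real assumes N: "N \<ge> 1"
  shows "(\<Sum>k<m. 1 / (1 + ((real k - b) / N)\<^sup>2)) \<le> 3 * pi * N"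
proof -
  define F where "F t = 3 * N * arctan ((t - b) / N)" for t
  have le: "1 / (1 + ((real k - b) / N)\<^sup>2) \<le> F (real (Suc k)) - F (real k)" for k
  proof -
    have der: "(F has_real_derivative 3 / (1 + ((t - b) / N)\<^sup>2)) (at t)" for t
    proof -
      have "((\<lambda>t. arctan ((t - b) / N)) has_real_derivative (1 / N) * inverse (1 + ((t - b) / N)\<^sup>2)) (at t)"
        using N by (auto intro!: derivative_eq_intros)
      from DERIV_cmult[OF this, of "3 * N"] show ?thesis
        unfolding F_def using N by (simp add: inverse_eq_divide)
    qed
    have "\<exists>z. z > real k \<and> z < real (Suc k) \<and> F (real (Suc k)) - F (real k) = (real (Suc k) - real k) * (3 / (1 + ((z - b) / N)\<^sup>2))"
      by (rule MVT2) (use der in auto)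
    then obtain z where z: "z > real k" "z < real (Suc k)"
      and eq: "F (real (Suc k)) - F (real k) = 3 / (1 + ((z - b) / N)\<^sup>2)" by auto
    define y \<delta> where "y = (real k - b) / N" and "\<delta> = (z - real k) / N"
    have zb: "(z - b) / N = y + \<delta>" by (simp add: y_def \<delta>_def flip: add_divide_distrib)
    have \<delta>: "0 \<le> \<delta>" "\<delta> \<le> 1" using z N by (auto simp: \<delta>_def field_simps)
    have "(y + \<delta>)\<^sup>2 \<le> 2 * y\<^sup>2 + 2 * \<delta>\<^sup>2"
      using zero_le_power2[of "y - \<delta>"] by (simp add: power2_eq_square algebra_simps)
    moreover have "\<delta>\<^sup>2 \<le> 1" using \<delta> by (simp add: power_le_one)
    ultimately have "1 + (y + \<delta>)\<^sup>2 \<le> 3 * (1 + y\<^sup>2)" by (smt (verit) zero_le_power2)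
    then have "1 / (1 + y\<^sup>2) \<le> 3 / (1 + (y + \<delta>)\<^sup>2)"
      by (simp add: field_simps add_pos_nonneg)
    then show ?thesis unfolding eq zb by (simp add: y_def)
  qed
  have "(\<Sum>k<m. 1 / (1 + ((real k - b) / N)\<^sup>2)) \<le> (\<Sum>k<m. F (real (Suc k)) - F (real k))"
    by (intro sum_mono le)
  also have "\<dots> = F (real m) - F 0" by (subst sum_lessThan_telescope) simp
  also have "\<dots> = 3 * N * (arctan ((real m - b) / N) - arctan ((0 - b) / N))"
    by (simp add: F_def algebra_simps)
  also have "\<dots> \<le> 3 * N * (pi / 2 - (- (pi / 2)))"
    using N arctan_bounded[of "(real m - b) / N"] arctan_bounded[of "(0 - b) / N"]
    by (intro mult_left_mono) auto
  finally show ?thesis by (simp add: algebra_simps)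
qed

section \<open>The bump and its differences\<close>

text \<open>For n >= 1 these are the coefficients of the (n - 1)-st derivative of the Mittag-Leffler
  type function with terms x^m / Gamma ((m + 1) / l).\<close>

definition fock_coeff :: "nat \<Rightarrow> real \<Rightarrow> nat \<Rightarrow> real" where
  "fock_coeff n l k = fact (n - 1 + k) / fact k / Gamma (real (k + n) / l)"

lemma fact_ratio_le: "fact (m + k) / fact k \<le> (real (m + 1 + k)) ^ m"
proof (induction m)
  case (Suc m)
  have "fact (Suc m + k) / fact k = real (m + 1 + k) * (fact (m + k) / fact k :: real)"
    by simp
  also have "\<dots> \<le> real (m + 1 + k) * real (m + 1 + k) ^ m"
    using Suc by (intro mult_left_mono) auto
  also have "\<dots> = real (m + 1 + k) ^ Suc m" by simp
  also have "\<dots> \<le> real (Suc m + 1 + k) ^ Suc m" by (intro power_mono) auto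
  finally show ?case .
qed simp

lemma fock_coeff_pos: "n \<ge> 1 \<Longrightarrow> l \<ge> 1 \<Longrightarrow> fock_coeff n l k > 0"
  by (auto simp: fock_coeff_def intro!: divide_pos_pos Gamma_real_pos)

text \<open>With s = (k + n) / l the power of the argument is X^(s - n/l), and the quotient of
  factorials is of order s^(n - 1). Stirling's bound replaces Gamma s by s^(s - 1/2) e^(-s), and X^s
  / (s^s e^(-s)) is exp X times the exponential of minus the entropy.\<close>

lemma fock_coeff_term_le:
  fixes l :: real assumes n: "n \<ge> 1" and l: "l \<ge> 1"
  shows "\<exists>C>0. \<forall>X>0. \<forall>k. fock_coeff n l k * (X powr (1 / l)) ^ k
     \<le> C * (real (k + n) / l) powr (real n - 1/2) * X powr (- real n / l) * exp X
         * exp (- (sqrt (real (k + n) / l) - sqrt X)\<^sup>2)"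
proof -
  obtain c where c: "c > 0" "\<And>s. s > 0 \<Longrightarrow> Gamma s \<ge> c * s powr (s - 1/2) * exp (- s :: real)"
    using Gamma_Stirling_lower by blast
  show ?thesis
  proof (intro exI[of _ "l ^ (n - 1) / c"] conjI allI impI)
    fix X :: real and k :: nat assume X: "X > 0"
    define s where "s = real (k + n) / l"
    have s: "s > 0" using n l by (simp add: s_def)
    have "fact (n - 1 + k) / fact k \<le> (real (n - 1 + 1 + k)) ^ (n - 1)" by (rule fact_ratio_le)
    also have "real (n - 1 + 1 + k) = l * s" using n l by (simp add: s_def)
    finally have f: "fact (n - 1 + k) / fact k \<le> l ^ (n - 1) * s powr (real n - 1)"
      using s n by (simp add: power_mult_distrib powr_realpow[symmetric] of_nat_diff)
    have g: "1 / Gamma s \<le> 1 / (c * s powr (s - 1/2) * exp (- s))"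
      using c(2)[OF s] c(1) s by (intro divide_left_mono mult_pos_pos Gamma_real_pos) auto
    have x: "(X powr (1 / l)) ^ k = X powr s * X powr (- real n / l)"
    proof -
      have "(X powr (1 / l)) ^ k = X powr (real k / l)"
        using X by (simp add: powr_realpow[symmetric] powr_powr)
      also have "real k / l = s + (- real n / l)" by (simp add: s_def add_divide_distrib)
      finally show ?thesis by (simp only: powr_add)
    qed
    have e: "X powr s / (s powr s * exp (- s)) \<le> exp X * exp (- (sqrt s - sqrt X)\<^sup>2)"
    proof -
      have "X powr s / (s powr s * exp (- s)) = exp (X - (s * ln (s / X) - s + X))"
        using s X by (simp add: powr_def exp_diff exp_add exp_minus ln_div field_simps)
      also have "\<dots> \<le> exp (X - (sqrt s - sqrt X)\<^sup>2)"
        using entropy_ge_sqrt_diff[OF s X] by simp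
      finally show ?thesis by (simp add: exp_add[symmetric])
    qed
    have "fock_coeff n l k * (X powr (1 / l)) ^ k
        = (fact (n - 1 + k) / fact k) * (1 / Gamma s) * (X powr s * X powr (- real n / l))"
      by (simp add: fock_coeff_def s_def x[unfolded s_def])
    also have "\<dots> \<le> (l ^ (n - 1) * s powr (real n - 1)) * (1 / (c * s powr (s - 1/2) * exp (- s))) * (X powr s * X powr (- real n / l))"
      using f g s l c(1) by (intro mult_right_mono mult_mono) (auto intro!: less_imp_le[OF Gamma_real_pos])
    also have "\<dots> = l ^ (n - 1) / c * s powr (real n - 1/2) * X powr (- real n / l) * (X powr s / (s powr s * exp (- s)))"
    proof -
      have "s powr (real n - 1) / s powr (s - 1/2) = s powr (real n - 1/2) / s powr s"
        using s by (simp add: powr_diff[symmetric] algebra_simps)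
      then show ?thesis using c(1) s by (simp add: field_simps)
    qed
    also have "\<dots> \<le> l ^ (n - 1) / c * s powr (real n - 1/2) * X powr (- real n / l) * (exp X * exp (- (sqrt s - sqrt X)\<^sup>2))"
      using e l c(1) by (intro mult_left_mono) auto
    finally show "fock_coeff n l k * (X powr (1 / l)) ^ k
     \<le> l ^ (n - 1) / c * (real (k + n) / l) powr (real n - 1/2) * X powr (- real n / l) * exp X
         * exp (- (sqrt (real (k + n) / l) - sqrt X)\<^sup>2)"
      by (simp add: s_def mult_ac)
  qed (use c l in auto)
qed

text \<open>Inequalities of Gautschi's type. The point s + t lies between s and s + 1, and s + 1
  lies between s + t and s + t + 1; log-convexity on these two intervals bounds the quotient from
  both sides, with a relative gap of only t / s.\<close>

lemma Gamma_ratio_bounds: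
  fixes s t :: real assumes s: "s > 0" and t: "0 < t" "t \<le> 1"
  shows "s powr (-t) \<le> Gamma s / Gamma (s + t)"
    and "Gamma s / Gamma (s + t) \<le> s powr (-t) * (1 + t / s)"
proof -
  have Gp: "Gamma (u + 1) = u * Gamma u" if "u > 0" for u :: real
    using that by (simp add: Gamma_real_plus1)
  have pos: "Gamma s > 0" "Gamma (s + t) > 0" "Gamma (s + 1) > 0" "Gamma (s + t + 1) > 0"
    using s t by auto
  have nz: "Gamma s \<noteq> 0" "Gamma (s + t) \<noteq> 0" using pos by auto
  have cvx: "ln (Gamma ((1 - v) * x + v * y)) \<le> (1 - v) * ln (Gamma x) + v * ln (Gamma y)"
    if "x > 0" "y > 0" "0 \<le> v" "v \<le> 1" for x y v :: real
    using convex_onD[OF log_convex_Gamma_real, of v x y] that by simp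
  have "ln (Gamma (s + t)) \<le> (1 - t) * ln (Gamma s) + t * ln (Gamma (s + 1))"
    using cvx[of s "s + 1" t] s t by (simp add: algebra_simps)
  also have "\<dots> = ln (Gamma s) + t * ln s"
  proof -
    have "ln (Gamma (s + 1)) = ln s + ln (Gamma s)"
      using s pos by (simp only: Gp ln_mult_pos)
    then show ?thesis by (simp only:) (simp add: algebra_simps)
  qed
  finally have "ln (Gamma (s + t)) \<le> ln (Gamma s * s powr t)"
    using s nz by (simp add: ln_mult ln_powr)
  then have "Gamma (s + t) \<le> Gamma s * s powr t"
    using s pos by (subst (asm) ln_le_cancel_iff) auto
  then show "s powr (-t) \<le> Gamma s / Gamma (s + t)"
    using s pos by (simp add: powr_minus field_simps)
  have "ln (Gamma (s + 1)) \<le> t * ln (Gamma (s + t)) + (1 - t) * ln (Gamma (s + t + 1))"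
    using cvx[of "s + t" "s + t + 1" "1 - t"] s t by (simp add: algebra_simps)
  also have "\<dots> = ln (Gamma (s + t)) + (1 - t) * ln (s + t)"
  proof -
    have "ln (Gamma (s + t + 1)) = ln (s + t) + ln (Gamma (s + t))"
      using s t pos by (subst Gp) (auto simp: ln_mult_pos)
    then show ?thesis by (simp only:) (simp add: algebra_simps)
  qed
  finally have "ln (s * Gamma s) \<le> ln (Gamma (s + t) * (s + t) powr (1 - t))"
    using s t nz Gp[of s] by (simp add: ln_mult ln_powr)
  then have "s * Gamma s \<le> Gamma (s + t) * (s + t) powr (1 - t)"
    using s t pos by (subst (asm) ln_le_cancel_iff) auto
  then have "Gamma s / Gamma (s + t) \<le> (s + t) powr (1 - t) / s"
    using s pos by (simp add: field_simps)
  also have "(s + t) powr (1 - t) = s powr (1 - t) * (1 + t / s) powr (1 - t)"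
  proof -
    have "s + t = s * (1 + t / s)" using s by (simp add: field_simps)
    then show ?thesis using s t powr_mult[of s "1 + t / s" "1 - t"] by simp
  qed
  also have "s powr (1 - t) * (1 + t / s) powr (1 - t) / s = s powr (-t) * (1 + t / s) powr (1 - t)"
    using s by (simp add: powr_diff powr_minus field_simps)
  also have "\<dots> \<le> s powr (-t) * (1 + t / s) powr 1"
    using s t by (intro mult_left_mono powr_mono) auto
  finally show "Gamma s / Gamma (s + t) \<le> s powr (-t) * (1 + t / s)"
    using s t by simp
qed

lemma abs_powr_minus_one_le:
  fixes u t :: real assumes "u > 0" "0 < t" "t \<le> 1"
  shows "\<bar>u powr t - 1\<bar> \<le> \<bar>u - 1\<bar>"
proof (cases "u \<ge> 1")
  case True
  have "u powr t \<le> u powr 1" using True assms by (intro powr_mono) auto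
  moreover have "1 \<le> u powr t" using True assms by (intro ge_one_powr_ge_zero) auto
  ultimately show ?thesis using True by simp
next
  case False
  have "u powr 1 \<le> u powr t" using False assms by (intro powr_mono') auto
  moreover have "u powr t \<le> 1" using False assms by (intro powr_le1) auto
  ultimately show ?thesis using False assms by simp
qed

text \<open>The quotient of consecutive terms is \<open>\<theta> * (X / s) powr t\<close> with t = 1
  / l, where \<open>\<theta>\<close> is 1 + O(1 / s) and the power differs from 1 by at most |X - s|
  / s. On the bump |s - X| is of order sqrt X, so a difference is smaller than a term by the factor
  sqrt X.\<close>

lemma fock_coeff_diff_le:
  fixes l :: real assumes n: "n \<ge> 1" and l: "l \<ge> 1"
  shows "\<exists>C>0. \<forall>X>0. \<forall>k.
     \<bar>fock_coeff n l (Suc k) * (X powr (1 / l)) ^ Suc k - fock_coeff n l k * (X powr (1 / l)) ^ k\<bar>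
     \<le> C * (fock_coeff n l k * (X powr (1 / l)) ^ k)
         * ((\<bar>real (k + n) / l - X\<bar> + 1) / (real (k + n) / l))"
proof -
  \<comment> \<open>\<open>D / s\<close> will bound \<open>\<theta> - 1\<close>: the summand n^2
    comes from the factorials, 1 from the quotient of Gamma values, and n^2 l from their product, as
    1 / s <= l.\<close>
  define D where "D = real n ^ 2 + 1 + real n ^ 2 * l"
  show ?thesis
  proof (intro exI[of _ "1 + D * (1 + l)"] conjI allI impI)
    show "1 + D * (1 + l) > 0" using l by (auto simp: D_def intro!: add_pos_nonneg)
    fix X :: real and k :: nat assume X: "X > 0"
    define s t where "s = real (k + n) / l" and "t = 1 / l"
    have s: "s > 0" using n l by (simp add: s_def)
    have t: "0 < t" "t \<le> 1" using l by (auto simp: t_def)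
    define a where "a = fock_coeff n l k * (X powr t) ^ k"
    have apos: "a > 0" using X fock_coeff_pos[OF n l] by (simp add: a_def)
    define \<eta> where "\<eta> = real (n - 1) / real (k + 1)"
    have st: "real (Suc k + n) / l = s + t" by (simp add: s_def t_def add_divide_distrib)
    have f: "fact (n - 1 + Suc k) / fact (Suc k) = (1 + \<eta>) * (fact (n - 1 + k) / fact k)"
    proof -
      obtain n' where "n = Suc n'" using n by (cases n) auto
      then show ?thesis by (simp add: \<eta>_def field_simps)
    qed
    define \<theta> where "\<theta> = (1 + \<eta>) * (Gamma s / Gamma (s + t)) * s powr t"
    have ratio: "fock_coeff n l (Suc k) * (X powr t) ^ Suc k = a * (\<theta> * (X / s) powr t)"
    proof -
      have "Gamma s \<noteq> 0" using s by (metis Gamma_real_pos less_irrefl)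
      then show ?thesis
        unfolding fock_coeff_def st f a_def \<theta>_def s_def[symmetric]
        using s X by (simp add: powr_divide)
    qed
    have \<eta>: "0 \<le> \<eta>" "\<eta> \<le> real n ^ 2 / s"
    proof -
      show "0 \<le> \<eta>" by (simp add: \<eta>_def)
      have "s \<le> real (k + n) / 1" unfolding s_def using l by (intro divide_left_mono) auto
      also have "real (k + n) / 1 = real (k + n)" by simp
      also have "\<dots> \<le> real n * real (k + 1)"
        using n by (metis (no_types, opaque_lifting) Suc_eq_plus1 add.commute add_mult_distrib2 mult.right_neutral mult_le_mono1 nat_add_left_cancel_le nat_mult_1 of_nat_le_iff of_nat_mult)
      finally have "real (n - 1) * s \<le> real n * (real n * real (k + 1))" using s by (intro mult_mono) auto
      then show "\<eta> \<le> real n ^ 2 / s" using s by (simp add: \<eta>_def field_simps power2_eq_square)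
    qed
    have g: "1 \<le> Gamma s / Gamma (s + t) * s powr t" "Gamma s / Gamma (s + t) * s powr t \<le> 1 + t / s"
      using Gamma_ratio_bounds[OF s t] s by (simp_all add: powr_minus field_simps)
    have "s \<ge> 1 / l" unfolding s_def using n l by (intro divide_right_mono) auto
    then have s1: "1 / s \<le> l" using s l by (simp add: field_simps)
    have th1: "1 \<le> \<theta>" unfolding \<theta>_def using mult_mono[of 1 "1 + \<eta>" 1, OF _ g(1)] \<eta> by (simp add: mult.assoc)
    have "\<theta> \<le> (1 + real n ^ 2 / s) * (1 + t / s)"
      unfolding \<theta>_def mult.assoc using \<eta> g by (intro mult_mono) auto
    also have "\<dots> = 1 + (real n ^ 2 + t + real n ^ 2 * t * (1 / s)) / s"
      using s by (simp add: field_simps)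
    also have "\<dots> \<le> 1 + (real n ^ 2 + 1 + real n ^ 2 * 1 * l) / s"
      using s s1 t by (intro add_left_mono divide_right_mono add_mono mult_mono) auto
    finally have th2: "\<theta> - 1 \<le> D / s" by (simp add: D_def)
    define y where "y = (X / s) powr t"
    have y: "\<bar>y - 1\<bar> \<le> \<bar>X - s\<bar> / s"
    proof -
      have "\<bar>y - 1\<bar> \<le> \<bar>X / s - 1\<bar>" unfolding y_def using s X t by (intro abs_powr_minus_one_le) auto
      also have "\<dots> = \<bar>X - s\<bar> / s" using s by (simp add: field_simps abs_divide diff_divide_distrib[symmetric])
      finally show ?thesis .
    qed
    have "\<bar>\<theta> * y - 1\<bar> \<le> \<bar>y - 1\<bar> + (\<theta> - 1) * (1 + \<bar>y - 1\<bar>)"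
    proof -
      have "\<theta> * y - 1 = (y - 1) + (\<theta> - 1) * (1 + (y - 1))" by (simp add: algebra_simps)
      also have "\<bar>\<dots>\<bar> \<le> \<bar>y - 1\<bar> + \<bar>(\<theta> - 1) * (1 + (y - 1))\<bar>" by (rule abs_triangle_ineq)
      also have "\<bar>(\<theta> - 1) * (1 + (y - 1))\<bar> = (\<theta> - 1) * \<bar>1 + (y - 1)\<bar>" using th1 by (simp add: abs_mult)
      also have "\<dots> \<le> (\<theta> - 1) * (1 + \<bar>y - 1\<bar>)" using th1 by (intro mult_left_mono) auto
      finally show ?thesis by simp
    qed
    also have "\<dots> \<le> \<bar>X - s\<bar> / s + D / s * (1 + \<bar>X - s\<bar> / s)"
      using y th1 th2 s by (intro add_mono mult_mono) (auto simp: D_def)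
    also have "\<dots> \<le> (1 + D * (1 + l)) * ((\<bar>X - s\<bar> + 1) / s)"
    proof -
      have "\<bar>X - s\<bar> * (1 / s) \<le> \<bar>X - s\<bar> * l" using s1 by (intro mult_left_mono) auto
      then have "1 + \<bar>X - s\<bar> / s \<le> (1 + l) * (\<bar>X - s\<bar> + 1)" using l by (simp add: algebra_simps)
      then have "D / s * (1 + \<bar>X - s\<bar> / s) \<le> D / s * ((1 + l) * (\<bar>X - s\<bar> + 1))"
        using s l by (intro mult_left_mono) (auto simp: D_def)
      moreover have "\<bar>X - s\<bar> / s \<le> (\<bar>X - s\<bar> + 1) / s" using s by (intro divide_right_mono) auto
      moreover have "(1 + D * (1 + l)) * ((\<bar>X - s\<bar> + 1) / s)
         = (\<bar>X - s\<bar> + 1) / s + D / s * ((1 + l) * (\<bar>X - s\<bar> + 1))"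
        by (subst distrib_right) (simp add: mult.assoc)
      ultimately show ?thesis by linarith
    qed
    finally have main: "\<bar>\<theta> * y - 1\<bar> \<le> (1 + D * (1 + l)) * ((\<bar>X - s\<bar> + 1) / s)" .
    have "\<bar>fock_coeff n l (Suc k) * (X powr t) ^ Suc k - a\<bar> = a * \<bar>\<theta> * y - 1\<bar>"
    proof -
      have "fock_coeff n l (Suc k) * (X powr t) ^ Suc k - a = a * (\<theta> * y - 1)"
        unfolding ratio y_def[symmetric] by (simp add: right_diff_distrib)
      then show ?thesis using apos by (simp add: abs_mult)
    qed
    also have "\<dots> \<le> a * ((1 + D * (1 + l)) * ((\<bar>X - s\<bar> + 1) / s))"
      using main apos by (intro mult_left_mono) auto
    finally show "\<bar>fock_coeff n l (Suc k) * (X powr (1 / l)) ^ Suc k - fock_coeff n l k * (X powr (1 / l)) ^ k\<bar>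
     \<le> (1 + D * (1 + l)) * (fock_coeff n l k * (X powr (1 / l)) ^ k)
         * ((\<bar>real (k + n) / l - X\<bar> + 1) / (real (k + n) / l))"
      by (simp add: a_def t_def s_def mult_ac abs_minus_commute)
  qed
qed

text \<open>\<open>power_exp_sqrt_bound\<close> controls the square of the factor 1 + (s - X)^2 / X.
  One of the two factors is kept as a Cauchy kernel of width l sqrt X in k, whose sum accounts for
  the additional power 1/2 of X.\<close>

lemma sum_entropy_weights_le:
  fixes l q :: real assumes n: "n \<ge> 1" and l: "l \<ge> 1"
  shows "\<exists>C>0. \<forall>X\<ge>1. \<forall>m. (\<Sum>k<m. (real (k + n) / l) powr q
      * exp (- 2 * (sqrt (real (k + n) / l) - sqrt X)\<^sup>2) * (1 + (real (k + n) / l - X)\<^sup>2 / X))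
     \<le> C * X powr (q + 1/2)"
proof -
  obtain C where C: "C > 0" "\<And>X s. X \<ge> 1 \<Longrightarrow> s \<ge> 1 / l \<Longrightarrow>
     s powr q * exp (- 2 * (sqrt s - sqrt X)\<^sup>2) * (1 + (s - X)\<^sup>2 / X)\<^sup>2 \<le> C * X powr q"
    using power_exp_sqrt_bound[of "1 / l" q] l by auto
  show ?thesis
  proof (intro exI[of _ "C * (3 * pi * l)"] conjI allI impI)
    show "C * (3 * pi * l) > 0" using C l by simp
    fix X :: real and m :: nat assume X: "X \<ge> 1"
    have "(\<Sum>k<m. (real (k + n) / l) powr q
      * exp (- 2 * (sqrt (real (k + n) / l) - sqrt X)\<^sup>2) * (1 + (real (k + n) / l - X)\<^sup>2 / X))
      \<le> (\<Sum>k<m. C * X powr q * (1 / (1 + ((real k - (l * X - real n)) / (l * sqrt X))\<^sup>2)))"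
    proof (rule sum_mono)
      fix k
      define s where "s = real (k + n) / l"
      define w where "w = 1 + (s - X)\<^sup>2 / X"
      have w: "w \<ge> 1" using X by (simp add: w_def)
      have "s \<ge> 1 / l" using n l by (simp add: s_def divide_right_mono)
      from C(2)[OF X this]
      have "s powr q * exp (- 2 * (sqrt s - sqrt X)\<^sup>2) * w * w \<le> C * X powr q"
        by (simp add: w_def power2_eq_square mult_ac)
      then have "s powr q * exp (- 2 * (sqrt s - sqrt X)\<^sup>2) * w \<le> C * X powr q * (1 / w)"
        using w by (simp add: field_simps)
      moreover have "(real k - (l * X - real n)) / (l * sqrt X) = (s - X) / sqrt X"
        using l X by (simp add: s_def field_simps)
      then have "w = 1 + ((real k - (l * X - real n)) / (l * sqrt X))\<^sup>2"
        using X by (simp add: w_def power_divide)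
      ultimately show "(real (k + n) / l) powr q
      * exp (- 2 * (sqrt (real (k + n) / l) - sqrt X)\<^sup>2) * (1 + (real (k + n) / l - X)\<^sup>2 / X)
        \<le> C * X powr q * (1 / (1 + ((real k - (l * X - real n)) / (l * sqrt X))\<^sup>2))"
        by (simp only: s_def w_def)
    qed
    also have "\<dots> = C * X powr q * (\<Sum>k<m. 1 / (1 + ((real k - (l * X - real n)) / (l * sqrt X))\<^sup>2))"
      by (simp add: sum_distrib_left)
    also have "\<dots> \<le> C * X powr q * (3 * pi * (l * sqrt X))"
    proof (intro mult_left_mono sum_cauchy_kernel_le)
      show "1 \<le> l * sqrt X" using mult_mono[of 1 l 1 "sqrt X"] l X by simp
    qed (use C in auto)
    also have "\<dots> = C * (3 * pi * l) * X powr (q + 1/2)"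
      using X by (simp add: powr_add powr_half_sqrt)
    finally show "(\<Sum>k<m. (real (k + n) / l) powr q
      * exp (- 2 * (sqrt (real (k + n) / l) - sqrt X)\<^sup>2) * (1 + (real (k + n) / l - X)\<^sup>2 / X))
       \<le> C * (3 * pi * l) * X powr (q + 1/2)" .
  qed
qed

text \<open>The exponent is that of height squared times width: twice n - n/l - 1/2, plus
  1/2.\<close>

lemma sum_fock_coeff_square_le:
  fixes l :: real assumes n: "n \<ge> 1" and l: "l \<ge> 1"
  shows "\<exists>C>0. \<forall>X\<ge>1. \<forall>m. (\<Sum>k<m. (fock_coeff n l k * (X powr (1 / l)) ^ k)\<^sup>2)
     \<le> C * exp (2 * X) * X powr (2 * real n - 2 * real n / l - 1/2)"
proof -
  obtain A where A: "A > 0" "\<And>X k. X > 0 \<Longrightarrow> fock_coeff n l k * (X powr (1 / l)) ^ k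
     \<le> A * (real (k + n) / l) powr (real n - 1/2) * X powr (- real n / l) * exp X
         * exp (- (sqrt (real (k + n) / l) - sqrt X)\<^sup>2)"
    using fock_coeff_term_le[OF n l] by blast
  obtain B where B: "B > 0" "\<And>X m. X \<ge> 1 \<Longrightarrow> (\<Sum>k<m. (real (k + n) / l) powr (2 * real n - 1)
      * exp (- 2 * (sqrt (real (k + n) / l) - sqrt X)\<^sup>2) * (1 + (real (k + n) / l - X)\<^sup>2 / X))
     \<le> B * X powr (2 * real n - 1 + 1/2)"
    using sum_entropy_weights_le[OF n l] by blast
  show ?thesis
  proof (intro exI[of _ "A\<^sup>2 * B"] conjI allI impI)
    show "A\<^sup>2 * B > 0" using A B by simp
    fix X :: real and m assume X: "X \<ge> 1"
    define P where "P = A\<^sup>2 * X powr (- 2 * real n / l) * exp (2 * X)"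
    have "(\<Sum>k<m. (fock_coeff n l k * (X powr (1 / l)) ^ k)\<^sup>2)
      \<le> (\<Sum>k<m. P * ((real (k + n) / l) powr (2 * real n - 1)
      * exp (- 2 * (sqrt (real (k + n) / l) - sqrt X)\<^sup>2) * (1 + (real (k + n) / l - X)\<^sup>2 / X)))"
    proof (rule sum_mono)
      fix k
      define s where "s = real (k + n) / l"
      define e where "e = (sqrt s - sqrt X)\<^sup>2"
      have s: "s > 0" using n l by (simp add: s_def)
      have p: "(s powr (real n - 1/2))\<^sup>2 = s powr (2 * real n - 1)" "(X powr (- real n / l))\<^sup>2 = X powr (- 2 * real n / l)"
        "(exp X)\<^sup>2 = exp (2 * X)" "(exp (- e))\<^sup>2 = exp (- 2 * e)"
        by (simp_all add: power2_eq_square powr_add[symmetric] exp_add[symmetric])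
      have "(fock_coeff n l k * (X powr (1 / l)) ^ k)\<^sup>2
         \<le> (A * s powr (real n - 1/2) * X powr (- real n / l) * exp X * exp (- e))\<^sup>2"
        using A(2)[of X k] X fock_coeff_pos[OF n l, of k]
        by (intro power_mono) (auto simp: s_def e_def)
      also have "\<dots> = P * (s powr (2 * real n - 1) * exp (- 2 * e) * 1)"
        by (simp only: P_def power_mult_distrib p) (simp add: mult_ac)
      also have "\<dots> \<le> P * (s powr (2 * real n - 1) * exp (- 2 * e) * (1 + (s - X)\<^sup>2 / X))"
        using X by (intro mult_left_mono) (auto simp: P_def)
      finally show "(fock_coeff n l k * (X powr (1 / l)) ^ k)\<^sup>2 \<le> P * ((real (k + n) / l) powr (2 * real n - 1)
      * exp (- 2 * (sqrt (real (k + n) / l) - sqrt X)\<^sup>2) * (1 + (real (k + n) / l - X)\<^sup>2 / X))"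
        by (simp only: s_def e_def)
    qed
    also have "\<dots> = P * (\<Sum>k<m. (real (k + n) / l) powr (2 * real n - 1)
      * exp (- 2 * (sqrt (real (k + n) / l) - sqrt X)\<^sup>2) * (1 + (real (k + n) / l - X)\<^sup>2 / X))"
      by (simp add: sum_distrib_left)
    also have "\<dots> \<le> P * (B * X powr (2 * real n - 1 + 1/2))"
      using B(2)[OF X] by (intro mult_left_mono) (auto simp: P_def)
    also have "\<dots> = A\<^sup>2 * B * exp (2 * X) * (X powr (- 2 * real n / l) * X powr (2 * real n - 1 + 1/2))"
      by (simp add: P_def mult_ac)
    also have "X powr (- 2 * real n / l) * X powr (2 * real n - 1 + 1/2) = X powr (2 * real n - 2 * real n / l - 1/2)"
      by (simp add: powr_add[symmetric] algebra_simps)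
    finally show "(\<Sum>k<m. (fock_coeff n l k * (X powr (1 / l)) ^ k)\<^sup>2)
       \<le> A\<^sup>2 * B * exp (2 * X) * X powr (2 * real n - 2 * real n / l - 1/2)" .
  qed
qed

text \<open>Compared with the sum of squares of the terms, the factor ((|s - X| + 1) / s)^2 gains
  one power of X: the denominator lowers the power of s by 2, and the numerator costs at most 2 X (1
  + (s - X)^2 / X).\<close>

lemma sum_fock_coeff_diff_square_le:
  fixes l :: real assumes n: "n \<ge> 1" and l: "l \<ge> 1"
  shows "\<exists>C>0. \<forall>X\<ge>1. \<forall>m. (\<Sum>k<m. (fock_coeff n l (Suc k) * (X powr (1 / l)) ^ Suc k - fock_coeff n l k * (X powr (1 / l)) ^ k)\<^sup>2)
     \<le> C * exp (2 * X) * X powr (2 * real n - 2 * real n / l - 3/2)"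
proof -
  obtain A where A: "A > 0" "\<And>X k. X > 0 \<Longrightarrow> fock_coeff n l k * (X powr (1 / l)) ^ k
     \<le> A * (real (k + n) / l) powr (real n - 1/2) * X powr (- real n / l) * exp X
         * exp (- (sqrt (real (k + n) / l) - sqrt X)\<^sup>2)"
    using fock_coeff_term_le[OF n l] by blast
  obtain D where D: "D > 0" "\<And>X k. X > 0 \<Longrightarrow>
     \<bar>fock_coeff n l (Suc k) * (X powr (1 / l)) ^ Suc k - fock_coeff n l k * (X powr (1 / l)) ^ k\<bar>
     \<le> D * (fock_coeff n l k * (X powr (1 / l)) ^ k)
         * ((\<bar>real (k + n) / l - X\<bar> + 1) / (real (k + n) / l))"
    using fock_coeff_diff_le[OF n l] by blast
  obtain B where B: "B > 0" "\<And>X m. X \<ge> 1 \<Longrightarrow> (\<Sum>k<m. (real (k + n) / l) powr (2 * real n - 3)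
      * exp (- 2 * (sqrt (real (k + n) / l) - sqrt X)\<^sup>2) * (1 + (real (k + n) / l - X)\<^sup>2 / X))
     \<le> B * X powr (2 * real n - 3 + 1/2)"
    using sum_entropy_weights_le[OF n l] by blast
  show ?thesis
  proof (intro exI[of _ "2 * A\<^sup>2 * D\<^sup>2 * B"] conjI allI impI)
    show "2 * A\<^sup>2 * D\<^sup>2 * B > 0" using A B D by simp
    fix X :: real and m assume X: "X \<ge> 1"
    define P where "P = 2 * D\<^sup>2 * A\<^sup>2 * X powr (- 2 * real n / l) * exp (2 * X) * X"
    have "(\<Sum>k<m. (fock_coeff n l (Suc k) * (X powr (1 / l)) ^ Suc k - fock_coeff n l k * (X powr (1 / l)) ^ k)\<^sup>2)
      \<le> (\<Sum>k<m. P * ((real (k + n) / l) powr (2 * real n - 3)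
      * exp (- 2 * (sqrt (real (k + n) / l) - sqrt X)\<^sup>2) * (1 + (real (k + n) / l - X)\<^sup>2 / X)))"
    proof (rule sum_mono)
      fix k
      define s where "s = real (k + n) / l"
      define e where "e = (sqrt s - sqrt X)\<^sup>2"
      have s: "s > 0" using n l by (simp add: s_def)
      have p: "(s powr (real n - 1/2))\<^sup>2 = s powr (2 * real n - 1)" "(X powr (- real n / l))\<^sup>2 = X powr (- 2 * real n / l)"
        "(exp X)\<^sup>2 = exp (2 * X)" "(exp (- e))\<^sup>2 = exp (- 2 * e)"
        by (simp_all add: power2_eq_square powr_add[symmetric] exp_add[symmetric])
      have "\<bar>fock_coeff n l (Suc k) * (X powr (1 / l)) ^ Suc k - fock_coeff n l k * (X powr (1 / l)) ^ k\<bar>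
         \<le> D * (A * s powr (real n - 1/2) * X powr (- real n / l) * exp X * exp (- e)) * ((\<bar>s - X\<bar> + 1) / s)"
      proof -
        have "D * (fock_coeff n l k * (X powr (1 / l)) ^ k) * ((\<bar>s - X\<bar> + 1) / s)
          \<le> D * (A * s powr (real n - 1/2) * X powr (- real n / l) * exp X * exp (- e)) * ((\<bar>s - X\<bar> + 1) / s)"
          using A(2)[of X k] X s D(1) unfolding e_def
          by (intro mult_right_mono mult_left_mono) (auto simp: s_def[symmetric] simp del: of_nat_add)
        then show ?thesis using D(2)[of X k] X unfolding s_def by linarith
      qed
      then have "(fock_coeff n l (Suc k) * (X powr (1 / l)) ^ Suc k - fock_coeff n l k * (X powr (1 / l)) ^ k)\<^sup>2
         \<le> (D * (A * s powr (real n - 1/2) * X powr (- real n / l) * exp X * exp (- e)) * ((\<bar>s - X\<bar> + 1) / s))\<^sup>2"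
        by (metis abs_ge_zero power2_abs power_mono)
      also have "\<dots> = (D\<^sup>2 * A\<^sup>2 * X powr (- 2 * real n / l) * exp (2 * X)) * (s powr (2 * real n - 1) / s\<^sup>2 * exp (- 2 * e) * (\<bar>s - X\<bar> + 1)\<^sup>2)"
        by (simp only: power_mult_distrib power_divide p) (simp add: mult_ac)
      also have "s powr (2 * real n - 1) / s\<^sup>2 = s powr (2 * real n - 3)"
      proof -
        have "s powr (2 * real n - 1) = s powr (2 * real n - 3) * s powr 2"
          by (simp add: powr_add[symmetric] del: powr_numeral)
        then show ?thesis using s by simp
      qed
      also have "(D\<^sup>2 * A\<^sup>2 * X powr (- 2 * real n / l) * exp (2 * X)) * (s powr (2 * real n - 3) * exp (- 2 * e) * (\<bar>s - X\<bar> + 1)\<^sup>2)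
        \<le> (D\<^sup>2 * A\<^sup>2 * X powr (- 2 * real n / l) * exp (2 * X)) * (s powr (2 * real n - 3) * exp (- 2 * e) * (2 * X * (1 + (s - X)\<^sup>2 / X)))"
      proof (intro mult_left_mono)
        have "(\<bar>s - X\<bar> + 1)\<^sup>2 \<le> 2 * (s - X)\<^sup>2 + 2"
        proof -
          have "(v + 1)\<^sup>2 \<le> 2 * v\<^sup>2 + 2" for v :: real
            using zero_le_power2[of "v - 1"] by (simp add: power2_eq_square algebra_simps)
          from this[of "\<bar>s - X\<bar>"] show ?thesis by simp
        qed
        also have "\<dots> \<le> 2 * X * (1 + (s - X)\<^sup>2 / X)" using X by (simp add: field_simps)
        finally show "(\<bar>s - X\<bar> + 1)\<^sup>2 \<le> 2 * X * (1 + (s - X)\<^sup>2 / X)" .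
      qed auto
      also have "\<dots> = P * (s powr (2 * real n - 3) * exp (- 2 * e) * (1 + (s - X)\<^sup>2 / X))"
        by (simp add: P_def mult_ac)
      finally show "(fock_coeff n l (Suc k) * (X powr (1 / l)) ^ Suc k - fock_coeff n l k * (X powr (1 / l)) ^ k)\<^sup>2
        \<le> P * ((real (k + n) / l) powr (2 * real n - 3)
      * exp (- 2 * (sqrt (real (k + n) / l) - sqrt X)\<^sup>2) * (1 + (real (k + n) / l - X)\<^sup>2 / X))"
        by (simp only: s_def e_def)
    qed
    also have "\<dots> = P * (\<Sum>k<m. (real (k + n) / l) powr (2 * real n - 3)
      * exp (- 2 * (sqrt (real (k + n) / l) - sqrt X)\<^sup>2) * (1 + (real (k + n) / l - X)\<^sup>2 / X))"
      by (simp add: sum_distrib_left)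
    also have "\<dots> \<le> P * (B * X powr (2 * real n - 3 + 1/2))"
      using B(2)[OF X] X by (intro mult_left_mono) (auto simp: P_def)
    also have "\<dots> = 2 * A\<^sup>2 * D\<^sup>2 * B * exp (2 * X) * (X powr (- 2 * real n / l) * X powr 1 * X powr (2 * real n - 3 + 1/2))"
      using X by (simp add: P_def mult_ac)
    also have "X powr (- 2 * real n / l) * X powr 1 * X powr (2 * real n - 3 + 1/2) = X powr (2 * real n - 2 * real n / l - 3/2)"
      by (simp add: powr_add[symmetric] algebra_simps del: powr_one powr_one')
    finally show "(\<Sum>k<m. (fock_coeff n l (Suc k) * (X powr (1 / l)) ^ Suc k - fock_coeff n l k * (X powr (1 / l)) ^ k)\<^sup>2)
       \<le> 2 * A\<^sup>2 * D\<^sup>2 * B * exp (2 * X) * X powr (2 * real n - 2 * real n / l - 3/2)" .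
  qed
qed

section \<open>Circle means of the kernel\<close>

definition fock_series :: "nat \<Rightarrow> real \<Rightarrow> complex \<Rightarrow> complex" where
  "fock_series n l x = (\<Sum>k. of_real (fock_coeff n l k) * x ^ k)"

text \<open>The maximum of |\<open>fock_series\<close>| on the circle of radius r, since the
  coefficients are positive. It dominates the series and its derivative under integrals.\<close>

definition fock_growth :: "nat \<Rightarrow> real \<Rightarrow> real \<Rightarrow> real" where
  "fock_growth n l r = (\<Sum>k. fock_coeff n l k * r ^ k)"

text \<open>A single squared term is at most the sum of the squares. The power of X is absorbed by
  increasing the rate of the exponential.\<close>

lemma fock_coeff_term_geometric:
  fixes l :: real assumes n: "n \<ge> 1" and l: "l \<ge> 1"
  shows "\<exists>A>0. \<exists>B>0. \<forall>r\<ge>1. \<forall>k. fock_coeff n l k * r ^ k \<le> A * exp (B * r powr l)"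
proof -
  define e where "e = 2 * real n - 2 * real n / l - 1/2"
  obtain C where C: "C > 0" "\<And>X m. X \<ge> 1 \<Longrightarrow> (\<Sum>k<m. (fock_coeff n l k * (X powr (1 / l)) ^ k)\<^sup>2)
     \<le> C * exp (2 * X) * X powr e"
    using sum_fock_coeff_square_le[OF n l] unfolding e_def by blast
  have key: "fock_coeff n l k * r ^ k \<le> (1 + C) * exp ((2 + \<bar>e\<bar>) * r powr l)" if r: "r \<ge> 1" for r k
  proof -
    define X where "X = r powr l"
    have X: "X \<ge> 1" using r l by (simp add: X_def ge_one_powr_ge_zero)
    have rX: "X powr (1 / l) = r" using r l by (simp add: X_def powr_powr)
    have "(fock_coeff n l k * r ^ k)\<^sup>2 \<le> (\<Sum>k<Suc k. (fock_coeff n l k * r ^ k)\<^sup>2)"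
      by (simp add: sum_nonneg)
    also have "\<dots> \<le> C * exp (2 * X) * X powr e" using C(2)[OF X, of "Suc k"] by (simp only: rX)
    also have "X powr e \<le> exp (\<bar>e\<bar> * X)"
    proof -
      have "e * ln X \<le> \<bar>e\<bar> * X"
        using X ln_le_minus_one[of X] by (intro mult_mono) (auto intro: ln_ge_zero)
      then show ?thesis using X by (simp add: powr_def)
    qed
    finally have "(fock_coeff n l k * r ^ k)\<^sup>2 \<le> C * exp ((2 + \<bar>e\<bar>) * X)"
      using C by (simp add: exp_add distrib_right mult.assoc)
    also have "\<dots> \<le> (1 + C)\<^sup>2 * (exp ((2 + \<bar>e\<bar>) * X))\<^sup>2"
    proof (intro mult_mono)
      show "C \<le> (1 + C)\<^sup>2" using C by (simp add: power2_eq_square algebra_simps)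
      have "exp ((2 + \<bar>e\<bar>) * X) \<ge> 1" using X by simp
      then show "exp ((2 + \<bar>e\<bar>) * X) \<le> (exp ((2 + \<bar>e\<bar>) * X))\<^sup>2"
        by (simp add: power2_eq_square)
    qed (use C in auto)
    finally have "(fock_coeff n l k * r ^ k)\<^sup>2 \<le> ((1 + C) * exp ((2 + \<bar>e\<bar>) * X))\<^sup>2"
      by (simp add: power_mult_distrib)
    then show "fock_coeff n l k * r ^ k \<le> (1 + C) * exp ((2 + \<bar>e\<bar>) * r powr l)"
      using C by (intro power2_le_imp_le[of "fock_coeff n l k * r ^ k"]) (auto simp: X_def)
  qed
  moreover have "1 + C > 0" "2 + \<bar>e\<bar> > 0" using C by auto
  ultimately show ?thesis by blast
qed

text \<open>The bound of each term at the radius 2 R leaves a factor 2^(-k), which makes the terms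
  summable. An unspecified rate B is good enough: for fixed z it multiplies |w|^l, against a weight
  with |w|^(2l).\<close>

lemma fock_growth_bound:
  fixes l :: real assumes n: "n \<ge> 1" and l: "l \<ge> 1"
  shows "\<exists>A>0. \<exists>B>0. \<forall>r\<ge>0. summable (\<lambda>k. fock_coeff n l k * r ^ k)
     \<and> fock_growth n l r \<le> A * exp (B * r powr l)"
proof -
  obtain A B where AB: "A > 0" "B > 0" "\<And>r k. r \<ge> 1 \<Longrightarrow> fock_coeff n l k * r ^ k \<le> A * exp (B * r powr l)"
    using fock_coeff_term_geometric[OF n l] by blast
  note cpos = fock_coeff_pos[OF n l]
  define A' where "A' = 2 * A * exp (B * 2 powr l)"
  have main: "summable (\<lambda>k. fock_coeff n l k * r ^ k) \<and> fock_growth n l r \<le> A' * exp ((B * 2 powr l) * r powr l)"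
    if r: "r \<ge> 0" for r
  proof -
    define R where "R = max 1 r"
    have R: "R \<ge> 1" "R \<ge> r" by (auto simp: R_def)
    have le: "fock_coeff n l k * r ^ k \<le> A * exp (B * (2 * R) powr l) * (1/2) ^ k" for k
    proof -
      have "fock_coeff n l k * r ^ k \<le> fock_coeff n l k * R ^ k"
        using r R cpos[of k] by (intro mult_left_mono power_mono) auto
      also have "\<dots> = (fock_coeff n l k * (2 * R) ^ k) * (1/2) ^ k"
        by (simp add: power_mult_distrib power_divide)
      also have "\<dots> \<le> (A * exp (B * (2 * R) powr l)) * (1/2) ^ k"
        using AB(3)[of "2 * R" k] R by (intro mult_right_mono) auto
      finally show ?thesis .
    qed
    have geo: "(\<lambda>k. A * exp (B * (2 * R) powr l) * (1/2::real) ^ k) sums (A * exp (B * (2 * R) powr l) * 2)"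
      using sums_mult[OF geometric_sums[of "1/2::real"], of "A * exp (B * (2 * R) powr l)"] by simp
    have sm: "summable (\<lambda>k. fock_coeff n l k * r ^ k)"
      using le r cpos
      by (intro summable_comparison_test'[OF sums_summable[OF geo]])
         (auto simp: abs_mult less_imp_le)
    have "fock_growth n l r \<le> A * exp (B * (2 * R) powr l) * 2"
      unfolding fock_growth_def using sums_le[OF le summable_sums[OF sm] geo] .
    also have "\<dots> \<le> A' * exp ((B * 2 powr l) * r powr l)"
    proof -
      have "R powr l \<le> 1 + r powr l" using r l by (auto simp: R_def max_def)
      then have "(2 * R) powr l \<le> 2 powr l * (1 + r powr l)"
        using R by (simp add: powr_mult mult_left_mono)
      then have "B * (2 * R) powr l \<le> B * 2 powr l + B * 2 powr l * r powr l"
        using AB(2) mult_left_mono[of _ _ B] by (fastforce simp: algebra_simps)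
      then have "exp (B * (2 * R) powr l) \<le> exp (B * 2 powr l) * exp (B * 2 powr l * r powr l)"
        by (simp add: exp_add[symmetric])
      then show ?thesis using AB by (simp add: A'_def)
    qed
    finally show ?thesis using sm by blast
  qed
  moreover have "A' > 0" "B * 2 powr l > 0" using AB by (auto simp: A'_def)
  ultimately show ?thesis by blast
qed

context
  fixes n :: nat and l :: real
  assumes n: "n \<ge> 1" and l: "l \<ge> 1"
begin

lemma summable_fock_growth: "r \<ge> 0 \<Longrightarrow> summable (\<lambda>k. fock_coeff n l k * r ^ k)"
  using fock_growth_bound[OF n l] by blast

lemma fock_growth_nonneg: "r \<ge> 0 \<Longrightarrow> fock_growth n l r \<ge> 0"
  unfolding fock_growth_def using fock_coeff_pos[OF n l]
  by (intro suminf_nonneg summable_fock_growth) (auto simp: less_imp_le)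

lemma fock_growth_mono: "0 \<le> r \<Longrightarrow> r \<le> s \<Longrightarrow> fock_growth n l r \<le> fock_growth n l s"
  unfolding fock_growth_def using fock_coeff_pos[OF n l]
  by (intro suminf_le summable_fock_growth mult_left_mono power_mono) (auto simp: less_imp_le)

lemma summable_norm_fock_series: "summable (\<lambda>k. norm (of_real (fock_coeff n l k) * x ^ k :: complex))"
  using summable_fock_growth[of "norm x"] fock_coeff_pos[OF n l]
  by (simp add: norm_mult norm_power less_imp_le)

lemma summable_fock_series: "summable (\<lambda>k. of_real (fock_coeff n l k) * x ^ k :: complex)"
  by (rule summable_norm_cancel[OF summable_norm_fock_series])

lemma norm_fock_series_le: "norm (fock_series n l x) \<le> fock_growth n l (norm x)"
proof -
  have "norm (fock_series n l x) \<le> (\<Sum>k. norm (of_real (fock_coeff n l k) * x ^ k :: complex))"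
    unfolding fock_series_def by (rule summable_norm[OF summable_norm_fock_series])
  also have "\<dots> = fock_growth n l (norm x)"
    using fock_coeff_pos[OF n l] by (simp add: fock_growth_def norm_mult norm_power less_imp_le)
  finally show ?thesis .
qed

lemma fock_series_cnj: "fock_series n l (cnj x) = cnj (fock_series n l x)"
  using sums_cnj[THEN iffD2, OF summable_sums[OF summable_fock_series[of x]]]
  unfolding fock_series_def by (simp add: sums_iff)

lemma continuous_on_fock_growth: "continuous_on {0..} (fock_growth n l)"
proof -
  have "isCont (\<lambda>x::real. \<Sum>k. fock_coeff n l k * x ^ k) r" for r
    using summable_fock_growth[of "\<bar>r\<bar> + 1"] by (intro isCont_powser) auto
  then show ?thesis unfolding fock_growth_def[abs_def] by (intro continuous_at_imp_continuous_on) auto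
qed

lemma continuous_on_fock_series: "continuous_on UNIV (fock_series n l)"
proof -
  have "isCont (\<lambda>x::complex. \<Sum>k. of_real (fock_coeff n l k) * x ^ k) x" for x
    using summable_fock_series[of "of_real (norm x + 1)"] by (intro isCont_powser) auto
  then show ?thesis unfolding fock_series_def[abs_def] by (intro continuous_at_imp_continuous_on) auto
qed

end

section \<open>Integration over the unit circle\<close>

abbreviation unit_interval :: "real measure" where
  "unit_interval \<equiv> restrict_space lborel {0..1}"

definition circ :: "real \<Rightarrow> complex" where "circ t = cis (2 * pi * t)"

lemma norm_circ [simp]: "norm (circ t) = 1" by (simp add: circ_def)

lemma continuous_on_circ [continuous_intros]:
  "continuous_on A f \<Longrightarrow> continuous_on A (\<lambda>x. circ (f x))"
  unfolding circ_def by (intro continuous_intros)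

lemma borel_measurable_circ [measurable]: "circ \<in> borel_measurable borel"
  by (intro borel_measurable_continuous_onI continuous_intros)

lemma space_unit_interval [simp]: "space unit_interval = {0..1}"
  by (simp add: space_restrict_space)

lemma prob_space_unit_interval: "prob_space unit_interval"
  by (rule prob_spaceI) (simp add: emeasure_restrict_space space_restrict_space)

lemma borel_measurable_unit_interval [measurable (raw)]:
  "f \<in> borel_measurable borel \<Longrightarrow> f \<in> borel_measurable unit_interval"
  by (simp add: measurable_restrict_space1)

lemma measurable_unit_interval_borel: "(\<lambda>x. x) \<in> measurable unit_interval borel"
  by (simp add: measurable_restrict_space1)

lemma nn_integral_unit_interval_const [simp]: "(\<integral>\<^sup>+t. c \<partial>unit_interval) = c"
  using prob_space.emeasure_space_1[OF prob_space_unit_interval] by simp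

lemma integrable_unit_interval:
  fixes f :: "real \<Rightarrow> 'a::{banach, second_countable_topology}"
  assumes "continuous_on UNIV f"
  shows "integrable unit_interval f"
proof -
  interpret prob_space unit_interval by (rule prob_space_unit_interval)
  have "bounded (f ` {0..1})"
    by (intro compact_imp_bounded compact_continuous_image continuous_on_subset[OF assms]) auto
  then obtain B where "\<forall>x\<in>{0..1}. norm (f x) \<le> B" by (auto simp: bounded_iff)
  then show ?thesis
    using assms by (intro integrable_const_bound[of _ B])
      (auto intro: borel_measurable_continuous_onI borel_measurable_unit_interval)
qed

lemma circ_add: "circ (s + t) = circ s * circ t"
  by (simp add: circ_def cis_mult distrib_left)

lemma circ_power: "circ t ^ k = circ (real k * t)"
  by (simp only: circ_def Complex.DeMoivre) (simp add: mult_ac)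

lemma cnj_circ: "cnj (circ t) = circ (- t)"
  by (simp add: circ_def cis_cnj)

lemma integral_circ_int: "(\<integral>t. circ (of_int k * t) \<partial>unit_interval) = (if k = 0 then 1 else 0)"
proof (cases "k = 0")
  case True
  then show ?thesis using prob_space.prob_space[OF prob_space_unit_interval] by (simp add: circ_def)
next
  case False
  define a where "a = 2 * pi * of_int k"
  have a: "a \<noteq> 0" using False by (simp add: a_def)
  have c: "circ (of_int k * t) = cis (a * t)" for t by (simp add: circ_def a_def mult_ac)
  have "(\<integral>t. circ (of_int k * t) \<partial>unit_interval) = (\<integral>t. indicator {0..1} t *\<^sub>R cis (a * t) \<partial>lborel)"
    unfolding c by (subst integral_restrict_space) auto
  also have "\<dots> = cis (a * 1) / (\<i> * of_real a) - cis (a * 0) / (\<i> * of_real a)"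
  proof (rule integral_FTC_Icc)
    fix x :: real
    have "((\<lambda>x. exp (\<i> * of_real (a * x)) / (\<i> * of_real a)) has_vector_derivative exp (\<i> * of_real (a * x))) (at x within {0..1})"
    proof -
      have "((\<lambda>z. exp (\<i> * of_real a * z) / (\<i> * of_real a)) has_field_derivative exp (\<i> * of_real a * of_real x)) (at (of_real x))"
        using a by (auto intro!: derivative_eq_intros)
      from has_vector_derivative_real_field[OF this] show ?thesis by (simp add: mult_ac)
    qed
    then show "((\<lambda>x. cis (a * x) / (\<i> * of_real a)) has_vector_derivative cis (a * x)) (at x within {0..1})"
      by (simp add: cis_conv_exp)
  qed (auto intro!: continuous_intros)
  also have "\<dots> = 0" by (simp add: a_def cis_multiple_2pi)
  finally show ?thesis using False by simp
qed

lemma nn_integral_circ_polynomial: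
  fixes d :: "nat \<Rightarrow> complex"
  shows "(\<integral>\<^sup>+t. ennreal ((norm (\<Sum>k<m. d k * circ t ^ k))\<^sup>2) \<partial>unit_interval) = ennreal (\<Sum>k<m. (norm (d k))\<^sup>2)"
proof -
  let ?F = "\<lambda>t. \<Sum>k<m. d k * circ t ^ k"
  have int: "integrable unit_interval (\<lambda>t. (norm (?F t))\<^sup>2)"
    by (intro integrable_unit_interval continuous_intros)
  have "complex_of_real (\<integral>t. (norm (?F t))\<^sup>2 \<partial>unit_interval)
      = (\<integral>t. complex_of_real ((norm (?F t))\<^sup>2) \<partial>unit_interval)"
    by (rule integral_complex_of_real[symmetric])
  also have "\<dots> = (\<integral>t. (\<Sum>j<m. \<Sum>k<m. d j * cnj (d k) * circ (of_int (int j - int k) * t)) \<partial>unit_interval)"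
  proof (rule Bochner_Integration.integral_cong[OF refl])
    fix t
    have "complex_of_real ((norm (?F t))\<^sup>2) = ?F t * cnj (?F t)" by (rule complex_norm_square)
    also have "\<dots> = (\<Sum>j<m. \<Sum>k<m. (d j * circ t ^ j) * (cnj (d k) * cnj (circ t) ^ k))"
      by (simp add: sum_product)
    also have "\<dots> = (\<Sum>j<m. \<Sum>k<m. d j * cnj (d k) * circ (of_int (int j - int k) * t))"
      by (intro sum.cong refl) (simp add: cnj_circ circ_power circ_add[symmetric] algebra_simps)
    finally show "complex_of_real ((norm (?F t))\<^sup>2) = (\<Sum>j<m. \<Sum>k<m. d j * cnj (d k) * circ (of_int (int j - int k) * t))" .
  qed
  also have "\<dots> = (\<Sum>j<m. \<Sum>k<m. \<integral>t. d j * cnj (d k) * circ (of_int (int j - int k) * t) \<partial>unit_interval)"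
    by (subst Bochner_Integration.integral_sum, (intro integrable_unit_interval continuous_intros)[1],
        subst Bochner_Integration.integral_sum, (intro integrable_unit_interval continuous_intros)[1]) simp
  also have "\<dots> = (\<Sum>j<m. \<Sum>k<m. d j * cnj (d k) * (if j = k then 1 else 0))"
    by (subst integral_mult_right_zero, subst integral_circ_int) (simp add: if_distrib cong: if_cong)
  also have "\<dots> = (\<Sum>j<m. d j * cnj (d j))" by (simp add: sum.delta if_distrib cong: if_cong)
  also have "\<dots> = complex_of_real (\<Sum>k<m. (norm (d k))\<^sup>2)" by (simp only: complex_norm_square of_real_sum)
  finally have "(\<integral>t. (norm (?F t))\<^sup>2 \<partial>unit_interval) = (\<Sum>k<m. (norm (d k))\<^sup>2)"
    by (simp only: of_real_eq_iff)
  then show ?thesis using nn_integral_eq_integral[OF int] by simp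
qed

text \<open>Only the Bessel half of Parseval's identity is needed, so Fatou's lemma suffices.\<close>

lemma nn_integral_circ_series_le:
  fixes d :: "nat \<Rightarrow> complex"
  assumes conv: "\<And>t. (\<lambda>k. d k * circ t ^ k) sums F t"
    and S: "\<And>m. (\<Sum>k<m. (norm (d k))\<^sup>2) \<le> S"
  shows "(\<integral>\<^sup>+t. ennreal ((norm (F t))\<^sup>2) \<partial>unit_interval) \<le> ennreal S"
proof -
  have "(\<integral>\<^sup>+t. ennreal ((norm (F t))\<^sup>2) \<partial>unit_interval)
     = (\<integral>\<^sup>+t. liminf (\<lambda>m. ennreal ((norm (\<Sum>k<m. d k * circ t ^ k))\<^sup>2)) \<partial>unit_interval)"
  proof (rule nn_integral_cong)
    fix t
    have "(\<lambda>m. ennreal ((norm (\<Sum>k<m. d k * circ t ^ k))\<^sup>2)) \<longlonglongrightarrow> ennreal ((norm (F t))\<^sup>2)"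
      using conv[of t] unfolding sums_def by (intro tendsto_ennrealI tendsto_intros)
    then show "ennreal ((norm (F t))\<^sup>2) = liminf (\<lambda>m. ennreal ((norm (\<Sum>k<m. d k * circ t ^ k))\<^sup>2))"
      by (intro lim_imp_Liminf[symmetric]) auto
  qed
  also have "\<dots> \<le> liminf (\<lambda>m. \<integral>\<^sup>+t. ennreal ((norm (\<Sum>k<m. d k * circ t ^ k))\<^sup>2) \<partial>unit_interval)"
    by (intro nn_integral_liminf) measurable
  also have "\<dots> = liminf (\<lambda>m. ennreal (\<Sum>k<m. (norm (d k))\<^sup>2))"
    by (simp only: nn_integral_circ_polynomial)
  also have "\<dots> \<le> liminf (\<lambda>m. ennreal S)"
    by (intro Liminf_mono always_eventually allI ennreal_leI S)
  also have "\<dots> = ennreal S" by (simp add: Liminf_const)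
  finally show ?thesis .
qed

text \<open>The norm is 2 |sin (pi v)|. For x = pi |v|, which is at most 2, Taylor's bound sin x >=
  x - x^3 / 6 gives sin x >= x / 3 >= |v|.\<close>

lemma norm_one_minus_circ_ge:
  assumes "\<bar>v\<bar> \<le> 1/2"
  shows "v\<^sup>2 \<le> (norm (1 - circ v))\<^sup>2"
proof -
  define x where "x = pi * \<bar>v\<bar>"
  have pi: "pi > 3" "pi < 4" using pi_approx by auto
  have x: "0 \<le> x" "x \<le> 2" using assms mult_mono[of pi 4 "\<bar>v\<bar>" "1/2"] pi by (auto simp: x_def)
  have "\<bar>sin x - (\<Sum>m<3. sin_coeff m * x ^ m)\<bar> \<le> inverse (fact 3) * \<bar>x\<bar> ^ 3"
    by (rule Maclaurin_sin_bound)
  then have "\<bar>sin x - x\<bar> \<le> x ^ 3 / 6"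
    using x by (simp add: numeral_eq_Suc sin_coeff_def fact_numeral)
  then have "x - x ^ 3 / 6 \<le> sin x" by linarith
  moreover have "x ^ 3 \<le> 4 * x"
    using mult_mono[of x 2 x 2] x mult_right_mono[of "x * x" 4 x] by (simp add: power3_eq_cube)
  ultimately have "x / 3 \<le> sin x" by simp
  moreover have "\<bar>v\<bar> \<le> x / 3" using pi mult_right_mono[of 3 pi "\<bar>v\<bar>"] by (simp add: x_def)
  ultimately have "\<bar>v\<bar>\<^sup>2 \<le> (sin x)\<^sup>2" by (intro power_mono) auto
  moreover have "(norm (1 - circ v))\<^sup>2 = 4 * (sin x)\<^sup>2"
  proof -
    have "(norm (1 - circ v))\<^sup>2 = (1 - cos (2 * (pi * v)))\<^sup>2 + (sin (2 * (pi * v)))\<^sup>2"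
      by (simp add: circ_def cmod_power2 mult_ac)
    also have "\<dots> = 2 - 2 * cos (2 * (pi * v))"
      using sin_cos_squared_add[of "2 * (pi * v)"] by (simp add: power2_eq_square algebra_simps)
    also have "\<dots> = 4 * (sin (pi * v))\<^sup>2" by (simp add: cos_double_sin)
    also have "(sin (pi * v))\<^sup>2 = (sin x)\<^sup>2"
      by (cases "v \<ge> 0") (auto simp: x_def)
    finally show ?thesis .
  qed
  ultimately have "v\<^sup>2 \<le> (sin x)\<^sup>2" "(norm (1 - circ v))\<^sup>2 = 4 * (sin x)\<^sup>2" by simp_all
  moreover have "(sin x)\<^sup>2 \<le> 4 * (sin x)\<^sup>2" by simp
  ultimately show ?thesis by (simp only:)
qed

lemma circ_shift_int: "circ (v - real j) = circ v"
proof -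
  have "circ (v - real j) = circ v * circ (- real j)" by (simp flip: circ_add)
  also have "circ (- real j) = 1" using cis_multiple_2pi[of "- real j"] by (simp add: circ_def)
  finally show ?thesis by simp
qed

lemma nn_integral_cauchy_le:
  assumes "X > 0"
  shows "(\<integral>\<^sup>+t. ennreal (1 / (1 + X * (t - b)\<^sup>2)) \<partial>unit_interval) \<le> ennreal (pi / sqrt X)"
proof -
  let ?F = "\<lambda>t. arctan (sqrt X * (t - b)) / sqrt X"
  have "(\<integral>\<^sup>+t. ennreal (1 / (1 + X * (t - b)\<^sup>2)) \<partial>unit_interval)
      = (\<integral>\<^sup>+t. ennreal (1 / (1 + X * (t - b)\<^sup>2)) * indicator {0..1} t \<partial>lborel)"
    by (subst nn_integral_restrict_space) auto
  also have "\<dots> = ennreal (?F 1 - ?F 0)"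
  proof (rule nn_integral_FTC_Icc)
    fix t :: real
    have "((\<lambda>t. arctan (sqrt X * (t - b))) has_real_derivative sqrt X * inverse (1 + (sqrt X * (t - b))\<^sup>2)) (at t)"
      by (auto intro!: derivative_eq_intros)
    from DERIV_cdivide[OF this, of "sqrt X"]
    have "(?F has_real_derivative 1 / (1 + X * (t - b)\<^sup>2)) (at t)"
      using assms by (simp add: power_mult_distrib inverse_eq_divide)
    then show "(?F has_real_derivative 1 / (1 + X * (t - b)\<^sup>2)) (at t)" .
  qed (use assms in auto)
  also have "?F 1 - ?F 0 = (arctan (sqrt X * (1 - b)) - arctan (sqrt X * (0 - b))) / sqrt X"
    by (simp add: diff_divide_distrib)
  also have "\<dots> \<le> pi / sqrt X"
    using assms arctan_bounded[of "sqrt X * (1 - b)"] arctan_bounded[of "sqrt X * (0 - b)"]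
    by (intro divide_right_mono) auto
  finally show ?thesis by (auto intro: ennreal_leI order_trans)
qed

text \<open>The sum \<open>t + \<tau>\<close> stays in [0, 2], hence within 1/2 of 0, 1 or 2. Near
  each of these the weight is at least that of a Cauchy kernel, whose mass is at most pi / sqrt
  X.\<close>

lemma nn_integral_inverse_circ_weight_le:
  assumes X: "X > 0" and \<tau>: "0 \<le> \<tau>" "\<tau> \<le> 1"
  shows "(\<integral>\<^sup>+t. ennreal (1 / (1 + X * (norm (1 - circ (t + \<tau>)))\<^sup>2)) \<partial>unit_interval) \<le> ennreal (3 * pi / sqrt X)"
proof -
  have "(\<integral>\<^sup>+t. ennreal (1 / (1 + X * (norm (1 - circ (t + \<tau>)))\<^sup>2)) \<partial>unit_interval)
     \<le> (\<integral>\<^sup>+t. ennreal (1 / (1 + X * (t - (0 - \<tau>))\<^sup>2)) + ennreal (1 / (1 + X * (t - (1 - \<tau>))\<^sup>2))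
            + ennreal (1 / (1 + X * (t - (2 - \<tau>))\<^sup>2)) \<partial>unit_interval)"
  proof (rule nn_integral_mono)
    fix t assume "t \<in> space unit_interval"
    then have t: "0 \<le> t" "t \<le> 1" by auto
    have tm: "1 / (1 + X * (norm (1 - circ (t + \<tau>)))\<^sup>2) \<le> 1 / (1 + X * (t - (real j - \<tau>))\<^sup>2)"
      if "\<bar>t + \<tau> - real j\<bar> \<le> 1/2" for j
    proof -
      have "(t - (real j - \<tau>))\<^sup>2 \<le> (norm (1 - circ (t + \<tau>)))\<^sup>2"
        using norm_one_minus_circ_ge[OF that] by (simp add: circ_shift_int algebra_simps)
      then show ?thesis using X by (intro divide_left_mono add_left_mono mult_left_mono mult_pos_pos add_pos_nonneg) auto
    qed
    define f where "f j = 1 / (1 + X * (t - (j - \<tau>))\<^sup>2)" for j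
    have f: "f j \<ge> 0" for j using X by (simp add: f_def)
    have tm': "1 / (1 + X * (norm (1 - circ (t + \<tau>)))\<^sup>2) \<le> f (real j)" if "\<bar>t + \<tau> - real j\<bar> \<le> 1/2" for j
      using tm[OF that] by (simp only: f_def)
    have "t + \<tau> \<le> 2" "0 \<le> t + \<tau>" using t \<tau> by auto
    then consider "\<bar>t + \<tau> - real 0\<bar> \<le> 1/2" | "\<bar>t + \<tau> - real 1\<bar> \<le> 1/2" | "\<bar>t + \<tau> - real 2\<bar> \<le> 1/2"
      unfolding abs_le_iff by simp linarith
    then have "1 / (1 + X * (norm (1 - circ (t + \<tau>)))\<^sup>2) \<le> f 0 + f 1 + f 2"
      by cases (use tm'[of 0] tm'[of 1] tm'[of 2] f[of 0] f[of 1] f[of 2] in force)+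
    then have "ennreal (1 / (1 + X * (norm (1 - circ (t + \<tau>)))\<^sup>2)) \<le> ennreal (f 0 + f 1 + f 2)"
      by (rule ennreal_leI)
    also have "\<dots> = ennreal (f 0) + ennreal (f 1) + ennreal (f 2)" using f by simp
    finally show "ennreal (1 / (1 + X * (norm (1 - circ (t + \<tau>)))\<^sup>2)) \<le> ennreal (1 / (1 + X * (t - (0 - \<tau>))\<^sup>2)) + ennreal (1 / (1 + X * (t - (1 - \<tau>))\<^sup>2))
            + ennreal (1 / (1 + X * (t - (2 - \<tau>))\<^sup>2))" by (simp only: f_def)
  qed
  also have "\<dots> = (\<integral>\<^sup>+t. ennreal (1 / (1 + X * (t - (0 - \<tau>))\<^sup>2)) \<partial>unit_interval)
     + (\<integral>\<^sup>+t. ennreal (1 / (1 + X * (t - (1 - \<tau>))\<^sup>2)) \<partial>unit_interval)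
     + (\<integral>\<^sup>+t. ennreal (1 / (1 + X * (t - (2 - \<tau>))\<^sup>2)) \<partial>unit_interval)"
    by (simp add: nn_integral_add)
  also have "\<dots> \<le> ennreal (pi / sqrt X) + ennreal (pi / sqrt X) + ennreal (pi / sqrt X)"
    by (intro add_mono nn_integral_cauchy_le X)
  also have "\<dots> = ennreal (3 * pi / sqrt X)"
    using X by (simp add: ennreal_plus[symmetric] del: ennreal_plus)
  finally show ?thesis .
qed

text \<open>Comparability in both directions passes to powers of either sign, so the signs of the
  exponents e, rho and sigma never have to be distinguished later.\<close>

lemma powr_comparable:
  fixes x y K e :: real
  assumes "x > 0" "y > 0" "K \<ge> 1" "x \<le> K * y" "y \<le> K * x"
  shows "x powr e \<le> K powr \<bar>e\<bar> * y powr e"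
proof (cases "e \<ge> 0")
  case True
  have "x powr e \<le> (K * y) powr e" using True assms by (intro powr_mono2) auto
  then show ?thesis using True assms by (simp add: powr_mult)
next
  case False
  have "(K * x) powr e \<le> y powr e" using False assms by (intro powr_mono2') auto
  then have "K powr (-e) * (K powr e * x powr e) \<le> K powr (-e) * y powr e"
    using assms by (intro mult_left_mono) (auto simp: powr_mult)
  then show ?thesis using False assms by (simp add: mult.assoc[symmetric] powr_add[symmetric])
qed

lemma exists_circ: "norm z = 1 \<Longrightarrow> \<exists>\<tau>. 0 \<le> \<tau> \<and> \<tau> \<le> 1 \<and> z = circ \<tau>"
proof -
  assume "norm z = 1"
  then obtain t where "0 \<le> t" "t < 2 * pi" "z = Complex (cos t) (sin t)"
    using complex_unimodular_polar[of z] by metis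
  then show ?thesis
    by (intro exI[of _ "t / (2 * pi)"]) (auto simp: circ_def complex_eq_iff)
qed

text \<open>Multiplication of the series by \<open>1 - u * circ t\<close> takes the differences of its coefficients, so
  the two sums of squares bound the \<open>L\<^sup>2\<close> norm with the weight \<open>1 + X * \<bar>1 - u * circ t\<bar>\<^sup>2\<close>, and
  the \<open>L\<^sup>1\<close> norm follows from the Cauchy-Schwarz inequality.\<close>

lemma circle_mean_fock_series_large:
  fixes l :: real assumes n: "n \<ge> 1" and l: "l \<ge> 1"
  shows "\<exists>C>0. \<forall>z. norm z \<ge> 1 \<longrightarrow> (\<integral>\<^sup>+t. ennreal (norm (fock_series n l (circ t * z))) \<partial>unit_interval)
     \<le> ennreal (C * exp (norm z powr l) * (norm z powr l) powr (real n - real n / l - 1/2))"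
proof -
  define e where "e = 2 * real n - 2 * real n / l - 1/2"
  obtain C1 where C1: "C1 > 0" "\<And>X m. X \<ge> 1 \<Longrightarrow> (\<Sum>k<m. (fock_coeff n l k * (X powr (1 / l)) ^ k)\<^sup>2)
     \<le> C1 * exp (2 * X) * X powr e"
    using sum_fock_coeff_square_le[OF n l] unfolding e_def by blast
  have e1: "2 * real n - 2 * real n / l - 3/2 = e - 1" by (simp add: e_def)
  obtain C2 where C2: "C2 > 0" "\<And>X m. X \<ge> 1 \<Longrightarrow> (\<Sum>k<m. (fock_coeff n l (Suc k) * (X powr (1 / l)) ^ Suc k - fock_coeff n l k * (X powr (1 / l)) ^ k)\<^sup>2)
     \<le> C2 * exp (2 * X) * X powr (e - 1)"
    using sum_fock_coeff_diff_square_le[OF n l] unfolding e1 by blast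
  define c0 where "c0 = fock_coeff n l 0"
  have e2: "e \<ge> - (1/2)" using n l by (simp add: e_def field_simps)
  define K where "K = C1 + c0\<^sup>2 + C2 + 3 * pi"
  have key: "(\<integral>\<^sup>+t. ennreal (norm (fock_series n l (circ t * z))) \<partial>unit_interval)
     \<le> ennreal (K * exp (norm z powr l) * (norm z powr l) powr (real n - real n / l - 1/2))"
    if z: "norm z \<ge> 1" for z
  proof -
    define r where "r = norm z"
    define X where "X = r powr l"
    have r: "r \<ge> 1" using z by (simp add: r_def)
    have X: "X \<ge> 1" using r l by (simp add: X_def ge_one_powr_ge_zero)
    have rX: "X powr (1 / l) = r" using r l by (simp add: X_def powr_powr)
    obtain \<tau> where \<tau>: "0 \<le> \<tau>" "\<tau> \<le> 1" "z / of_real r = circ \<tau>"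
    proof -
      have "norm (z / of_real r) = 1" using r by (simp add: norm_divide flip: r_def)
      then show ?thesis using exists_circ that by blast
    qed
    have zr: "z = of_real r * circ \<tau>" using \<tau>(3) r by (simp add: field_simps)
    define a where "a k = fock_coeff n l k * r ^ k" for k
    \<comment> \<open>The coefficients after multiplication by 1 - u, where u =
      \<open>circ (t + \<tau>)\<close>. The zeroth one is not a difference and has to be estimated
      separately, by \<open>c0\<close>.\<close>
    define b where "b k = (case k of 0 \<Rightarrow> a 0 | Suc j \<Rightarrow> a (Suc j) - a j)" for k
    let ?H = "\<lambda>t. fock_series n l (circ t * z)"
    let ?v = "\<lambda>t. 1 - circ (t + \<tau>)"
    define d where "d k = of_real (a k) * circ \<tau> ^ k" for k
    define d' where "d' k = of_real (b k) * circ \<tau> ^ k" for k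
    have H: "(\<lambda>k. d k * circ t ^ k) sums ?H t" for t
      using summable_sums[OF summable_fock_series[OF n l, of "circ t * z"]]
      unfolding fock_series_def by (simp add: d_def a_def zr power_mult_distrib mult_ac)
    have H': "(\<lambda>k. d' k * circ t ^ k) sums (?v t * ?H t)" for t
    proof -
      have "(\<lambda>k. d (Suc k) * circ t ^ Suc k - d k * circ t ^ k * circ (t + \<tau>)) sums (?H t - d 0 - ?H t * circ (t + \<tau>))"
      proof (intro sums_diff sums_mult2 H)
        show "(\<lambda>k. d (Suc k) * circ t ^ Suc k) sums (?H t - d 0)"
          using H[of t] by (subst sums_Suc_iff) simp
      qed
      moreover have "d (Suc k) * circ t ^ Suc k - d k * circ t ^ k * circ (t + \<tau>) = d' (Suc k) * circ t ^ Suc k" for k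
        by (simp add: d_def d'_def b_def circ_add algebra_simps)
      ultimately have "(\<lambda>k. d' (Suc k) * circ t ^ Suc k) sums (?H t - d 0 - ?H t * circ (t + \<tau>))" by simp
      then have "(\<lambda>k. d' k * circ t ^ k) sums (?H t - d 0 - ?H t * circ (t + \<tau>) + d' 0 * circ t ^ 0)"
        by (subst (asm) sums_Suc_iff) simp
      moreover have "d' 0 = d 0" by (simp add: d_def d'_def b_def)
      ultimately show ?thesis by (simp add: algebra_simps)
    qed
    have S1: "(\<Sum>k<m. (norm (d k))\<^sup>2) \<le> C1 * exp (2 * X) * X powr e" for m
      using C1(2)[OF X, of m] unfolding rX by (simp add: d_def a_def norm_mult norm_power power_mult_distrib flip: power_abs)
    have S2: "(\<Sum>k<m. (norm (d' k))\<^sup>2) \<le> c0\<^sup>2 + C2 * exp (2 * X) * X powr (e - 1)" for m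
    proof -
      have "(\<Sum>k<m. (norm (d' k))\<^sup>2) \<le> (\<Sum>k<Suc m. (norm (d' k))\<^sup>2)" by simp
      also have "\<dots> = (norm (d' 0))\<^sup>2 + (\<Sum>k<m. (norm (d' (Suc k)))\<^sup>2)"
        by (rule sum.lessThan_Suc_shift)
      also have "(norm (d' 0))\<^sup>2 = c0\<^sup>2" by (simp add: d'_def b_def a_def c0_def)
      also have "(\<Sum>k<m. (norm (d' (Suc k)))\<^sup>2) = (\<Sum>k<m. (a (Suc k) - a k)\<^sup>2)"
        by (intro sum.cong) (auto simp: d'_def b_def norm_mult norm_power simp flip: of_real_diff)
      also have "\<dots> \<le> C2 * exp (2 * X) * X powr (e - 1)"
        using C2(2)[OF X, of m] unfolding rX by (simp add: a_def)
      finally show ?thesis by simp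
    qed
    \<comment> \<open>\<open>N\<close> is the claimed size of the mean;
      \<open>N\<^sup>2 * sqrt X\<close> is the size of the sum of squares.\<close>
    define N where "N = exp X * X powr (real n - real n / l - 1/2)"
    have N: "N > 0" using X by (simp add: N_def)
    have N2: "N\<^sup>2 * sqrt X = exp (2 * X) * X powr e"
    proof -
      have "N\<^sup>2 = exp (2 * X) * X powr (2 * (real n - real n / l - 1/2))"
      proof -
        have "(exp X)\<^sup>2 = exp (2 * X)" "(X powr q)\<^sup>2 = X powr (2 * q)" for q
          by (simp_all add: power2_eq_square exp_add[symmetric] powr_add[symmetric])
        then show ?thesis by (simp only: N_def power_mult_distrib)
      qed
      moreover have "sqrt X = X powr (1/2)" using X by (simp add: powr_half_sqrt)
      ultimately have "N\<^sup>2 * sqrt X = exp (2 * X) * (X powr (2 * (real n - real n / l - 1/2)) * X powr (1/2))"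
        by (simp only: mult.assoc)
      also have "X powr (2 * (real n - real n / l - 1/2)) * X powr (1/2) = X powr e"
        by (simp add: powr_add[symmetric] e_def algebra_simps)
      finally show ?thesis .
    qed
    \<comment> \<open>This absorbs the zeroth coefficient, whose square enters with the weight X. It
      rests on e >= -1/2, as X = X^(3/2) X^(-1/2).\<close>
    have XN: "X \<le> N\<^sup>2 * sqrt X"
    proof -
      have "X = X powr (3/2) * X powr (-(1/2))" using X by (simp add: powr_add[symmetric])
      also have "\<dots> \<le> X powr 2 * X powr e" using e2 X by (intro mult_mono powr_mono) auto
      also have "\<dots> \<le> exp (2 * X) * X powr e"
      proof (intro mult_right_mono)
        have "X \<le> exp X" using exp_ge_add_one_self[of X] by linarith
        then have "X ^ 2 \<le> exp X ^ 2" using X by (intro power_mono) auto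
        then show "X powr 2 \<le> exp (2 * X)" using X by (simp flip: exp_of_nat_mult)
      qed auto
      finally show ?thesis using N2 by simp
    qed
    define W where "W t = 1 + X * (norm (?v t))\<^sup>2" for t
    have W: "W t \<ge> 1" for t using X by (simp add: W_def)
    have [measurable]: "?H \<in> borel_measurable borel"
      by (intro borel_measurable_continuous_onI continuous_on_compose2[OF continuous_on_fock_series[OF n l]] continuous_intros) auto
    have [measurable]: "W \<in> borel_measurable borel" unfolding W_def[abs_def]
      by (intro borel_measurable_continuous_onI continuous_intros)
    have "(\<integral>\<^sup>+t. ennreal (norm (?H t)) \<partial>unit_interval)
       \<le> (\<integral>\<^sup>+t. ennreal (1 / (N * sqrt X)) * ennreal ((norm (?H t))\<^sup>2 * W t) + ennreal (N * sqrt X) * ennreal (1 / W t) \<partial>unit_interval)"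
    proof (rule nn_integral_mono)
      fix t
      define h where "h = norm (?H t)"
      \<comment> \<open>The Cauchy-Schwarz inequality in the pointwise form h <= h^2 / M + M, with M
        chosen so that both integrals become constant multiples of N.\<close>
      have "h \<le> 1 / (N * sqrt X) * (h\<^sup>2 * W t) + N * sqrt X * (1 / W t)"
      proof -
        define M where "M = N * sqrt X / W t"
        have M: "M > 0" using N X W[of t] by (simp add: M_def)
        have "2 * (h * M) \<le> h\<^sup>2 + M\<^sup>2" using zero_le_power2[of "h - M"] by (simp add: power2_diff)
        moreover have "0 \<le> h * M" using M by (simp add: h_def)
        ultimately have "h * M \<le> h\<^sup>2 + M\<^sup>2" by linarith
        then have "h \<le> h\<^sup>2 / M + M" using M by (simp add: field_simps power2_eq_square)
        then show ?thesis by (simp add: M_def mult_ac)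
      qed
      then have "ennreal h \<le> ennreal (1 / (N * sqrt X) * (h\<^sup>2 * W t) + N * sqrt X * (1 / W t))" by (rule ennreal_leI)
      also have "\<dots> = ennreal (1 / (N * sqrt X)) * ennreal (h\<^sup>2 * W t) + ennreal (N * sqrt X) * ennreal (1 / W t)"
        using N X W[of t] by (simp add: ennreal_mult'[symmetric])
      finally show "ennreal (norm (?H t)) \<le> ennreal (1 / (N * sqrt X)) * ennreal ((norm (?H t))\<^sup>2 * W t) + ennreal (N * sqrt X) * ennreal (1 / W t)"
        by (simp only: h_def)
    qed
    also have "\<dots> = ennreal (1 / (N * sqrt X)) * (\<integral>\<^sup>+t. ennreal ((norm (?H t))\<^sup>2 * W t) \<partial>unit_interval)
        + ennreal (N * sqrt X) * (\<integral>\<^sup>+t. ennreal (1 / W t) \<partial>unit_interval)"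
      by (simp add: nn_integral_add nn_integral_cmult)
    also have "\<dots> \<le> ennreal (1 / (N * sqrt X)) * ennreal ((C1 + c0\<^sup>2 + C2) * (N\<^sup>2 * sqrt X))
        + ennreal (N * sqrt X) * ennreal (3 * pi / sqrt X)"
    proof (intro add_mono mult_left_mono)
      show "(\<integral>\<^sup>+t. ennreal (1 / W t) \<partial>unit_interval) \<le> ennreal (3 * pi / sqrt X)"
        unfolding W_def using X \<tau> by (intro nn_integral_inverse_circ_weight_le) auto
      have "(\<integral>\<^sup>+t. ennreal ((norm (?H t))\<^sup>2 * W t) \<partial>unit_interval)
        = (\<integral>\<^sup>+t. ennreal ((norm (?H t))\<^sup>2) + ennreal X * ennreal ((norm (?v t * ?H t))\<^sup>2) \<partial>unit_interval)"
      proof (rule nn_integral_cong)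
        fix t
        have "(norm (?H t))\<^sup>2 * W t = (norm (?H t))\<^sup>2 + X * (norm (?v t * ?H t))\<^sup>2"
          by (simp only: W_def norm_mult power_mult_distrib distrib_left mult_1_right) (simp only: mult_ac)
        then show "ennreal ((norm (?H t))\<^sup>2 * W t) = ennreal ((norm (?H t))\<^sup>2) + ennreal X * ennreal ((norm (?v t * ?H t))\<^sup>2)"
          using X by (simp add: ennreal_mult'[symmetric])
      qed
      also have "\<dots> = (\<integral>\<^sup>+t. ennreal ((norm (?H t))\<^sup>2) \<partial>unit_interval)
          + ennreal X * (\<integral>\<^sup>+t. ennreal ((norm (?v t * ?H t))\<^sup>2) \<partial>unit_interval)"
        by (simp add: nn_integral_add nn_integral_cmult)
      also have "\<dots> \<le> ennreal (C1 * exp (2 * X) * X powr e) + ennreal X * ennreal (c0\<^sup>2 + C2 * exp (2 * X) * X powr (e - 1))"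
        by (intro add_mono mult_left_mono nn_integral_circ_series_le[OF H S1] nn_integral_circ_series_le[OF H' S2]) auto
      also have "\<dots> = ennreal (C1 * exp (2 * X) * X powr e + X * (c0\<^sup>2 + C2 * exp (2 * X) * X powr (e - 1)))"
        using X C1(1) C2(1) by (simp add: ennreal_mult'[symmetric] ennreal_plus[symmetric] del: ennreal_plus)
      also have "C1 * exp (2 * X) * X powr e + X * (c0\<^sup>2 + C2 * exp (2 * X) * X powr (e - 1))
         \<le> (C1 + c0\<^sup>2 + C2) * (N\<^sup>2 * sqrt X)"
      proof -
        have "X * X powr (e - 1) = X powr e" using X by (simp add: powr_diff)
        then have "X * (c0\<^sup>2 + C2 * exp (2 * X) * X powr (e - 1)) = c0\<^sup>2 * X + C2 * (N\<^sup>2 * sqrt X)"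
          unfolding N2 by (simp add: algebra_simps)
        moreover have "c0\<^sup>2 * X \<le> c0\<^sup>2 * (N\<^sup>2 * sqrt X)" by (intro mult_left_mono XN) auto
        moreover have "C1 * exp (2 * X) * X powr e = C1 * (N\<^sup>2 * sqrt X)" unfolding N2 by simp
        ultimately show ?thesis by (simp only: distrib_right)
      qed
      finally show "(\<integral>\<^sup>+t. ennreal ((norm (?H t))\<^sup>2 * W t) \<partial>unit_interval) \<le> ennreal ((C1 + c0\<^sup>2 + C2) * (N\<^sup>2 * sqrt X))"
        by (simp add: ennreal_leI order_trans)
    qed auto
    also have "\<dots> = ennreal (1 / (N * sqrt X) * ((C1 + c0\<^sup>2 + C2) * (N\<^sup>2 * sqrt X)) + N * sqrt X * (3 * pi / sqrt X))"
      using N X C1(1) C2(1) by (simp add: ennreal_mult'[symmetric] ennreal_plus[symmetric] del: ennreal_plus)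
    also have "1 / (N * sqrt X) * ((C1 + c0\<^sup>2 + C2) * (N\<^sup>2 * sqrt X)) + N * sqrt X * (3 * pi / sqrt X) = K * N"
      using N X by (simp add: K_def field_simps power2_eq_square)
    finally show ?thesis by (simp add: N_def X_def r_def mult.assoc)
  qed
  moreover have "K > 0" using C1 C2 by (simp add: K_def add_pos_pos add_pos_nonneg)
  ultimately show ?thesis by blast
qed

text \<open>Written in |z|, the power of |z|^l has the exponent l (n - n/l - 1/2) = n (l - 1) - l/2.
  With 1 + |z| as base the bound extends to the unit disc, where \<open>fock_growth n l 1\<close>
  bounds the series.\<close>

lemma circle_mean_fock_series:
  fixes l :: real assumes n: "n \<ge> 1" and l: "l \<ge> 1"
  shows "\<exists>C>0. \<forall>z. (\<integral>\<^sup>+t. ennreal (norm (fock_series n l (circ t * z))) \<partial>unit_interval)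
     \<le> ennreal (C * exp (norm z powr l) * (1 + norm z) powr (real n * (l - 1) - l / 2))"
proof -
  obtain C where C: "C > 0" "\<And>z. norm z \<ge> 1 \<Longrightarrow> (\<integral>\<^sup>+t. ennreal (norm (fock_series n l (circ t * z))) \<partial>unit_interval)
     \<le> ennreal (C * exp (norm z powr l) * (norm z powr l) powr (real n - real n / l - 1/2))"
    using circle_mean_fock_series_large[OF n l] by blast
  define e where "e = real n * (l - 1) - l / 2"
  define K where "K = C * 2 powr \<bar>e\<bar> + fock_growth n l 1 * 2 powr \<bar>e\<bar>"
  have g: "fock_growth n l 1 \<ge> 0" by (intro fock_growth_nonneg[OF n l]) auto
  have "(\<integral>\<^sup>+t. ennreal (norm (fock_series n l (circ t * z))) \<partial>unit_interval)
     \<le> ennreal (K * exp (norm z powr l) * (1 + norm z) powr e)" for z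
  proof (cases "norm z \<ge> 1")
    case True
    have "(norm z powr l) powr (real n - real n / l - 1/2) = norm z powr e"
    proof -
      have "l * (real n - real n / l - 1/2) = e" using l by (simp add: e_def right_diff_distrib)
      then show ?thesis by (simp add: powr_powr)
    qed
    also have "\<dots> \<le> 2 powr \<bar>e\<bar> * (1 + norm z) powr e" using True by (intro powr_comparable) auto
    finally have "C * exp (norm z powr l) * (norm z powr l) powr (real n - real n / l - 1/2)
       \<le> C * exp (norm z powr l) * (2 powr \<bar>e\<bar> * (1 + norm z) powr e)"
      using C by (intro mult_left_mono) auto
    also have "\<dots> \<le> K * exp (norm z powr l) * (1 + norm z) powr e"
      using g by (simp add: K_def algebra_simps)
    finally show ?thesis using C(2)[OF True] by (meson ennreal_leI order_trans)
  next
    case False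
    have "(\<integral>\<^sup>+t. ennreal (norm (fock_series n l (circ t * z))) \<partial>unit_interval)
      \<le> (\<integral>\<^sup>+t. ennreal (fock_growth n l 1) \<partial>unit_interval)"
    proof (intro nn_integral_mono ennreal_leI)
      fix t
      have "norm (fock_series n l (circ t * z)) \<le> fock_growth n l (norm (circ t * z))"
        by (rule norm_fock_series_le[OF n l])
      also have "\<dots> \<le> fock_growth n l 1" using False by (intro fock_growth_mono[OF n l]) (auto simp: norm_mult)
      finally show "norm (fock_series n l (circ t * z)) \<le> fock_growth n l 1" .
    qed
    also have "\<dots> = ennreal (fock_growth n l 1)" by (rule nn_integral_unit_interval_const)
    also have "\<dots> = ennreal (fock_growth n l 1 * (1 * 1))" by simp
    also have "\<dots> \<le> ennreal (K * exp (norm z powr l) * (1 + norm z) powr e)"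
    proof (intro ennreal_leI)
      have "1 powr e \<le> 2 powr \<bar>e\<bar> * (1 + norm z) powr e"
        using False by (intro powr_comparable) (auto intro: add_pos_nonneg)
      then have "1 \<le> 2 powr \<bar>e\<bar> * (1 + norm z) powr e" by simp
      then have "fock_growth n l 1 * (1 * 1) \<le> fock_growth n l 1 * (exp (norm z powr l) * (2 powr \<bar>e\<bar> * (1 + norm z) powr e))"
        using g by (intro mult_left_mono mult_mono) auto
      also have "\<dots> \<le> K * exp (norm z powr l) * (1 + norm z) powr e"
        using C(1) by (simp add: K_def algebra_simps)
      finally show "fock_growth n l 1 * (1 * 1) \<le> K * exp (norm z powr l) * (1 + norm z) powr e" .
    qed
    finally show ?thesis .
  qed
  moreover have "K > 0" using C g by (auto simp: K_def intro!: add_pos_nonneg)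
  ultimately show ?thesis unfolding e_def by blast
qed

section \<open>The weighted \<open>L\<^sup>1\<close> bound of the kernel\<close>

lemma powr_diff_ge:
  fixes m M l :: real assumes "0 \<le> m" "m \<le> M" "l \<ge> 1"
  shows "M powr (l - 1) * (M - m) \<le> M powr l - m powr l"
proof (cases "m = 0")
  case True
  then show ?thesis using assms by (cases "M = 0") (auto simp: powr_mult_base powr_diff)
next
  case False
  have "M powr l = M powr (l - 1) * M" using assms False by (simp add: powr_diff)
  moreover have "m powr l = m powr (l - 1) * m" using assms False by (simp add: powr_diff)
  moreover have "m powr (l - 1) * m \<le> M powr (l - 1) * m"
    using assms by (intro mult_right_mono powr_mono2) auto
  ultimately show ?thesis by (simp add: algebra_simps)
qed

lemma powr_double: "(x::real) \<ge> 0 \<Longrightarrow> x powr (2 * l) = (x powr l)\<^sup>2"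
  by (simp add: power2_eq_square powr_add[symmetric])

lemma powr_double_square: "(x::real) \<ge> 0 \<Longrightarrow> x powr (2 * l) = (x\<^sup>2) powr l"
  by (cases "x = 0") (auto simp: power2_eq_square powr_mult powr_add[symmetric])

text \<open>Here a stands for |z|, b for the modulus of the distinguished coordinate of w, and s for
  the norm of the other coordinates. The right-hand side is (a^l - b^l)^2 plus (b^2 + s^2)^l -
  b^(2l), and \<open>powr_diff_ge\<close> applies to both summands.\<close>

lemma energy_lower_terms:
  fixes a b s l :: real assumes l: "l \<ge> 1" and nn: "0 \<le> a" "0 \<le> b" "0 \<le> s"
  shows "max a b powr (2 * (l - 1)) * (a - b)\<^sup>2 + (b\<^sup>2 + s\<^sup>2) powr (l - 1) * s\<^sup>2
    \<le> a powr (2 * l) + (b\<^sup>2 + s\<^sup>2) powr l - 2 * (a powr l * b powr l)"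
proof -
  have 1: "max a b powr (2 * (l - 1)) * (a - b)\<^sup>2 \<le> (a powr l - b powr l)\<^sup>2"
  proof -
    have *: "M powr (2 * (l - 1)) * (M - m)\<^sup>2 \<le> (M powr l - m powr l)\<^sup>2"
      if "0 \<le> m" "m \<le> M" for m M :: real
    proof -
      have "(M powr (l - 1) * (M - m))\<^sup>2 \<le> (M powr l - m powr l)\<^sup>2"
        using that l powr_diff_ge[OF that l] by (intro power_mono) auto
      then show ?thesis using that powr_double[of M "l - 1"] by (simp only: power_mult_distrib)
    qed
    show ?thesis
    proof (cases "b \<le> a")
      case True
      then show ?thesis using *[of b a] nn by (simp add: max_absorb1)
    next
      case False
      then show ?thesis using *[of a b] nn by (simp add: max_absorb2 power2_commute)
    qed
  qed
  have 2: "(b\<^sup>2 + s\<^sup>2) powr (l - 1) * s\<^sup>2 \<le> (b\<^sup>2 + s\<^sup>2) powr l - b powr (2 * l)"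
    using powr_diff_ge[of "b\<^sup>2" "b\<^sup>2 + s\<^sup>2" l] nn l by (simp add: powr_double_square)
  show ?thesis using 1 2 nn by (simp add: power2_diff powr_double mult.assoc)
qed

text \<open>The part with a - b is immediate. For the part with s: if b >= a/2, then b^2 + s^2 >=
  a^2 / 4; otherwise a <= 2 (a - b), so s^2 is controlled by (a - b)^2 when s <= a, and by the power
  of s itself when s > a. For bounded a the powers of a are of no help; there u <= 1 + u^l is used,
  at the price of the constant 1.\<close>

lemma energy_lower:
  fixes l :: real assumes l: "l \<ge> 1"
  shows "\<exists>c>0. \<forall>a\<ge>0. \<forall>b\<ge>0. \<forall>s\<ge>0.
    c * (1 + a) powr (2 * (l - 1)) * ((a - b)\<^sup>2 + s\<^sup>2) - 1
     \<le> a powr (2 * l) + (b\<^sup>2 + s\<^sup>2) powr l - 2 * (a powr l * b powr l)"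
proof -
  \<comment> \<open>4^(l - 1) comes from (1 + a)^(2(l - 1)) <= 4^(l - 1) (1 + A) with A = a^(2(l -
    1)); the rest collects u <= 1 + 2^l E and A u <= (5 + 4^l) E.\<close>
  define K where "K = 4 powr (l - 1) * (1 + 2 powr l + (5 + 4 powr l))"
  have K: "K > 0" by (auto simp: K_def intro!: mult_pos_pos add_pos_nonneg)
  have key: "(1 / K) * (1 + a) powr (2 * (l - 1)) * ((a - b)\<^sup>2 + s\<^sup>2) - 1
     \<le> a powr (2 * l) + (b\<^sup>2 + s\<^sup>2) powr l - 2 * (a powr l * b powr l)"
    if nn: "0 \<le> a" "0 \<le> b" "0 \<le> s" for a b s
  proof -
    define E where "E = a powr (2 * l) + (b\<^sup>2 + s\<^sup>2) powr l - 2 * (a powr l * b powr l)"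
    define F1 where "F1 = max a b powr (2 * (l - 1)) * (a - b)\<^sup>2"
    define F2 where "F2 = (b\<^sup>2 + s\<^sup>2) powr (l - 1) * s\<^sup>2"
    define u where "u = (a - b)\<^sup>2 + s\<^sup>2"
    define A where "A = a powr (2 * (l - 1))"
    have E: "F1 + F2 \<le> E" using energy_lower_terms[OF l nn] by (simp add: E_def F1_def F2_def)
    have F: "F1 \<ge> 0" "F2 \<ge> 0" by (auto simp: F1_def F2_def)
    have F1A: "A * (a - b)\<^sup>2 \<le> F1"
      unfolding A_def F1_def using nn l by (intro mult_right_mono powr_mono2) auto
    have s2: "s powr (2 * (l - 1)) * s\<^sup>2 \<le> F2"
    proof -
      have "s powr (2 * (l - 1)) = (s\<^sup>2) powr (l - 1)" using nn by (intro powr_double_square)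
      also have "\<dots> \<le> (b\<^sup>2 + s\<^sup>2) powr (l - 1)" using l by (intro powr_mono2) auto
      finally show ?thesis unfolding F2_def by (intro mult_right_mono) auto
    qed
    have As: "A * s\<^sup>2 \<le> (4 + 4 powr l) * E"
    proof (cases "b \<ge> a / 2")
      case True
      have "A = 4 powr (l - 1) * ((a / 2)\<^sup>2) powr (l - 1)"
        using nn unfolding A_def by (subst powr_double_square) (auto simp: power_divide powr_divide)
      also have "\<dots> \<le> 4 powr (l - 1) * (b\<^sup>2 + s\<^sup>2) powr (l - 1)"
      proof (intro mult_left_mono powr_mono2)
        have "(a / 2)\<^sup>2 \<le> b\<^sup>2" using True nn by (intro power_mono) auto
        then show "(a / 2)\<^sup>2 \<le> b\<^sup>2 + s\<^sup>2" by (simp add: add_increasing2)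
      qed (use l in auto)
      finally have "A * s\<^sup>2 \<le> 4 powr (l - 1) * F2"
        unfolding F2_def mult.assoc[symmetric] by (intro mult_right_mono) auto
      also have "\<dots> \<le> (4 + 4 powr l) * E"
      proof (intro mult_mono)
        have "4 powr (l - 1) \<le> (4::real) powr l" by (intro powr_mono) auto
        then show "4 powr (l - 1) \<le> 4 + (4::real) powr l" by linarith
      qed (use E F in auto)
      finally show ?thesis .
    next
      case False
      have "A * s\<^sup>2 \<le> 4 * (F1 + F2)"
      proof (cases "s \<le> a")
        case True
        have "s\<^sup>2 \<le> a\<^sup>2" using True nn by (intro power_mono) auto
        also have "\<dots> \<le> (2 * (a - b))\<^sup>2" using False nn by (intro power_mono) auto
        also have "\<dots> = 4 * (a - b)\<^sup>2" by (simp only: power_mult_distrib) simp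
        finally have "A * s\<^sup>2 \<le> A * (4 * (a - b)\<^sup>2)" by (intro mult_left_mono) (auto simp: A_def)
        then show ?thesis using F1A F by simp
      next
        case False
        have "A * s\<^sup>2 \<le> s powr (2 * (l - 1)) * s\<^sup>2"
          unfolding A_def using False nn l by (intro mult_right_mono powr_mono2) auto
        then show ?thesis using s2 F by simp
      qed
      also have "\<dots> \<le> 4 * E" using E by simp
      also have "\<dots> \<le> (4 + 4 powr l) * E" using E F by (intro mult_right_mono) auto
      finally show ?thesis .
    qed
    have Au: "A * u \<le> (5 + 4 powr l) * E"
      using As F1A E F by (simp add: u_def algebra_simps)
    have ul: "u powr l \<le> 2 powr l * E"
    proof -
      have d: "((a - b)\<^sup>2) powr l \<le> E"
      proof (cases "a = b")
        case True then show ?thesis using E F by simp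
      next
        case False
        have "((a - b)\<^sup>2) powr l = ((a - b)\<^sup>2) powr (l - 1) * (a - b)\<^sup>2"
          using False by (simp add: powr_diff)
        also have "((a - b)\<^sup>2) powr (l - 1) = \<bar>a - b\<bar> powr (2 * (l - 1))"
          by (subst powr_double_square) auto
        also have "\<dots> * (a - b)\<^sup>2 \<le> F1"
          unfolding F1_def using nn l by (intro mult_right_mono powr_mono2) auto
        finally show ?thesis using E F by simp
      qed
      have e: "(s\<^sup>2) powr l \<le> E"
      proof (cases "s = 0")
        case True then show ?thesis using E F by simp
      next
        case False
        have "(s\<^sup>2) powr l = (s\<^sup>2) powr (l - 1) * s\<^sup>2"
          using False by (simp add: powr_diff)
        also have "\<dots> = s powr (2 * (l - 1)) * s\<^sup>2" using nn by (subst powr_double_square) auto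
        finally show ?thesis using s2 E F by simp
      qed
      have "u powr l \<le> (2 * max ((a - b)\<^sup>2) (s\<^sup>2)) powr l"
        using l by (intro powr_mono2) (auto simp: u_def)
      also have "\<dots> = 2 powr l * max ((a - b)\<^sup>2) (s\<^sup>2) powr l" by (simp add: powr_mult)
      also have "max ((a - b)\<^sup>2) (s\<^sup>2) powr l \<le> E" using d e by (simp add: max_def)
      finally show ?thesis by simp
    qed
    have u0: "u \<ge> 0" by (simp add: u_def)
    have u1: "u \<le> 1 + u powr l"
    proof (cases "u \<le> 1")
      case False
      then have "u powr 1 \<le> u powr l" using l by (intro powr_mono) auto
      then show ?thesis using False by simp
    qed (simp add: add_increasing2)
    have "(1 + a) powr (2 * (l - 1)) \<le> 4 powr (l - 1) * (1 + A)"
    proof (cases "a \<le> 1")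
      case True
      have "(1 + a) powr (2 * (l - 1)) \<le> 2 powr (2 * (l - 1))" using True nn l by (intro powr_mono2) auto
      also have "\<dots> = 4 powr (l - 1)" by (subst powr_double_square) auto
      also have "\<dots> \<le> 4 powr (l - 1) * (1 + A)" by (simp add: A_def)
      finally show ?thesis .
    next
      case False
      have "(1 + a) powr (2 * (l - 1)) \<le> (2 * a) powr (2 * (l - 1))" using False nn l by (intro powr_mono2) auto
      also have "\<dots> = 4 powr (l - 1) * A" using nn unfolding A_def
        by (subst (1 2) powr_double_square) (auto simp: power_mult_distrib powr_mult)
      also have "\<dots> \<le> 4 powr (l - 1) * (1 + A)" by simp
      finally show ?thesis .
    qed
    then have "(1 + a) powr (2 * (l - 1)) * u \<le> 4 powr (l - 1) * (1 + A) * u"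
      using u0 by (intro mult_right_mono)
    also have "\<dots> = 4 powr (l - 1) * (u + A * u)" by (simp add: algebra_simps)
    also have "\<dots> \<le> 4 powr (l - 1) * (1 + 2 powr l * E + (5 + 4 powr l) * E)"
      using u1 ul Au by (intro mult_left_mono add_mono) auto
    also have "\<dots> \<le> K * (1 + E)"
      using E F by (simp add: K_def algebra_simps)
    finally have "(1 / K) * ((1 + a) powr (2 * (l - 1)) * u) \<le> 1 + E"
      using K by (simp add: field_simps)
    then show ?thesis by (simp add: u_def E_def mult.assoc)
  qed
  show ?thesis by (rule exI[of _ "1 / K"]) (use key K in auto)
qed

lemma powr_one_plus_gaussian_bounded:
  fixes M c :: real assumes "c > 0" "M \<ge> 0"
  shows "\<exists>C>0. \<forall>v\<ge>0. (1 + v) powr M * exp (- c * v\<^sup>2) \<le> C"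
proof -
  have "(1 + v) powr M * exp (- c * v\<^sup>2) \<le> exp (M\<^sup>2 / (4 * c))" if v: "v \<ge> 0" for v
  proof -
    have "M * ln (1 + v) \<le> M * v" using v assms ln_add_one_self_le_self[of v] by (intro mult_left_mono) auto
    then have "(1 + v) powr M * exp (- c * v\<^sup>2) \<le> exp (M * v - c * v\<^sup>2)"
      using v by (simp add: powr_def exp_add[symmetric])
    also have "\<dots> \<le> exp (M\<^sup>2 / (4 * c))"
    proof -
      have "0 \<le> (2 * c * v - M)\<^sup>2 / (4 * c)" using assms by simp
      also have "(2 * c * v - M)\<^sup>2 / (4 * c) = c * v\<^sup>2 - M * v + M\<^sup>2 / (4 * c)"
        using assms by (simp add: power2_eq_square field_simps)
      finally show ?thesis by simp
    qed
    finally show ?thesis .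
  qed
  then show ?thesis by (intro exI[of _ "exp (M\<^sup>2 / (4 * c))"]) auto
qed

text \<open>With v^2 = (a - b)^2 + s^2, replacing 1 + ab by (1 + a)^2 and 1 + sqrt (b^2 + s^2) by 1
  + a costs powers of 1 + v only. Half of the exponent from \<open>energy_lower\<close> is weakened
  to a multiple of v^2, as (1 + a)^(2(l - 1)) >= 1, and absorbs them; the other half is
  kept.\<close>

lemma weighted_energy_bound:
  fixes l e \<sigma> :: real assumes l: "l \<ge> 1"
  shows "\<exists>C>0. \<exists>c>0. \<forall>a\<ge>0. \<forall>b\<ge>0. \<forall>s\<ge>0.
     exp (a powr l * b powr l) * (1 + a * b) powr e * exp (- (1/2) * (a powr (2 * l) + (b\<^sup>2 + s\<^sup>2) powr l))
       * ((1 + a) / (1 + sqrt (b\<^sup>2 + s\<^sup>2))) powr \<sigma>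
     \<le> C * (1 + a) powr (2 * e) * exp (- (c * (1 + a) powr (2 * (l - 1))) * ((a - b)\<^sup>2 + s\<^sup>2))"
proof -
  obtain c where c: "c > 0" "\<And>a b s. a \<ge> 0 \<Longrightarrow> b \<ge> 0 \<Longrightarrow> s \<ge> 0 \<Longrightarrow>
    c * (1 + a) powr (2 * (l - 1)) * ((a - b)\<^sup>2 + s\<^sup>2) - 1
     \<le> a powr (2 * l) + (b\<^sup>2 + s\<^sup>2) powr l - 2 * (a powr l * b powr l)"
    using energy_lower[OF l] by blast
  define M where "M = 2 * \<bar>e\<bar> + \<bar>\<sigma>\<bar>"
  have M: "M \<ge> 0" by (simp add: M_def)
  obtain D where D: "D > 0" "\<And>v. v \<ge> 0 \<Longrightarrow> (1 + v) powr M * exp (- (c / 4) * v\<^sup>2) \<le> D"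
    using powr_one_plus_gaussian_bounded[of "c / 4" M] c M by auto
  define C where "C = exp (1/2) * 4 powr \<bar>e\<bar> * D"
  have key: "exp (a powr l * b powr l) * (1 + a * b) powr e * exp (- (1/2) * (a powr (2 * l) + (b\<^sup>2 + s\<^sup>2) powr l))
       * ((1 + a) / (1 + sqrt (b\<^sup>2 + s\<^sup>2))) powr \<sigma>
     \<le> C * (1 + a) powr (2 * e) * exp (- ((c/4) * (1 + a) powr (2 * (l - 1))) * ((a - b)\<^sup>2 + s\<^sup>2))"
    if nn: "0 \<le> a" "0 \<le> b" "0 \<le> s" for a b s
  proof -
    define u where "u = (a - b)\<^sup>2 + s\<^sup>2"
    define v where "v = sqrt u"
    define d where "d = \<bar>a - b\<bar>"
    define Q where "Q = (1 + a) powr (2 * (l - 1))"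
    define r where "r = sqrt (b\<^sup>2 + s\<^sup>2)"
    have u0: "u \<ge> 0" by (simp add: u_def)
    have v: "v \<ge> 0" "v\<^sup>2 = u" using u0 by (auto simp: v_def)
    have dv: "d \<le> v" "d \<ge> 0" by (auto simp: d_def v_def u_def intro: real_le_rsqrt)
    have Q: "Q \<ge> 1" unfolding Q_def using nn l by (intro ge_one_powr_ge_zero) auto
    have r: "r \<ge> 0" by (simp add: r_def)
    \<comment> \<open>The triangle inequality in the plane for the points (a, 0) and (b, s), whose
      distance is v.\<close>
    have ra: "\<bar>a - r\<bar> \<le> v"
      using norm_triangle_ineq3[of "Complex a 0" "Complex b s"] nn
      by (simp add: r_def v_def u_def complex_norm minus_complex.ctr)
    \<comment> \<open>b differs from a by at most v. The factor 4 serves the passage from a to 1 +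
      a: for a <= 1 because (1 + a)^2 <= 4, for a > 1 because (1 + a)^2 <= (2a)^2.\<close>
    have 1: "(1 + a * b) powr e \<le> (4 * (1 + v)\<^sup>2) powr \<bar>e\<bar> * ((1 + a)\<^sup>2) powr e"
    proof (rule powr_comparable)
      show "0 < 1 + a * b" "0 < (1 + a)\<^sup>2" using nn by (auto simp: add_pos_nonneg)
      have "1 \<le> (1 + v)\<^sup>2" using v by simp
      then show "1 \<le> 4 * (1 + v)\<^sup>2" by linarith
      have "b \<le> a + v" using dv by (simp add: d_def)
      then have "a * b \<le> a * (a + v)" using nn by (intro mult_left_mono) auto
      then have "1 + a * b \<le> (1 + a)\<^sup>2 * (1 + v)"
      proof -
        assume h: "a * b \<le> a * (a + v)"
        have "(1 + a)\<^sup>2 * (1 + v) = 1 + a * (a + v) + (v + 2 * a + a * v + a\<^sup>2 * v)"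
          by (simp add: power2_eq_square algebra_simps)
        moreover have "0 \<le> v + 2 * a + a * v + a\<^sup>2 * v" using nn v(1) by simp
        ultimately show ?thesis using h by linarith
      qed
      also have "\<dots> \<le> (1 + a)\<^sup>2 * (4 * (1 + v)\<^sup>2)"
      proof (intro mult_left_mono)
        have "(1 + v) * 1 \<le> (1 + v) * (4 * (1 + v))" using v by (intro mult_left_mono) auto
        then show "1 + v \<le> 4 * (1 + v)\<^sup>2" by (simp add: power2_eq_square mult_ac)
      qed auto
      finally show "1 + a * b \<le> 4 * (1 + v)\<^sup>2 * (1 + a)\<^sup>2" by (simp add: mult_ac)
      show "(1 + a)\<^sup>2 \<le> 4 * (1 + v)\<^sup>2 * (1 + a * b)"
      proof (cases "a \<le> 1")
        case True
        have "(1 + a)\<^sup>2 \<le> 2\<^sup>2" using True nn by (intro power_mono) auto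
        also have "\<dots> = 4 * 1 * 1" by simp
        also have "\<dots> \<le> 4 * (1 + v)\<^sup>2 * (1 + a * b)" using v nn by (intro mult_mono) auto
        finally show ?thesis .
      next
        case False
        have ab: "a \<le> b + v" using dv by (simp add: d_def)
        have "a\<^sup>2 \<le> a * b + a * v"
          using mult_left_mono[OF ab, of a] nn by (simp add: power2_eq_square algebra_simps)
        also have "a * v \<le> (b + v) * v" using ab v by (intro mult_right_mono)
        also have "b * v \<le> a * b * v" using False nn v mult_right_mono[of 1 a "b * v"] by (simp add: mult_ac)
        then have "a * b + (b + v) * v \<le> a * b + a * b * v + v\<^sup>2" by (simp add: algebra_simps power2_eq_square)
        also have "\<dots> \<le> (1 + v)\<^sup>2 * (1 + a * b)"
        proof -
          have "(1 + v)\<^sup>2 * (1 + a * b) = a * b + a * b * v + v\<^sup>2 + (1 + 2 * v + a * b * v + a * b * v\<^sup>2)"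
            by (simp add: power2_eq_square algebra_simps)
          moreover have "0 \<le> 1 + 2 * v + a * b * v + a * b * v\<^sup>2" using v(1) nn by simp
          ultimately show ?thesis by linarith
        qed
        finally have "a\<^sup>2 \<le> (1 + v)\<^sup>2 * (1 + a * b)" by simp
        moreover have "(1 + a)\<^sup>2 \<le> (2 * a)\<^sup>2" using False by (intro power_mono) auto
        ultimately show ?thesis by (simp add: power_mult_distrib)
      qed
    qed
    have 2: "((1 + a) / (1 + r)) powr \<sigma> \<le> (1 + v) powr \<bar>\<sigma>\<bar> * 1 powr \<sigma>"
    proof (rule powr_comparable)
      have "a \<le> r + v" "r \<le> a + v" using ra by auto
      then have "1 + a \<le> (1 + v) * (1 + r)" "1 + r \<le> (1 + v) * (1 + a)"
        using mult_nonneg_nonneg[OF v(1) r] mult_nonneg_nonneg[OF v(1) nn(1)]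
        unfolding distrib_left distrib_right by linarith+
      then show "(1 + a) / (1 + r) \<le> (1 + v) * 1" "1 \<le> (1 + v) * ((1 + a) / (1 + r))"
        using nn r by (simp_all add: field_simps add_nonneg_pos)
      show "0 < (1 + a) / (1 + r)" using nn r by simp
    qed (use v in auto)
    have 3: "exp (a powr l * b powr l) * exp (- (1/2) * (a powr (2 * l) + (b\<^sup>2 + s\<^sup>2) powr l))
       \<le> exp (1/2) * exp (- (c/4) * v\<^sup>2) * exp (- ((c/4) * Q) * u)"
    proof -
      have "exp (a powr l * b powr l) * exp (- (1/2) * (a powr (2 * l) + (b\<^sup>2 + s\<^sup>2) powr l))
        = exp (- (1/2) * (a powr (2 * l) + (b\<^sup>2 + s\<^sup>2) powr l - 2 * (a powr l * b powr l)))"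
        by (simp add: exp_add[symmetric] algebra_simps)
      also have "\<dots> \<le> exp (- (1/2) * (c * Q * u - 1))"
        using c(2)[OF nn] by (simp add: Q_def u_def)
      also have "\<dots> \<le> exp (1/2 + - (c/4) * v\<^sup>2 + - ((c/4) * Q) * u)"
      proof -
        have "c * (1 * u) \<le> c * (Q * u)" using Q u0 c(1) by (intro mult_left_mono mult_right_mono) auto
        then show ?thesis by (simp add: v algebra_simps)
      qed
      also have "\<dots> = exp (1/2) * exp (- (c/4) * v\<^sup>2) * exp (- ((c/4) * Q) * u)"
        by (simp only: exp_add)
      finally show ?thesis .
    qed
    have p: "(4 * (1 + v)\<^sup>2) powr \<bar>e\<bar> * ((1 + a)\<^sup>2) powr e = 4 powr \<bar>e\<bar> * (1 + v) powr (2 * \<bar>e\<bar>) * (1 + a) powr (2 * e)"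
      using v nn by (simp add: powr_mult powr_double_square)
    have "exp (a powr l * b powr l) * (1 + a * b) powr e * exp (- (1/2) * (a powr (2 * l) + (b\<^sup>2 + s\<^sup>2) powr l))
       * ((1 + a) / (1 + r)) powr \<sigma>
      = (exp (a powr l * b powr l) * exp (- (1/2) * (a powr (2 * l) + (b\<^sup>2 + s\<^sup>2) powr l)))
        * ((1 + a * b) powr e) * ((1 + a) / (1 + r)) powr \<sigma>" by (simp only: mult_ac)
    also have "\<dots> \<le> (exp (1/2) * exp (- (c/4) * v\<^sup>2) * exp (- ((c/4) * Q) * u))
        * (4 powr \<bar>e\<bar> * (1 + v) powr (2 * \<bar>e\<bar>) * (1 + a) powr (2 * e)) * ((1 + v) powr \<bar>\<sigma>\<bar> * 1)"
    proof (rule mult_mono)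
      show "((1 + a) / (1 + r)) powr \<sigma> \<le> (1 + v) powr \<bar>\<sigma>\<bar> * 1" using 2 by simp
    qed (rule mult_mono[OF 3 1[unfolded p]], auto)
    also have "\<dots> = exp (1/2) * 4 powr \<bar>e\<bar> * ((1 + v) powr M * exp (- (c/4) * v\<^sup>2)) * (1 + a) powr (2 * e) * exp (- ((c/4) * Q) * u)"
      by (simp add: M_def powr_add mult_ac)
    also have "\<dots> \<le> exp (1/2) * 4 powr \<bar>e\<bar> * D * (1 + a) powr (2 * e) * exp (- ((c/4) * Q) * u)"
      using D(2)[OF v(1)] by (intro mult_right_mono mult_left_mono) auto
    finally show ?thesis by (simp add: C_def r_def Q_def u_def)
  qed
  moreover have "C > 0" "c / 4 > 0" using c D by (auto simp: C_def)
  ultimately show ?thesis by blast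
qed

section \<open>The Hermitian form and rotations\<close>

definition herm :: "complex ^ 'n \<Rightarrow> complex ^ 'n \<Rightarrow> complex" where
  "herm z w = (\<Sum>j\<in>UNIV. z $ j * cnj (w $ j))"

lemma continuous_on_herm [continuous_intros]:
  "continuous_on A f \<Longrightarrow> continuous_on A g \<Longrightarrow> continuous_on A (\<lambda>x. herm (f x) (g x))"
  unfolding herm_def by (intro continuous_intros)

lemma herm_smult_left: "herm (c *s z) w = c * herm z w"
  by (simp add: herm_def sum_distrib_left mult_ac)

lemma herm_smult_right: "herm z (c *s w) = cnj c * herm z w"
  by (simp add: herm_def sum_distrib_left mult_ac)

lemma herm_add_left: "herm (z + z') w = herm z w + herm z' w"
  by (simp add: herm_def sum.distrib algebra_simps)

lemma herm_add_right: "herm z (w + w') = herm z w + herm z w'"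
  by (simp add: herm_def sum.distrib algebra_simps)

lemma herm_commute: "herm w z = cnj (herm z w)"
  by (simp add: herm_def mult_ac)

lemma herm_eq_inner: "herm z w = Complex (z \<bullet> w) (- ((\<i> *s z) \<bullet> w))"
  by (simp add: complex_eq_iff herm_def inner_vec_def inner_complex_def sum_negf[symmetric] algebra_simps)

lemma herm_self: "herm z z = of_real ((norm z)\<^sup>2)"
proof -
  have "(\<i> *s z) \<bullet> z = 0" by (simp add: inner_vec_def inner_complex_def)
  then show ?thesis by (simp add: herm_eq_inner dot_square_norm complex_of_real_def)
qed

lemma norm_herm_le: "norm (herm z w) \<le> norm z * norm w"
proof -
  have "norm (herm z w) \<le> (\<Sum>j\<in>UNIV. \<bar>norm (z $ j)\<bar> * \<bar>norm (w $ j)\<bar>)"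
    unfolding herm_def by (rule order_trans[OF norm_sum]) (simp add: norm_mult)
  also have "\<dots> \<le> norm z * norm w" unfolding norm_vec_def by (rule L2_set_mult_ineq)
  finally show ?thesis .
qed

text \<open>The Householder reflection in the hyperplane orthogonal to u - v; the equality of norms
  makes it take u to v.\<close>

lemma exists_reflection:
  fixes u v :: "'a::euclidean_space"
  assumes "norm u = norm v"
  shows "\<exists>S. linear S \<and> (\<forall>x. norm (S x) = norm x) \<and> S u = v \<and> (\<forall>x. x \<bullet> (u - v) = 0 \<longrightarrow> S x = x)"
proof -
  define d where "d = u - v"
  define S where "S x = x - (2 * (x \<bullet> d) / (d \<bullet> d)) *\<^sub>R d" for x
  have lin: "linear S"
    by (rule linearI) (simp_all add: S_def inner_add_left algebra_simps add_divide_distrib)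
  have nrm: "norm (S x) = norm x" for x
  proof (cases "d = 0")
    case False
    have "S x \<bullet> S x = x \<bullet> x"
      using False by (simp add: S_def inner_diff_left inner_diff_right inner_commute field_simps power2_eq_square)
    then show ?thesis by (simp add: norm_eq)
  qed (simp add: S_def)
  have "S u = v"
  proof (cases "d = 0")
    case False
    have "u \<bullet> u = v \<bullet> v" using assms by (simp add: norm_eq)
    then have "2 * (u \<bullet> d) = d \<bullet> d" by (simp add: d_def inner_diff_left inner_diff_right inner_commute)
    then show ?thesis using False by (simp add: S_def) (simp add: d_def)
  qed (simp add: S_def d_def)
  moreover have "x \<bullet> (u - v) = 0 \<Longrightarrow> S x = x" for x by (simp add: S_def d_def)
  ultimately show ?thesis using lin nrm by blast
qed

text \<open>Two real reflections suffice: the first takes \<open>axis i0 1\<close> to f = z / |z|,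
  the second takes the image of \<open>axis i0 \<i>\<close> to i f and keeps f. Real linearity of T
  is enough, because \<open>herm z (T w)\<close> is determined by the real inner products of
  \<open>T w\<close> with f and i f, which equal the real and imaginary parts of
  \<open>w $ i0\<close>.\<close>

lemma exists_rotation_to_axis:
  fixes z :: "complex ^ 'n" and i0 :: 'n
  shows "\<exists>T. linear T \<and> (\<forall>x. norm (T x) = norm x) \<and> (\<forall>w. herm z (T w) = of_real (norm z) * cnj (w $ i0))"
proof (cases "z = 0")
  case True
  then show ?thesis by (intro exI[of _ id]) (auto simp: herm_def id_def linear_id[unfolded id_def])
next
  case False
  define f where "f = inverse (of_real (norm z)) *s z"
  define e where "e = (axis i0 1 :: complex ^ 'n)"
  define e' where "e' = (axis i0 \<i> :: complex ^ 'n)"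
  have zf: "z = of_real (norm z) *s f" using False by (simp add: f_def vec_eq_iff)
  have nf: "norm f = 1" using False by (simp add: f_def norm_vector_smult norm_inverse)
  have ne: "norm e = 1" "norm e' = 1" by (simp_all add: e_def e'_def)
  have nif: "norm (\<i> *s f) = 1" using nf by (simp add: norm_vector_smult)
  obtain S1 where S1: "linear S1" "\<And>x. norm (S1 x) = norm x" "S1 e = f"
    using exists_reflection[of e f] ne nf by auto
  obtain S2 where S2: "linear S2" "\<And>x. norm (S2 x) = norm x" "S2 (S1 e') = \<i> *s f"
      "\<And>x. x \<bullet> (S1 e' - \<i> *s f) = 0 \<Longrightarrow> S2 x = x"
    using exists_reflection[of "S1 e'" "\<i> *s f"] ne nif S1(2) by auto
  have inner: "T x \<bullet> T y = x \<bullet> y" if "linear T" "\<And>x. norm (T x) = norm x" for T :: "complex ^ 'n \<Rightarrow> _" and x y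
    using that by (simp add: dot_norm linear_add[OF that(1), symmetric])
  \<comment> \<open>The second reflection fixes f, since f is orthogonal to \<open>S1 e'\<close> by
    isometry and to i f always.\<close>
  have "f \<bullet> (S1 e' - \<i> *s f) = 0"
  proof -
    have "f \<bullet> S1 e' = e \<bullet> e'" using inner[OF S1(1,2), of e e'] S1(3) by simp
    also have "\<dots> = 0" by (simp add: e_def e'_def inner_axis_axis inner_complex_def)
    finally have "f \<bullet> S1 e' = 0" .
    moreover have "f \<bullet> (\<i> *s f) = 0" by (simp add: inner_vec_def inner_complex_def)
    ultimately show ?thesis by (simp add: inner_diff_right)
  qed
  then have Te: "S2 (S1 e) = f" using S2(4) S1(3) by simp
  define T where "T = S2 \<circ> S1"
  have T: "linear T" "\<And>x. norm (T x) = norm x" using S1 S2 by (auto simp: T_def linear_compose)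
  have "herm z (T w) = of_real (norm z) * cnj (w $ i0)" for w
  proof -
    have "f \<bullet> T w = e \<bullet> w" using inner[OF T, of e w] Te by (simp add: T_def)
    also have "e \<bullet> w = Re (w $ i0)" by (simp add: e_def inner_axis' inner_complex_def)
    finally have 1: "f \<bullet> T w = Re (w $ i0)" .
    have "(\<i> *s f) \<bullet> T w = e' \<bullet> w" using inner[OF T, of e' w] S2(3) by (simp add: T_def)
    also have "e' \<bullet> w = Im (w $ i0)" by (simp add: e'_def inner_axis' inner_complex_def)
    finally have 2: "(\<i> *s f) \<bullet> T w = Im (w $ i0)" .
    have "herm f (T w) = cnj (w $ i0)" using 1 2 by (simp add: herm_eq_inner complex_eq_iff)
    then show ?thesis by (subst zf) (simp add: herm_smult_left)
  qed
  then show ?thesis using T by blast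
qed

lemma continuous_on_circ_smult:
  "continuous_on A f \<Longrightarrow> continuous_on A g \<Longrightarrow> continuous_on A (\<lambda>x. circ (f x) *s (g x :: complex ^ 'n))"
  unfolding vector_scalar_mult_def by (intro continuous_intros)

text \<open>Multiplication by a unimodular scalar preserves the measure, so averaging over all of
  them changes nothing. This is how circle means enter the integral over w.\<close>

lemma nn_integral_rotation_average:
  fixes f :: "complex ^ 'n \<Rightarrow> ennreal"
  assumes [measurable]: "f \<in> borel_measurable borel"
  shows "(\<integral>\<^sup>+w. f w \<partial>lborel) = (\<integral>\<^sup>+w. \<integral>\<^sup>+t. f (circ t *s w) \<partial>unit_interval \<partial>lborel)"
proof -
  interpret U: prob_space unit_interval by (rule prob_space_unit_interval)
  interpret P: pair_sigma_finite "lborel :: (complex ^ 'n) measure" unit_interval by standard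
  have "(\<lambda>x :: (complex ^ 'n) \<times> real. circ (snd x) *s fst x) \<in> borel_measurable (lborel \<Otimes>\<^sub>M unit_interval)"
    by (intro borel_measurable_pair measurable_unit_interval_borel borel_measurable_continuous_onI
        continuous_on_circ_smult continuous_intros) simp
  then have [measurable]: "(\<lambda>(w :: complex ^ 'n, t). circ t *s w) \<in> borel_measurable (lborel \<Otimes>\<^sub>M unit_interval)"
    by (simp add: case_prod_unfold)
  have "(\<integral>\<^sup>+w. f w \<partial>lborel) = (\<integral>\<^sup>+t. (\<integral>\<^sup>+w. f w \<partial>lborel) \<partial>unit_interval)"
    by (simp only: nn_integral_unit_interval_const)
  also have "\<dots> = (\<integral>\<^sup>+t. (\<integral>\<^sup>+w. f (circ t *s w) \<partial>lborel) \<partial>unit_interval)"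
    by (intro nn_integral_cong nn_integral_lborel_isometry[symmetric] linear_vector_smult)
       (auto simp: norm_vector_smult)
  also have "\<dots> = (\<integral>\<^sup>+w. \<integral>\<^sup>+t. f (circ t *s w) \<partial>unit_interval \<partial>lborel)"
    by (rule P.Fubini') measurable
  finally show ?thesis .
qed

lemma ennreal_power_mono: "(x::ennreal) \<le> y \<Longrightarrow> x ^ k \<le> y ^ k"
  by (induction k) (auto intro!: mult_mono)

text \<open>The integral factorizes. With kappa of order (1 + a)^(2(l - 1)), the distinguished
  coordinate contributes a / sqrt kappa + 1 / kappa, at most of order (1 + a)^(2 - l), and each of
  the other n - 1 contributes 1 / kappa.\<close>

lemma nn_integral_gaussian_product_bound:
  fixes i0 :: "'n::finite" and l c :: real
  assumes l: "l \<ge> 1" and c: "c > 0"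
  shows "\<exists>C>0. \<forall>a\<ge>0. (\<integral>\<^sup>+(w :: complex ^ 'n). ennreal (exp (- (c * (1 + a) powr (2 * (l - 1)))
       * ((a - norm (w $ i0))\<^sup>2 + (\<Sum>j\<in>UNIV - {i0}. (norm (w $ j))\<^sup>2)))) \<partial>lborel)
     \<le> ennreal (C * (1 + a) powr (2 - l - 2 * (l - 1) * (real CARD('n) - 1)))"
proof -
  obtain G where G: "G > 0" "\<And>\<kappa> a. \<kappa> > 0 \<Longrightarrow> a \<ge> 0 \<Longrightarrow>
     (\<integral>\<^sup>+w. ennreal (exp (- \<kappa> * (a - norm (w::complex))\<^sup>2)) \<partial>lborel) \<le> ennreal (G * (a / sqrt \<kappa> + 1 / \<kappa>))"
    using gaussian_annulus_bound by blast
  define K where "K = 1 / sqrt c + 1 / c"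
  have K: "K > 0" using c by (auto simp: K_def intro!: add_pos_pos)
  define C where "C = G * K * (G / c) ^ (CARD('n) - 1)"
  have key: "(\<integral>\<^sup>+(w :: complex ^ 'n). ennreal (exp (- (c * (1 + a) powr (2 * (l - 1)))
       * ((a - norm (w $ i0))\<^sup>2 + (\<Sum>j\<in>UNIV - {i0}. (norm (w $ j))\<^sup>2)))) \<partial>lborel)
     \<le> ennreal (C * (1 + a) powr (2 - l - 2 * (l - 1) * (real CARD('n) - 1)))" if a: "a \<ge> 0" for a
  proof -
    define \<kappa> where "\<kappa> = c * (1 + a) powr (2 * (l - 1))"
    have \<kappa>: "\<kappa> > 0" using c a by (simp add: \<kappa>_def)
    define g where "g j u = (if j = i0 then exp (- \<kappa> * (a - norm u)\<^sup>2) else exp (- \<kappa> * (0 - norm u)\<^sup>2))"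
      for j :: 'n and u :: complex
    have [measurable]: "g j \<in> borel_measurable borel" for j
      unfolding g_def[abs_def] by simp
    have "(\<integral>\<^sup>+(w :: complex ^ 'n). ennreal (exp (- \<kappa> * ((a - norm (w $ i0))\<^sup>2 + (\<Sum>j\<in>UNIV - {i0}. (norm (w $ j))\<^sup>2)))) \<partial>lborel)
      = (\<integral>\<^sup>+(w :: complex ^ 'n). (\<Prod>j\<in>UNIV. ennreal (g j (w $ j))) \<partial>lborel)"
    proof (rule nn_integral_cong)
      fix w :: "complex ^ 'n"
      have "(\<Prod>j\<in>UNIV. g j (w $ j)) = g i0 (w $ i0) * (\<Prod>j\<in>UNIV - {i0}. g j (w $ j))"
        by (rule prod.remove) auto
      also have "(\<Prod>j\<in>UNIV - {i0}. g j (w $ j)) = (\<Prod>j\<in>UNIV - {i0}. exp (- \<kappa> * (norm (w $ j))\<^sup>2))"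
        by (intro prod.cong) (auto simp: g_def)
      also have "\<dots> = exp (\<Sum>j\<in>UNIV - {i0}. - \<kappa> * (norm (w $ j))\<^sup>2)" by (simp add: exp_sum)
      also have "g i0 (w $ i0) * \<dots> = exp (- \<kappa> * ((a - norm (w $ i0))\<^sup>2 + (\<Sum>j\<in>UNIV - {i0}. (norm (w $ j))\<^sup>2)))"
      proof -
        have "g i0 (w $ i0) = exp (- \<kappa> * (a - norm (w $ i0))\<^sup>2)" by (simp add: g_def)
        then show ?thesis by (simp only: exp_add[symmetric] sum_distrib_left[symmetric] distrib_left)
      qed
      finally show "ennreal (exp (- \<kappa> * ((a - norm (w $ i0))\<^sup>2 + (\<Sum>j\<in>UNIV - {i0}. (norm (w $ j))\<^sup>2))))
         = (\<Prod>j\<in>UNIV. ennreal (g j (w $ j)))"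
        by (subst prod_ennreal) (auto simp: g_def)
    qed
    also have "\<dots> = (\<Prod>j\<in>UNIV. \<integral>\<^sup>+u. ennreal (g j u) \<partial>lborel)"
      by (rule nn_integral_lborel_vec_prod) measurable
    also have "\<dots> = (\<integral>\<^sup>+u. ennreal (g i0 u) \<partial>lborel) * (\<Prod>j\<in>UNIV - {i0}. \<integral>\<^sup>+u. ennreal (g j u) \<partial>lborel)"
      by (rule prod.remove) auto
    also have "\<dots> \<le> ennreal (G * (a / sqrt \<kappa> + 1 / \<kappa>)) * (\<Prod>j\<in>UNIV - {i0}. ennreal (G * (0 / sqrt \<kappa> + 1 / \<kappa>)))"
      using G(2)[OF \<kappa> a] G(2)[OF \<kappa> order_refl]
      by (intro mult_mono) (auto simp: g_def intro: ennreal_power_mono)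
    also have "\<dots> = ennreal (G * (a / sqrt \<kappa> + 1 / \<kappa>) * (G / \<kappa>) ^ (CARD('n) - 1))"
      using G \<kappa> a by (simp add: ennreal_mult' ennreal_power card_Diff_singleton)
    also have "G * (a / sqrt \<kappa> + 1 / \<kappa>) * (G / \<kappa>) ^ (CARD('n) - 1)
       \<le> C * (1 + a) powr (2 - l - 2 * (l - 1) * (real CARD('n) - 1))"
    proof -
      have sq: "sqrt \<kappa> = sqrt c * (1 + a) powr (l - 1)"
        unfolding \<kappa>_def using a by (subst powr_double) (auto simp: real_sqrt_mult)
      have "a / sqrt \<kappa> \<le> (1 + a) / sqrt \<kappa>" using \<kappa> by (intro divide_right_mono) auto
      also have "\<dots> = (1 / sqrt c) * ((1 + a) powr 1 / (1 + a) powr (l - 1))" using a by (simp add: sq)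
      also have "(1 + a) powr 1 / (1 + a) powr (l - 1) = (1 + a) powr (2 - l)"
        by (simp add: powr_diff[symmetric] del: powr_one')
      finally have 1: "a / sqrt \<kappa> \<le> 1 / sqrt c * (1 + a) powr (2 - l)" .
      have i\<kappa>: "1 / \<kappa> = 1 / c * (1 + a) powr (- (2 * (l - 1)))" by (simp only: \<kappa>_def powr_minus) (simp add: divide_inverse)
      also have "\<dots> \<le> 1 / c * (1 + a) powr (2 - l)" using a c l by (intro mult_left_mono powr_mono) auto
      finally have "a / sqrt \<kappa> + 1 / \<kappa> \<le> K * (1 + a) powr (2 - l)" using 1 by (simp add: K_def distrib_right)
      moreover have "(G / \<kappa>) ^ (CARD('n) - 1) = (G / c) ^ (CARD('n) - 1) * (1 + a) powr (- (2 * (l - 1)) * (real CARD('n) - 1))"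
      proof -
        have "G / \<kappa> = G / c * (1 + a) powr (- (2 * (l - 1)))" using i\<kappa> by (simp add: divide_inverse)
        moreover have "((1 + a) powr (- (2 * (l - 1)))) ^ (CARD('n) - 1) = (1 + a) powr (- (2 * (l - 1)) * (real CARD('n) - 1))"
          using a by (simp add: powr_realpow[symmetric] powr_powr of_nat_diff)
        ultimately show ?thesis by (simp only: power_mult_distrib)
      qed
      ultimately have "G * (a / sqrt \<kappa> + 1 / \<kappa>) * (G / \<kappa>) ^ (CARD('n) - 1)
         \<le> G * (K * (1 + a) powr (2 - l)) * ((G / c) ^ (CARD('n) - 1) * (1 + a) powr (- (2 * (l - 1)) * (real CARD('n) - 1)))"
        using G(1) K c \<kappa> a by (intro mult_mono mult_left_mono) (auto intro!: mult_nonneg_nonneg)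
      also have "\<dots> = C * ((1 + a) powr (2 - l) * (1 + a) powr (- (2 * (l - 1)) * (real CARD('n) - 1)))"
        by (simp only: C_def mult_ac)
      also have "(1 + a) powr (2 - l) * (1 + a) powr (- (2 * (l - 1)) * (real CARD('n) - 1))
         = (1 + a) powr (2 - l - 2 * (l - 1) * (real CARD('n) - 1))"
        by (simp add: powr_add[symmetric] algebra_simps)
      finally show ?thesis .
    qed
    finally show ?thesis unfolding \<kappa>_def by (auto intro: ennreal_leI order_trans)
  qed
  moreover have "C > 0" using G K c by (simp add: C_def)
  ultimately show ?thesis by blast
qed

lemma norm_vec_split: "norm (w :: complex ^ 'n) = sqrt ((norm (w $ i0))\<^sup>2 + (\<Sum>j\<in>UNIV - {i0}. (norm (w $ j))\<^sup>2))"
  unfolding norm_vec_def L2_set_def by (subst sum.remove[of UNIV i0]) auto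

lemma fock_kernel_L1_bound:
  fixes l \<sigma> :: real assumes l: "l \<ge> 1"
  shows "\<exists>C>0. \<forall>z :: complex ^ 'n. (\<integral>\<^sup>+w. ennreal (norm (fock_series CARD('n) l (herm z w))
      * exp (- (1/2) * (norm z powr (2 * l) + norm w powr (2 * l))) * ((1 + norm z) / (1 + norm w)) powr \<sigma>) \<partial>lborel)
     \<le> ennreal C"
proof -
  define n where "n = CARD('n)"
  have n: "n \<ge> 1" by (simp add: n_def Suc_leI)
  define e where "e = real n * (l - 1) - l / 2"
  obtain i0 :: 'n where True by simp
  obtain A where A: "A > 0" "\<And>z. (\<integral>\<^sup>+t. ennreal (norm (fock_series n l (circ t * z))) \<partial>unit_interval)
     \<le> ennreal (A * exp (norm z powr l) * (1 + norm z) powr e)"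
    using circle_mean_fock_series[OF n l] unfolding e_def by blast
  obtain B c where B: "B > 0" "c > 0" "\<And>a b s. 0 \<le> a \<Longrightarrow> 0 \<le> b \<Longrightarrow> 0 \<le> s \<Longrightarrow>
     exp (a powr l * b powr l) * (1 + a * b) powr e * exp (- (1/2) * (a powr (2 * l) + (b\<^sup>2 + s\<^sup>2) powr l))
       * ((1 + a) / (1 + sqrt (b\<^sup>2 + s\<^sup>2))) powr \<sigma>
     \<le> B * (1 + a) powr (2 * e) * exp (- (c * (1 + a) powr (2 * (l - 1))) * ((a - b)\<^sup>2 + s\<^sup>2))"
    using weighted_energy_bound[OF l, of e \<sigma>]
    by - (elim exE conjE, erule (1) that, blast)
  obtain D where D: "D > 0" "\<And>a. a \<ge> 0 \<Longrightarrow> (\<integral>\<^sup>+(w :: complex ^ 'n). ennreal (exp (- (c * (1 + a) powr (2 * (l - 1)))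
       * ((a - norm (w $ i0))\<^sup>2 + (\<Sum>j\<in>UNIV - {i0}. (norm (w $ j))\<^sup>2)))) \<partial>lborel)
     \<le> ennreal (D * (1 + a) powr (2 - l - 2 * (l - 1) * (real n - 1)))"
    using nn_integral_gaussian_product_bound[OF l B(2), of i0] unfolding n_def by blast
  have key: "(\<integral>\<^sup>+w. ennreal (norm (fock_series n l (herm z w))
      * exp (- (1/2) * (norm z powr (2 * l) + norm w powr (2 * l))) * ((1 + norm z) / (1 + norm w)) powr \<sigma>) \<partial>lborel)
     \<le> ennreal (A * B * D)" for z :: "complex ^ 'n"
  proof -
    define a where "a = norm z"
    have a: "a \<ge> 0" by (simp add: a_def)
    define G where "G w = exp (- (1/2) * (a powr (2 * l) + norm w powr (2 * l))) * ((1 + a) / (1 + norm w)) powr \<sigma>"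
      for w :: "complex ^ 'n"
    have G0: "G w \<ge> 0" for w by (simp add: G_def)
    have [measurable]: "fock_series n l \<in> borel_measurable borel"
      by (intro borel_measurable_continuous_onI continuous_on_fock_series[OF n l])
    have [measurable]: "cnj \<in> borel_measurable borel"
      by (intro borel_measurable_continuous_onI continuous_intros)
    have [measurable]: "(\<lambda>w :: complex ^ 'n. w $ i) \<in> borel_measurable borel" for i
      by (intro borel_measurable_continuous_onI continuous_intros)
    have [measurable]: "(\<lambda>w :: complex ^ 'n. herm z w) \<in> borel_measurable borel"
      by (intro borel_measurable_continuous_onI continuous_intros)
    have [measurable]: "G \<in> borel_measurable borel" unfolding G_def[abs_def] by measurable
    obtain T where T: "linear T" "\<And>x. norm (T x) = norm x" "\<And>w. herm z (T w) = of_real a * cnj (w $ i0)"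
      using exists_rotation_to_axis[of z i0] unfolding a_def by blast
    have "(\<integral>\<^sup>+w. ennreal (norm (fock_series n l (herm z w)) * G w) \<partial>lborel)
      = (\<integral>\<^sup>+w. ennreal (norm (fock_series n l (herm z (T w))) * G (T w)) \<partial>lborel)"
      by (rule nn_integral_lborel_isometry[OF T(1,2), symmetric]) measurable
    also have "\<dots> = (\<integral>\<^sup>+w. ennreal (norm (fock_series n l (of_real a * cnj (w $ i0))) * G w) \<partial>lborel)"
      by (simp only: T(3)) (simp only: G_def T(2))
    also have "\<dots> = (\<integral>\<^sup>+w. \<integral>\<^sup>+t. ennreal (norm (fock_series n l (of_real a * cnj ((circ t *s w) $ i0))) * G (circ t *s w)) \<partial>unit_interval \<partial>lborel)"
      by (rule nn_integral_rotation_average) measurable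
    also have "\<dots> \<le> (\<integral>\<^sup>+(w :: complex ^ 'n). ennreal (A * B * (1 + a) powr (2 * e)) * ennreal (exp (- (c * (1 + a) powr (2 * (l - 1)))
       * ((a - norm (w $ i0))\<^sup>2 + (\<Sum>j\<in>UNIV - {i0}. (norm (w $ j))\<^sup>2)))) \<partial>lborel)"
    proof (rule nn_integral_mono)
      fix w :: "complex ^ 'n"
      define b where "b = norm (w $ i0)"
      define s where "s = sqrt (\<Sum>j\<in>UNIV - {i0}. (norm (w $ j))\<^sup>2)"
      have b: "b \<ge> 0" by (simp add: b_def)
      have s: "s \<ge> 0" "s\<^sup>2 = (\<Sum>j\<in>UNIV - {i0}. (norm (w $ j))\<^sup>2)" by (auto simp: s_def sum_nonneg)
      have nw: "norm w = sqrt (b\<^sup>2 + s\<^sup>2)" unfolding s(2) b_def by (rule norm_vec_split)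
      have nw2: "norm w powr (2 * l) = (b\<^sup>2 + s\<^sup>2) powr l"
        by (subst powr_double_square) (auto simp: nw)
      have "(\<integral>\<^sup>+t. ennreal (norm (fock_series n l (of_real a * cnj ((circ t *s w) $ i0))) * G (circ t *s w)) \<partial>unit_interval)
         = (\<integral>\<^sup>+t. ennreal (norm (fock_series n l (of_real a * cnj ((circ t *s w) $ i0)))) * ennreal (G w) \<partial>unit_interval)"
        using G0 by (intro nn_integral_cong) (simp add: ennreal_mult G_def norm_vector_smult)
      also have "\<dots> = (\<integral>\<^sup>+t. ennreal (norm (fock_series n l (of_real a * cnj ((circ t *s w) $ i0)))) \<partial>unit_interval) * ennreal (G w)"
        by (rule nn_integral_multc) simp
      also have "(\<integral>\<^sup>+t. ennreal (norm (fock_series n l (of_real a * cnj ((circ t *s w) $ i0)))) \<partial>unit_interval) * ennreal (G w)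
         = (\<integral>\<^sup>+t. ennreal (norm (fock_series n l (circ t * (of_real a * (w $ i0))))) \<partial>unit_interval) * ennreal (G w)"
      proof -
        \<comment> \<open>The rotation acts on the conjugated argument. Since the coefficients are
          real, the conjugation moves outside the series, where the modulus ignores it.\<close>
        have "of_real a * cnj ((circ t *s w) $ i0) = cnj (circ t * (of_real a * (w $ i0)))" for t by (simp add: mult_ac)
        then show ?thesis by (simp only: fock_series_cnj[OF n l] complex_mod_cnj)
      qed
      also have "(\<integral>\<^sup>+t. ennreal (norm (fock_series n l (circ t * (of_real a * (w $ i0))))) \<partial>unit_interval) * ennreal (G w)
         \<le> ennreal (A * exp ((a * b) powr l) * (1 + a * b) powr e) * ennreal (G w)"
        using A(2)[of "of_real a * (w $ i0)"] a by (intro mult_right_mono) (auto simp: norm_mult b_def)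
      also have "\<dots> = ennreal (A * exp ((a * b) powr l) * (1 + a * b) powr e * G w)"
        using A G0 by (simp add: ennreal_mult)
      also have "\<dots> \<le> ennreal (A * (B * (1 + a) powr (2 * e) * exp (- (c * (1 + a) powr (2 * (l - 1))) * ((a - b)\<^sup>2 + s\<^sup>2))))"
      proof (rule ennreal_leI)
        have "exp (a powr l * b powr l) * (1 + a * b) powr e * G w \<le> B * (1 + a) powr (2 * e) * exp (- (c * (1 + a) powr (2 * (l - 1))) * ((a - b)\<^sup>2 + s\<^sup>2))"
          using B(3)[OF a b s(1)] unfolding G_def nw2 unfolding nw by (simp only: mult.assoc)
        then have "A * (exp (a powr l * b powr l) * (1 + a * b) powr e * G w) \<le> A * (B * (1 + a) powr (2 * e) * exp (- (c * (1 + a) powr (2 * (l - 1))) * ((a - b)\<^sup>2 + s\<^sup>2)))"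
          using A by (intro mult_left_mono) auto
        then show "A * exp ((a * b) powr l) * (1 + a * b) powr e * G w \<le> A * (B * (1 + a) powr (2 * e) * exp (- (c * (1 + a) powr (2 * (l - 1))) * ((a - b)\<^sup>2 + s\<^sup>2)))"
          using a b by (simp add: powr_mult mult.assoc)
      qed
      also have "\<dots> = ennreal (A * B * (1 + a) powr (2 * e)) * ennreal (exp (- (c * (1 + a) powr (2 * (l - 1))) * ((a - b)\<^sup>2 + s\<^sup>2)))"
        using A B by (simp add: ennreal_mult[symmetric] mult.assoc)
      finally show "(\<integral>\<^sup>+t. ennreal (norm (fock_series n l (of_real a * cnj ((circ t *s w) $ i0))) * G (circ t *s w)) \<partial>unit_interval)
        \<le> ennreal (A * B * (1 + a) powr (2 * e)) * ennreal (exp (- (c * (1 + a) powr (2 * (l - 1)))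
       * ((a - norm (w $ i0))\<^sup>2 + (\<Sum>j\<in>UNIV - {i0}. (norm (w $ j))\<^sup>2))))"
        unfolding s(2) b_def .
    qed
    also have "\<dots> = ennreal (A * B * (1 + a) powr (2 * e)) * (\<integral>\<^sup>+(w :: complex ^ 'n). ennreal (exp (- (c * (1 + a) powr (2 * (l - 1)))
       * ((a - norm (w $ i0))\<^sup>2 + (\<Sum>j\<in>UNIV - {i0}. (norm (w $ j))\<^sup>2)))) \<partial>lborel)"
      by (rule nn_integral_cmult) measurable
    also have "\<dots> \<le> ennreal (A * B * (1 + a) powr (2 * e)) * ennreal (D * (1 + a) powr (2 - l - 2 * (l - 1) * (real n - 1)))"
      by (intro mult_left_mono D a) auto
    also have "\<dots> = ennreal (A * B * D * ((1 + a) powr (2 * e) * (1 + a) powr (2 - l - 2 * (l - 1) * (real n - 1))))"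
    proof -
      have "ennreal x * ennreal y = ennreal (x * y)" if "x \<ge> 0" "y \<ge> 0" for x y
        using that by (simp add: ennreal_mult)
      from this[of "A * B * (1 + a) powr (2 * e)" "D * (1 + a) powr (2 - l - 2 * (l - 1) * (real n - 1))"]
      show ?thesis using A(1) B(1) D(1) by (simp only: mult_ac) simp
    qed
    \<comment> \<open>The cancellation that makes the bound uniform in z; it holds for the exact
      exponent e = n (l - 1) - l/2 of the circle mean.\<close>
    also have "(1 + a) powr (2 * e) * (1 + a) powr (2 - l - 2 * (l - 1) * (real n - 1)) = 1"
    proof -
      have "2 * e + (2 - l - 2 * (l - 1) * (real n - 1)) = 0" by (simp add: e_def algebra_simps)
      then show ?thesis using a by (simp add: powr_add[symmetric])
    qed
    finally show ?thesis by (simp only: G_def a_def mult_1_right mult.assoc)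
  qed
  then show ?thesis using A B D unfolding n_def by (intro exI[of _ "A * B * D"]) auto
qed

section \<open>Homogeneous parts of entire functions\<close>

lemma integrable_gaussian:
  assumes c: "c > 0"
  shows "integrable lborel (\<lambda>w :: complex ^ 'n. exp (- c * (norm w)\<^sup>2))"
proof (rule integrableI_bounded)
  obtain G where G: "\<And>\<kappa> a. \<kappa> > 0 \<Longrightarrow> a \<ge> 0 \<Longrightarrow>
     (\<integral>\<^sup>+w. ennreal (exp (- \<kappa> * (a - norm (w::complex))\<^sup>2)) \<partial>lborel) \<le> ennreal (G * (a / sqrt \<kappa> + 1 / \<kappa>))"
    using gaussian_annulus_bound by blast
  have "(\<integral>\<^sup>+(w :: complex ^ 'n). ennreal (norm (exp (- c * (norm w)\<^sup>2))) \<partial>lborel)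
    = (\<integral>\<^sup>+(w :: complex ^ 'n). (\<Prod>j\<in>UNIV. ennreal (exp (- c * (0 - norm (w $ j))\<^sup>2))) \<partial>lborel)"
  proof (rule nn_integral_cong)
    fix w :: "complex ^ 'n"
    have "(norm w)\<^sup>2 = (\<Sum>j\<in>UNIV. (norm (w $ j))\<^sup>2)"
      by (simp add: norm_vec_def L2_set_def sum_nonneg)
    then have "exp (- c * (norm w)\<^sup>2) = (\<Prod>j\<in>UNIV. exp (- c * (0 - norm (w $ j))\<^sup>2))"
      by (simp only: exp_sum[symmetric] sum_distrib_left[symmetric] finite) simp
    then show "ennreal (norm (exp (- c * (norm w)\<^sup>2))) = (\<Prod>j\<in>UNIV. ennreal (exp (- c * (0 - norm (w $ j))\<^sup>2)))"
      by (simp only: prod_ennreal[OF exp_ge_zero] real_norm_def abs_prod abs_exp_cancel)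
  qed
  also have "\<dots> = (\<Prod>j\<in>(UNIV::'n set). (\<integral>\<^sup>+u. ennreal (exp (- c * (0 - norm (u::complex))\<^sup>2)) \<partial>lborel))"
    by (rule nn_integral_lborel_vec_prod) measurable
  also have "\<dots> < \<infinity>"
  proof -
    have "(\<integral>\<^sup>+u. ennreal (exp (- c * (0 - norm (u::complex))\<^sup>2)) \<partial>lborel) < top"
      using G[OF c order_refl] by (rule le_less_trans) simp
    then show ?thesis by (simp add: power_less_top_ennreal)
  qed
  finally show "(\<integral>\<^sup>+(w :: complex ^ 'n). ennreal (norm (exp (- c * (norm w)\<^sup>2))) \<partial>lborel) < \<infinity>" .
qed simp

text \<open>For l >= 1, v^(2l) >= v^2 - 1, which costs a factor exp c; half of the resulting
  Gaussian absorbs the power.\<close>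

lemma weight_le_gaussian:
  fixes M c l :: real assumes c: "c > 0" and l: "l \<ge> 1"
  shows "\<exists>C>0. \<forall>v\<ge>0. (1 + v) powr M * exp (- c * v powr (2 * l)) \<le> C * exp (- (c / 2) * v\<^sup>2)"
proof -
  obtain C where C: "C > 0" "\<And>v. v \<ge> 0 \<Longrightarrow> (1 + v) powr \<bar>M\<bar> * exp (- (c/2) * v\<^sup>2) \<le> C"
    using powr_one_plus_gaussian_bounded[of "c/2" "\<bar>M\<bar>"] c by auto
  have "(1 + v) powr M * exp (- c * v powr (2 * l)) \<le> (exp c * C) * exp (- (c / 2) * v\<^sup>2)" if v: "v \<ge> 0" for v
  proof -
    have "v\<^sup>2 - 1 \<le> v powr (2 * l)"
    proof (cases "v \<ge> 1")
      case True
      have "v powr 2 \<le> v powr (2 * l)" using True l by (intro powr_mono) auto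
      then show ?thesis using True by simp
    next
      case False
      then have "v\<^sup>2 \<le> 1" using v by (simp add: power_le_one)
      moreover have "v powr (2 * l) \<ge> 0" by simp
      ultimately show ?thesis by linarith
    qed
    then have "c * (v\<^sup>2 - 1) \<le> c * v powr (2 * l)" using c by (intro mult_left_mono) auto
    then have "exp (- c * v powr (2 * l)) \<le> exp (c - c * v\<^sup>2)" by (simp add: algebra_simps)
    also have "\<dots> = exp c * exp (- (c/2) * v\<^sup>2) * exp (- (c/2) * v\<^sup>2)" by (simp add: exp_add[symmetric])
    finally have "(1 + v) powr M * exp (- c * v powr (2 * l))
       \<le> (1 + v) powr \<bar>M\<bar> * (exp c * exp (- (c/2) * v\<^sup>2) * exp (- (c/2) * v\<^sup>2))"
      using v by (intro mult_mono powr_mono) auto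
    also have "\<dots> = exp c * ((1 + v) powr \<bar>M\<bar> * exp (- (c/2) * v\<^sup>2)) * exp (- (c/2) * v\<^sup>2)" by (simp only: mult_ac)
    also have "\<dots> \<le> exp c * C * exp (- (c/2) * v\<^sup>2)"
      using C(2)[OF v] by (intro mult_right_mono mult_left_mono) auto
    finally show ?thesis .
  qed
  then show ?thesis using C(1) by (intro exI[of _ "exp c * C"]) auto
qed

lemma integrable_weight:
  fixes M c l :: real assumes c: "c > 0" and l: "l \<ge> 1"
  shows "integrable lborel (\<lambda>w :: complex ^ 'n. (1 + norm w) powr M * exp (- c * norm w powr (2 * l)))"
proof -
  obtain C where C: "C > 0" "\<And>v. v \<ge> 0 \<Longrightarrow> (1 + v) powr M * exp (- c * v powr (2 * l)) \<le> C * exp (- (c / 2) * v\<^sup>2)"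
    using weight_le_gaussian[OF c l, of M] by auto
  show ?thesis
  proof (rule Bochner_Integration.integrable_bound)
    show "integrable lborel (\<lambda>w :: complex ^ 'n. C * exp (- (c/2) * (norm w)\<^sup>2))"
      using c by (intro integrable_mult_right integrable_gaussian) auto
    show "AE w :: complex ^ 'n in lborel. norm ((1 + norm w) powr M * exp (- c * norm w powr (2 * l))) \<le> norm (C * exp (- (c/2) * (norm w)\<^sup>2))"
      using C by (intro AE_I2) auto
  qed measurable
qed

text \<open>Cauchy's formula in normalized arc length: on the unit circle, du / u^(k+1) = 2 pi i
  cnj(u)^k dt. Fourier coefficients on the circle are thus Taylor coefficients at 0.\<close>

lemma circle_integral_higher_deriv:
  assumes g: "g holomorphic_on UNIV"
  shows "(\<integral>t. g (circ t) * cnj (circ t) ^ k \<partial>unit_interval) = (deriv ^^ k) g 0 / fact k"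
proof -
  have gc: "continuous_on UNIV g" using g by (rule holomorphic_on_imp_continuous_on)
  let ?f = "\<lambda>t. g (circ t) * cnj (circ t) ^ k"
  have c: "continuous_on A ?f" for A
    by (intro continuous_intros continuous_on_compose2[OF gc]) auto
  have cp: "circlepath 0 1 t = circ t" for t
    by (simp add: circlepath circ_def cis_conv_exp mult_ac)
  have "((\<lambda>u. g u / (u - 0) ^ Suc k) has_contour_integral ((2 * pi * \<i>) / (fact k) * (deriv ^^ k) g 0)) (circlepath 0 1)"
    by (rule Cauchy_has_contour_integral_higher_derivative_circlepath)
       (auto intro: continuous_on_subset[OF gc] holomorphic_on_subset[OF g])
  then have "((\<lambda>t. g (circ t) / circ t ^ Suc k * vector_derivative (circlepath 0 1) (at t within {0..1}))
       has_integral ((2 * pi * \<i>) / (fact k) * (deriv ^^ k) g 0)) {0..1}"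
    unfolding has_contour_integral_def cp by simp
  moreover have "g (circ t) / circ t ^ Suc k * vector_derivative (circlepath 0 1) (at t within {0..1}) = (2 * pi * \<i>) * ?f t"
    if "t \<in> {0..1}" for t
  proof -
    have "vector_derivative (circlepath 0 1) (at t within {0..1}) = 2 * pi * \<i> * circ t"
      using that by (subst vector_derivative_circlepath01) (auto simp: circ_def cis_conv_exp mult_ac)
    moreover have "cnj (circ t) * circ t = 1" using complex_norm_square[of "circ t"] by (simp add: mult.commute)
    then have "1 / circ t ^ k = cnj (circ t) ^ k"
      by (metis divide_eq_eq mult_eq_0_iff power_mult_distrib power_one zero_neq_one power_0_left nonzero_eq_divide_eq power_eq_0_iff)
    moreover have "circ t \<noteq> 0" using norm_circ[of t] by (metis norm_zero zero_neq_one)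
    ultimately show ?thesis by (simp add: field_simps)
  qed
  ultimately have "((\<lambda>t. (2 * pi * \<i>) * ?f t) has_integral ((2 * pi * \<i>) / (fact k) * (deriv ^^ k) g 0)) {0..1}"
    by (rule has_integral_eq[rotated]) auto
  then have "integral {0..1} (\<lambda>t. (2 * pi * \<i>) * ?f t) = (2 * pi * \<i>) / (fact k) * (deriv ^^ k) g 0"
    by (rule integral_unique)
  then have "(2 * pi * \<i>) * integral {0..1} ?f = (2 * pi * \<i>) * ((deriv ^^ k) g 0 / fact k)"
    by simp
  then have "integral {0..1} ?f = (deriv ^^ k) g 0 / fact k"
    by (subst (asm) mult_cancel_left) simp
  moreover have "(\<integral>t. ?f t \<partial>unit_interval) = integral {0..1} ?f"
    using set_borel_integral_eq_integral(2)[OF borel_integrable_atLeastAtMost'[OF c[of "{0..1}"]]]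
    by (subst integral_restrict_space) (auto simp: set_lebesgue_integral_def)
  ultimately show ?thesis by simp
qed

section \<open>Homogeneous parts and their mean values\<close>

lemma entire_continuous: "entire G \<Longrightarrow> continuous_on UNIV G"
  unfolding entire_def by (metis continuous_at_imp_continuous_on has_derivative_continuous)

text \<open>Restriction to complex lines brings the one-variable theory to bear on entire functions
  of several variables.\<close>

lemma entire_affine_holomorphic:
  fixes G :: "complex ^ 'n \<Rightarrow> complex"
  assumes "entire G"
  shows "(\<lambda>\<zeta>. G (a + \<zeta> *s b)) holomorphic_on UNIV"
proof (subst holomorphic_on_open)
  show "\<forall>\<zeta>\<in>UNIV. \<exists>f'. ((\<lambda>\<zeta>. G (a + \<zeta> *s b)) has_field_derivative f') (at \<zeta>)"
  proof
    fix \<zeta> :: complex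
    obtain D where D: "(G has_derivative D) (at (a + \<zeta> *s b))" "\<And>c v. D (c *s v) = c * D v"
      using assms unfolding entire_def by blast
    have lin: "linear (\<lambda>\<zeta>::complex. \<zeta> *s b)"
      by (rule linearI) (simp_all add: vec_eq_iff algebra_simps)
    have "((\<lambda>\<zeta>. a + \<zeta> *s b) has_derivative (\<lambda>\<zeta>. \<zeta> *s b)) (at \<zeta>)"
      using has_derivative_add[OF has_derivative_const bounded_linear_imp_has_derivative[of "\<lambda>\<zeta>. \<zeta> *s b"]]
        lin by (simp add: linear_conv_bounded_linear)
    from has_derivative_compose[OF this D(1)]
    have "((\<lambda>\<zeta>. G (a + \<zeta> *s b)) has_derivative (\<lambda>x. D b * x)) (at \<zeta>)"
      by (simp add: D(2) mult.commute)
    then show "\<exists>f'. ((\<lambda>\<zeta>. G (a + \<zeta> *s b)) has_field_derivative f') (at \<zeta>)"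
      unfolding has_field_derivative_def by blast
  qed
qed simp

text \<open>Defined as a Fourier coefficient along the orbit of w under the circle, a form suited to
  measurability, bounds and Fubini's theorem. The equivalent Taylor coefficient along the ray
  through w supplies homogeneity and the expansion of G.\<close>

definition hom_part :: "(complex ^ 'n \<Rightarrow> complex) \<Rightarrow> nat \<Rightarrow> complex ^ 'n \<Rightarrow> complex" where
  "hom_part G k w = (\<integral>t. G (circ t *s w) * cnj (circ t) ^ k \<partial>unit_interval)"

context
  fixes G :: "complex ^ 'n \<Rightarrow> complex"
  assumes G: "entire G"
begin

lemma entire_ray_holomorphic: "(\<lambda>\<zeta>. G (\<zeta> *s w)) holomorphic_on A"
  using entire_affine_holomorphic[OF G, of 0 w] by (auto intro: holomorphic_on_subset)

lemma hom_part_deriv: "hom_part G k w = (deriv ^^ k) (\<lambda>\<zeta>. G (\<zeta> *s w)) 0 / fact k"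
  unfolding hom_part_def by (rule circle_integral_higher_deriv[OF entire_ray_holomorphic])

lemma hom_part_sums: "(\<lambda>k. hom_part G k w) sums G w"
  using holomorphic_power_series[OF entire_ray_holomorphic[of w], of 1 0 2] by (simp add: hom_part_deriv)

lemma hom_part_smult: "hom_part G k (c *s w) = c ^ k * hom_part G k w"
proof -
  have "(deriv ^^ k) (\<lambda>\<zeta>. G ((c * \<zeta>) *s w)) 0 = c ^ k * (deriv ^^ k) (\<lambda>\<zeta>. G (\<zeta> *s w)) (c * 0)"
    by (rule higher_deriv_compose_linear[OF entire_ray_holomorphic, of UNIV UNIV]) auto
  moreover have "(\<lambda>\<zeta>. G ((c * \<zeta>) *s w)) = (\<lambda>\<zeta>. G (\<zeta> *s (c *s w)))"
    by (simp add: vector_smult_assoc mult.commute)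
  ultimately show ?thesis by (simp add: hom_part_deriv)
qed

lemma hom_part_bound: "\<exists>K\<ge>0. \<forall>w. norm (hom_part G k w) \<le> K * norm w ^ k"
proof -
  have Gc: "continuous_on UNIV G" by (rule entire_continuous[OF G])
  have "bounded (G ` sphere 0 1)"
    by (intro compact_imp_bounded compact_continuous_image continuous_on_subset[OF Gc]) auto
  then obtain K0 where "\<forall>w\<in>sphere 0 1. norm (G w) \<le> K0" by (auto simp: bounded_iff)
  then have K0: "norm (G w) \<le> K0" if "norm w = 1" for w using that by simp
  define K where "K = max K0 0"
  have K: "K \<ge> 0" "\<And>w. norm w = 1 \<Longrightarrow> norm (G w) \<le> K" using K0 by (auto simp: K_def le_max_iff_disj)
  have unit: "norm (hom_part G k w) \<le> K" if "norm w = 1" for w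
  proof -
    interpret U: prob_space unit_interval by (rule prob_space_unit_interval)
    have int: "integrable unit_interval (\<lambda>t. G (circ t *s w) * cnj (circ t) ^ k)"
      by (intro integrable_unit_interval continuous_intros continuous_on_compose2[OF Gc] continuous_on_circ_smult) auto
    have "norm (hom_part G k w) \<le> (\<integral>t. norm (G (circ t *s w) * cnj (circ t) ^ k) \<partial>unit_interval)"
      unfolding hom_part_def by (rule integral_norm_bound)
    also have "\<dots> \<le> (\<integral>t. K \<partial>unit_interval)"
      using that by (intro integral_mono integrable_norm[OF int] integrable_const) (auto simp: norm_mult norm_power norm_vector_smult intro!: K(2))
    also have "\<dots> = K" using U.prob_space by simp
    finally show ?thesis .
  qed
  have "norm (hom_part G k w) \<le> K * norm w ^ k" for w
  proof (cases "w = 0")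
    case True
    show ?thesis
    proof (cases k)
      \<comment> \<open>The claimed bound at the origin is K, as 0^0 = 1. The part of degree 0 is
        constant, so its value at a unit vector may be used.\<close>
      case 0
      have "hom_part G 0 w = G w" by (simp add: hom_part_deriv True)
      also have "G w = hom_part G 0 (0 *s axis undefined 1)" by (simp add: hom_part_deriv True)
      also have "\<dots> = hom_part G 0 (axis undefined 1)" using hom_part_smult[of 0 0 "axis undefined 1"] by simp
      finally show ?thesis using unit[of "axis undefined 1"] 0 by simp
    next
      case (Suc k')
      then show ?thesis using hom_part_smult[of k 0 w] True K by simp
    qed
  next
    case False
    define u where "u = inverse (of_real (norm w)) *s w"
    have u: "norm u = 1" using False by (simp add: u_def norm_vector_smult norm_inverse)
    have w: "w = of_real (norm w) *s u" using False by (simp add: u_def vec_eq_iff)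
    have "norm (hom_part G k w) = norm w ^ k * norm (hom_part G k u)"
      by (subst w) (simp add: hom_part_smult norm_mult norm_power)
    also have "\<dots> \<le> norm w ^ k * K" using unit[OF u] by (intro mult_left_mono) auto
    finally show ?thesis by (simp add: mult.commute)
  qed
  then show ?thesis using K(1) by blast
qed

lemma borel_measurable_hom_part: "hom_part G k \<in> borel_measurable borel"
proof -
  interpret U: prob_space unit_interval by (rule prob_space_unit_interval)
  have Gc: "continuous_on UNIV G" by (rule entire_continuous[OF G])
  have "continuous_on UNIV (\<lambda>x :: (complex ^ 'n) \<times> real. G (circ (snd x) *s fst x) * cnj (circ (snd x)) ^ k)"
    by (intro continuous_intros continuous_on_compose2[OF Gc] continuous_on_circ_smult) auto
  then have "(\<lambda>x :: (complex ^ 'n) \<times> real. G (circ (snd x) *s fst x) * cnj (circ (snd x)) ^ k) \<in> borel_measurable (borel \<Otimes>\<^sub>M unit_interval)"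
    by (rule borel_measurable_pair[OF borel_measurable_continuous_onI _ measurable_unit_interval_borel]) simp
  then have "(\<lambda>(w :: complex ^ 'n, t). G (circ t *s w) * cnj (circ t) ^ k) \<in> borel_measurable (borel \<Otimes>\<^sub>M unit_interval)"
    by (simp add: case_prod_unfold)
  then show ?thesis
    unfolding hom_part_def[abs_def] by (rule U.borel_measurable_lebesgue_integral)
qed

text \<open>The mean value property of \<open>hom_part G k\<close> is inherited from \<open>G\<close> by Fubini's theorem; this
  avoids showing that \<open>hom_part G k\<close> is holomorphic.\<close>

lemma hom_part_mean_value:
  "(\<integral>s. hom_part G k (z + circ s *s v) * exp (- (circ s * b)) \<partial>unit_interval) = hom_part G k z"
proof -
  interpret U: prob_space unit_interval by (rule prob_space_unit_interval)
  interpret P: pair_prob_space unit_interval unit_interval by standard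
  have Gc: "continuous_on UNIV G" by (rule entire_continuous[OF G])
  define F where "F t s = G (circ t *s z + circ s *s (circ t *s v)) * exp (- (circ s * b)) * cnj (circ t) ^ k" for t s
  have Fc: "continuous_on UNIV (\<lambda>x. F (fst x) (snd x))" unfolding F_def
    by (intro continuous_intros continuous_on_compose2[OF Gc] continuous_on_circ_smult) auto
  have Fm: "(\<lambda>x. F (fst x) (snd x)) \<in> borel_measurable (unit_interval \<Otimes>\<^sub>M unit_interval)"
    by (intro borel_measurable_pair measurable_unit_interval_borel borel_measurable_continuous_onI Fc)
  have "bounded ((\<lambda>x. F (fst x) (snd x)) ` ({0..1} \<times> {0..1}))"
    by (intro compact_imp_bounded compact_continuous_image continuous_on_subset[OF Fc] compact_Times) auto
  then obtain K where K: "\<forall>x\<in>({0..1} \<times> {0..1}). norm (F (fst x) (snd x)) \<le> K" by (auto simp: bounded_iff)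
  have "integrable (unit_interval \<Otimes>\<^sub>M unit_interval) (\<lambda>x. F (fst x) (snd x))"
    using K Fm by (intro P.P.integrable_const_bound[of _ K] AE_I2) (auto simp: space_pair_measure)
  then have int: "integrable (unit_interval \<Otimes>\<^sub>M unit_interval) (case_prod F)" by (simp add: case_prod_unfold)
  have "(\<integral>s. hom_part G k (z + circ s *s v) * exp (- (circ s * b)) \<partial>unit_interval)
      = (\<integral>s. (\<integral>t. F t s \<partial>unit_interval) \<partial>unit_interval)"
  proof (rule Bochner_Integration.integral_cong[OF refl])
    fix s
    have "hom_part G k (z + circ s *s v) * exp (- (circ s * b))
       = (\<integral>t. G (circ t *s (z + circ s *s v)) * cnj (circ t) ^ k * exp (- (circ s * b)) \<partial>unit_interval)"
      unfolding hom_part_def by simp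
    also have "\<dots> = (\<integral>t. F t s \<partial>unit_interval)"
      by (simp add: F_def vector_add_ldistrib vector_smult_assoc mult_ac)
    finally show "hom_part G k (z + circ s *s v) * exp (- (circ s * b)) = (\<integral>t. F t s \<partial>unit_interval)" .
  qed
  also have "\<dots> = (\<integral>t. (\<integral>s. F t s \<partial>unit_interval) \<partial>unit_interval)"
    by (rule P.Fubini_integral[OF int])
  also have "\<dots> = (\<integral>t. G (circ t *s z) * cnj (circ t) ^ k \<partial>unit_interval)"
  proof (rule Bochner_Integration.integral_cong[OF refl])
    fix t
    \<comment> \<open>\<open>g\<close> is entire with \<open>g 0 = G (circ t *s z)\<close>, so its
      mean over the circle is this value; the exponential factor is 1 at the centre.\<close>
    define g where "g \<zeta> = G (circ t *s z + \<zeta> *s (circ t *s v)) * exp (- (\<zeta> * b))" for \<zeta>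
    have "g holomorphic_on UNIV" unfolding g_def
      by (intro holomorphic_intros entire_affine_holomorphic[OF G])
    from circle_integral_higher_deriv[OF this, of 0]
    have "(\<integral>s. g (circ s) \<partial>unit_interval) = G (circ t *s z)" by (simp add: g_def)
    moreover have "(\<integral>s. F t s \<partial>unit_interval) = (\<integral>s. g (circ s) * cnj (circ t) ^ k \<partial>unit_interval)"
      by (simp add: F_def g_def)
    ultimately show "(\<integral>s. F t s \<partial>unit_interval) = G (circ t *s z) * cnj (circ t) ^ k" by simp
  qed
  finally show ?thesis by (simp add: hom_part_def)
qed

end

lemma integral_rotation_average:
  fixes f :: "complex ^ 'n \<Rightarrow> complex"
  assumes f: "integrable lborel f"
  shows "(\<integral>w. f w \<partial>lborel) = (\<integral>w. (\<integral>t. f (circ t *s w) \<partial>unit_interval) \<partial>lborel)"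
proof -
  interpret U: prob_space unit_interval by (rule prob_space_unit_interval)
  interpret P: pair_sigma_finite unit_interval "lborel :: (complex ^ 'n) measure" by standard
  have [measurable]: "f \<in> borel_measurable borel" using f by auto
  have "(\<lambda>x :: real \<times> (complex ^ 'n). circ (fst x) *s snd x) \<in> borel_measurable (unit_interval \<Otimes>\<^sub>M lborel)"
    by (intro borel_measurable_pair measurable_unit_interval_borel borel_measurable_continuous_onI
        continuous_on_circ_smult continuous_intros) simp
  from measurable_compose[OF this, of f borel]
  have m2: "(\<lambda>x :: real \<times> (complex ^ 'n). f (circ (fst x) *s snd x)) \<in> borel_measurable (unit_interval \<Otimes>\<^sub>M lborel)"
    by simp
  have iso: "integrable lborel (\<lambda>w. f (circ t *s w))" for t
  proof -
    have "integrable (distr lborel borel (\<lambda>w. circ t *s w)) f"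
      using f by (subst lborel_distr_isometry) (auto intro: linear_vector_smult simp: norm_vector_smult)
    then show ?thesis
    proof (subst (asm) integrable_distr_eq)
      show "(\<lambda>w :: complex ^ 'n. circ t *s w) \<in> measurable lborel borel"
        unfolding vector_scalar_mult_def by (intro borel_measurable_continuous_onI continuous_intros | simp)+
    qed auto
  qed
  have rot: "(\<integral>w. h (circ t *s w) \<partial>lborel) = (\<integral>w. h w \<partial>lborel)" if "h \<in> borel_measurable borel"
    for h :: "complex ^ 'n \<Rightarrow> 'b::{banach, second_countable_topology}" and t
    using that by (intro integral_lborel_isometry linear_vector_smult) (auto simp: norm_vector_smult)
  have "integrable (unit_interval \<Otimes>\<^sub>M lborel) (\<lambda>x. f (circ (fst x) *s snd x))"
  proof (rule P.Fubini_integrable[OF m2])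
    show "integrable unit_interval (\<lambda>t. \<integral>w. norm (f (circ (fst (t, w)) *s snd (t, w))) \<partial>lborel)"
      using rot[of "\<lambda>w. norm (f w)"] by simp
  qed (auto simp: iso)
  then have int: "integrable (unit_interval \<Otimes>\<^sub>M lborel) (case_prod (\<lambda>t w. f (circ t *s w)))"
    by (simp add: case_prod_unfold)
  have "(\<integral>w. (\<integral>t. f (circ t *s w) \<partial>unit_interval) \<partial>lborel) = (\<integral>t. (\<integral>w. f (circ t *s w) \<partial>lborel) \<partial>unit_interval)"
    by (rule P.Fubini_integral[OF int])
  also have "\<dots> = (\<integral>w. f w \<partial>lborel)" using rot[of f] U.prob_space by simp
  finally show ?thesis by simp
qed

section \<open>Homogeneous functions against radial weights\<close>

lemma nn_integral_Gamma:
  assumes "s > -1"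
  shows "(\<integral>\<^sup>+u. ennreal (indicator {0..} u * u powr s * exp (- u)) \<partial>lborel) = ennreal (Gamma (s + 1))"
proof -
  have "((\<lambda>t. t powr (s + 1 - 1) / exp t) has_integral Gamma (s + 1)) {0..}"
    using assms by (intro Gamma_integral_real) auto
  from nn_integral_has_integral_lebesgue[OF _ this]
  have "(\<integral>\<^sup>+u. ennreal (indicator {0..} u * (u powr s / exp u)) \<partial>lborel) = ennreal (Gamma (s + 1))"
    by simp
  then show ?thesis by (simp add: exp_minus divide_inverse mult_ac)
qed

lemma integral_Gamma:
  fixes s :: real
  assumes "s > -1"
  shows "integrable lborel (\<lambda>u. indicator {0..} u * u powr s * exp (- u))"
    and "(\<integral>u. indicator {0..} u * u powr s * exp (- u) \<partial>lborel) = Gamma (s + 1)"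
proof -
  have "Gamma (s + 1) > 0" using assms by (intro Gamma_real_pos) simp
  then have G: "Gamma (s + 1) \<ge> 0" by simp
  have nn: "0 \<le> indicator {0..} u * u powr s * exp (- u)" for u :: real by (simp add: indicator_def)
  have "has_bochner_integral lborel (\<lambda>u. indicator {0..} u * u powr s * exp (- u)) (Gamma (s + 1))"
    by (rule has_bochner_integral_nn_integral) (use nn_integral_Gamma[OF assms] G nn in auto)
  then show "integrable lborel (\<lambda>u. indicator {0..} u * u powr s * exp (- u))"
    "(\<integral>u. indicator {0..} u * u powr s * exp (- u) \<partial>lborel) = Gamma (s + 1)"
    by (auto simp: has_bochner_integral_iff)
qed

text \<open>The layer-cake identity writes the weight as a superposition of balls of radius (u /
  alpha)^(1/(2l)). Homogeneity reduces each of them to the unit ball, with the factor (u / alpha)^s,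
  and integration against e^(-u) yields the Gamma factor. The integral over the unit ball is the
  same for all l and alpha, which links the Gaussian to the general weight.\<close>

lemma integral_homogeneous_exp:
  fixes q :: "complex ^ 'n \<Rightarrow> complex" and m :: nat and l \<alpha> K :: real
  assumes q[measurable]: "q \<in> borel_measurable borel"
    and hom: "\<And>t w. t > 0 \<Longrightarrow> q (t *\<^sub>R w) = of_real (t ^ m) * q w"
    and bnd: "\<And>w. norm (q w) \<le> K * norm w ^ m"
    and l: "l \<ge> 1" and \<alpha>: "\<alpha> > 0"
  defines "s \<equiv> (2 * real CARD('n) + real m) / (2 * l)"
  shows "integrable lborel (\<lambda>w. q w * of_real (exp (- \<alpha> * norm w powr (2 * l))))"
    and "(\<integral>w. q w * of_real (exp (- \<alpha> * norm w powr (2 * l))) \<partial>lborel)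
      = of_real (\<alpha> powr (- s) * Gamma (s + 1)) * (\<integral>w. q w * indicator (cball 0 1) w \<partial>lborel)"
proof -
  have s: "s > 0" using l by (auto simp: s_def intro!: divide_pos_pos add_pos_nonneg)
  have K: "norm w ^ m * K \<le> \<bar>K\<bar> * (1 + norm w) powr real m" for w :: "complex ^ 'n"
  proof -
    have "norm w ^ m \<le> (1 + norm w) ^ m" by (intro power_mono) auto
    also have "(1 + norm w) ^ m = (1 + norm w) powr real m" by (subst powr_realpow) (auto intro: add_pos_nonneg)
    finally have "norm w ^ m * \<bar>K\<bar> \<le> (1 + norm w) powr real m * \<bar>K\<bar>" by (intro mult_right_mono) auto
    moreover have "norm w ^ m * K \<le> norm w ^ m * \<bar>K\<bar>" by (intro mult_left_mono) auto
    ultimately show ?thesis by (simp add: mult.commute)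
  qed
  show int: "integrable lborel (\<lambda>w. q w * of_real (exp (- \<alpha> * norm w powr (2 * l))))"
  proof (rule Bochner_Integration.integrable_bound)
    show "integrable lborel (\<lambda>w :: complex ^ 'n. \<bar>K\<bar> * ((1 + norm w) powr real m * exp (- \<alpha> * norm w powr (2 * l))))"
      using \<alpha> l by (intro integrable_mult_right integrable_weight) auto
    show "AE w in lborel. norm (q w * of_real (exp (- \<alpha> * norm w powr (2 * l))))
        \<le> norm (\<bar>K\<bar> * ((1 + norm w) powr real m * exp (- \<alpha> * norm w powr (2 * l))))"
    proof (rule AE_I2)
      fix w
      have "norm (q w) * exp (- \<alpha> * norm w powr (2 * l)) \<le> (\<bar>K\<bar> * (1 + norm w) powr real m) * exp (- \<alpha> * norm w powr (2 * l))"
        using bnd[of w] K[of w] by (intro mult_right_mono) (auto simp: mult.commute)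
      then show "norm (q w * of_real (exp (- \<alpha> * norm w powr (2 * l))))
        \<le> norm (\<bar>K\<bar> * ((1 + norm w) powr real m * exp (- \<alpha> * norm w powr (2 * l))))"
        by (simp add: norm_mult abs_mult mult.assoc)
    qed
  qed measurable
  define Q where "Q = (\<integral>w. q w * indicator (cball 0 1) w \<partial>lborel)"
  define f where "f w u = q w * of_real (exp (- u) * indicator {\<alpha> * norm w powr (2 * l)..} u)" for w u
  have layer: "has_bochner_integral lborel (\<lambda>u. exp (- u) * indicator {a..} u) (exp (- a))" if "a \<ge> 0" for a :: real
  proof (rule has_bochner_integral_nn_integral)
    show "(\<integral>\<^sup>+u. ennreal (exp (- u) * indicator {a..} u) \<partial>lborel) = ennreal (exp (- a))"
      using nn_integral_exp_layer[OF that] by (simp add: ennreal_mult' ennreal_indicator)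
  qed auto
  have fm: "(\<lambda>(w, u). f w u) \<in> borel_measurable (lborel \<Otimes>\<^sub>M lborel)"
  proof -
    have [measurable]: "Measurable.pred (borel \<Otimes>\<^sub>M borel) (\<lambda>x :: (complex ^ 'n) \<times> real. \<alpha> * norm (fst x) powr (2 * l) \<le> snd x)"
      by measurable
    have "(\<lambda>x. f (fst x) (snd x)) = (\<lambda>x. q (fst x) * of_real (exp (- snd x) * of_bool (\<alpha> * norm (fst x) powr (2 * l) \<le> snd x)))"
      by (simp add: f_def indicator_def fun_eq_iff)
    also have "\<dots> \<in> borel_measurable (borel \<Otimes>\<^sub>M borel)" by measurable
    finally show ?thesis by (simp add: case_prod_unfold)
  qed
  have fint: "integrable (lborel \<Otimes>\<^sub>M lborel) (\<lambda>(w, u). f w u)"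
  proof (rule lborel_pair.Fubini_integrable[OF fm])
    have "(\<integral>u. norm (f w u) \<partial>lborel) = norm (q w * of_real (exp (- \<alpha> * norm w powr (2 * l))))" for w
    proof -
      have "(\<integral>u. norm (f w u) \<partial>lborel) = (\<integral>u. norm (q w) * (exp (- u) * indicator {\<alpha> * norm w powr (2 * l)..} u) \<partial>lborel)"
        by (intro Bochner_Integration.integral_cong refl) (simp add: f_def norm_mult indicator_def)
      then show ?thesis using layer[of "\<alpha> * norm w powr (2 * l)"] \<alpha>
        by (simp add: has_bochner_integral_iff norm_mult)
    qed
    then show "integrable lborel (\<lambda>x. \<integral>y. norm (case (x, y) of (w, u) \<Rightarrow> f w u) \<partial>lborel)"
      using integrable_norm[OF int] by simp
    show "AE x in lborel. integrable lborel (\<lambda>y. case (x, y) of (w, u) \<Rightarrow> f w u)"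
    proof (rule AE_I2)
      fix w
      show "integrable lborel (\<lambda>y. case (w, y) of (w, u) \<Rightarrow> f w u)"
        using layer[of "\<alpha> * norm w powr (2 * l)"] \<alpha> unfolding f_def prod.case
        by (intro integrable_mult_right integrable_of_real) (auto simp: has_bochner_integral_iff)
    qed
  qed
  have "(\<integral>w. q w * of_real (exp (- \<alpha> * norm w powr (2 * l))) \<partial>lborel) = (\<integral>w. (\<integral>u. f w u \<partial>lborel) \<partial>lborel)"
  proof (rule Bochner_Integration.integral_cong[OF refl])
    fix w
    have "(\<integral>u. f w u \<partial>lborel) = q w * (\<integral>u. of_real (exp (- u) * indicator {\<alpha> * norm w powr (2 * l)..} u) \<partial>lborel)"
      unfolding f_def by (rule integral_mult_right_zero)
    also have "\<dots> = q w * of_real (\<integral>u. exp (- u) * indicator {\<alpha> * norm w powr (2 * l)..} u \<partial>lborel)"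
      by (simp only: integral_complex_of_real)
    also have "\<dots> = q w * of_real (exp (- \<alpha> * norm w powr (2 * l)))"
      using layer[of "\<alpha> * norm w powr (2 * l)"] \<alpha> by (simp add: has_bochner_integral_iff)
    finally show "q w * of_real (exp (- \<alpha> * norm w powr (2 * l))) = (\<integral>u. f w u \<partial>lborel)" by simp
  qed
  also have "\<dots> = (\<integral>u. (\<integral>w. f w u \<partial>lborel) \<partial>lborel)"
    by (rule lborel_pair.Fubini_integral[OF fint, symmetric])
  also have "\<dots> = (\<integral>u. of_real (\<alpha> powr (- s) * (indicator {0..} u * u powr s * exp (- u))) * Q \<partial>lborel)"
  proof (rule integral_cong_AE)
    show "AE u in lborel. (\<integral>w. f w u \<partial>lborel) = of_real (\<alpha> powr (- s) * (indicator {0..} u * u powr s * exp (- u))) * Q"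
      using AE_lborel_singleton[of "0::real"]
    proof eventually_elim
      case (elim u)
      show ?case
      proof (cases "u > 0")
        case False
        then have "\<not> \<alpha> * norm w powr (2 * l) \<le> u" for w :: "complex ^ 'n"
          using elim \<alpha> mult_nonneg_nonneg[of \<alpha> "norm w powr (2 * l)"] by (smt (verit) powr_ge_zero)
        then show ?thesis using False elim by (simp add: f_def indicator_def)
      next
        case True
        define r where "r = (u / \<alpha>) powr (1 / (2 * l))"
        have r: "r > 0" using True \<alpha> by (simp add: r_def)
        have r2: "r powr (2 * l) = u / \<alpha>" using True \<alpha> l by (simp add: r_def powr_powr)
        have iff: "\<alpha> * norm w powr (2 * l) \<le> u \<longleftrightarrow> norm w \<le> r" for w :: "complex ^ 'n"
        proof -
          have "\<alpha> * norm w powr (2 * l) \<le> u \<longleftrightarrow> norm w powr (2 * l) \<le> r powr (2 * l)"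
            unfolding r2 using \<alpha> by (simp add: field_simps)
          also have "\<dots> \<longleftrightarrow> norm w \<le> r"
          proof
            assume "norm w powr (2 * l) \<le> r powr (2 * l)"
            then show "norm w \<le> r"
              using powr_less_mono2[of "2 * l" r "norm w"] l r by (meson less_le_trans mult_pos_pos not_le not_less_iff_gr_or_eq zero_less_numeral zero_less_one order_less_imp_le)
          qed (use l r in \<open>auto intro: powr_mono2\<close>)
          finally show ?thesis .
        qed
        have "(\<integral>w. f w u \<partial>lborel) = (\<integral>w. of_real (exp (- u)) * (q w * indicator (cball 0 r) w) \<partial>lborel)"
          by (intro Bochner_Integration.integral_cong refl) (auto simp: f_def indicator_def iff)
        also have "\<dots> = of_real (exp (- u)) * (\<integral>w. q w * indicator (cball 0 r) w \<partial>lborel)"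
          by (rule integral_mult_right_zero)
        also have "(\<integral>w. q w * indicator (cball 0 r) w \<partial>lborel)
          = (r ^ DIM(complex ^ 'n)) *\<^sub>R (\<integral>w. q (r *\<^sub>R w) * indicator (cball 0 r) (r *\<^sub>R w) \<partial>lborel)"
          by (rule integral_lborel_scale[OF borel_measurable_times[OF q borel_measurable_indicator] r]) simp
        also have "(\<lambda>w. q (r *\<^sub>R w) * indicator (cball 0 r) (r *\<^sub>R w)) = (\<lambda>w. of_real (r ^ m) * (q w * indicator (cball 0 1) w))"
          using r by (auto simp: fun_eq_iff hom indicator_def)
        also have "(\<integral>w. of_real (r ^ m) * (q w * indicator (cball 0 1) w) \<partial>lborel) = of_real (r ^ m) * Q"
          unfolding Q_def by (rule integral_mult_right_zero)
        also have "(r ^ DIM(complex ^ 'n)) *\<^sub>R (of_real (r ^ m) * Q) = of_real (r ^ (2 * CARD('n) + m)) * Q"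
          by (simp add: scaleR_conv_of_real power_add mult_ac)
        also have "r ^ (2 * CARD('n) + m) = \<alpha> powr (- s) * u powr s"
        proof -
          have "r ^ (2 * CARD('n) + m) = (u / \<alpha>) powr s"
            using r by (simp add: powr_realpow[symmetric] r_def powr_powr s_def)
          also have "\<dots> = \<alpha> powr (- s) * u powr s" using True \<alpha> by (simp add: powr_divide powr_minus_divide)
          finally show ?thesis .
        qed
        finally show ?thesis using True by (simp add: mult_ac)
      qed
    qed
    show "(\<lambda>u. \<integral>w. f w u \<partial>lborel) \<in> borel_measurable lborel"
      using borel_measurable_integrable[OF lborel_pair.integrable_snd[OF fint]] by simp
  qed measurable
  also have "\<dots> = (\<integral>u. of_real (\<alpha> powr (- s) * (indicator {0..} u * u powr s * exp (- u))) \<partial>lborel) * Q"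
    by (rule integral_mult_left_zero)
  also have "(\<integral>u. complex_of_real (\<alpha> powr (- s) * (indicator {0..} u * u powr s * exp (- u))) \<partial>lborel)
     = of_real (\<alpha> powr (- s) * Gamma (s + 1))"
    using integral_Gamma(2)[of s] s by (simp only: integral_complex_of_real integral_mult_right_zero)
  finally show "(\<integral>w. q w * of_real (exp (- \<alpha> * norm w powr (2 * l))) \<partial>lborel)
      = of_real (\<alpha> powr (- s) * Gamma (s + 1)) * (\<integral>w. q w * indicator (cball 0 1) w \<partial>lborel)"
    unfolding Q_def .
qed

lemma integral_lborel_translate:
  fixes c :: "'a::euclidean_space" and f :: "'a \<Rightarrow> 'b::{banach, second_countable_topology}"
  assumes [measurable]: "f \<in> borel_measurable borel"
  shows "(\<integral>x. f (c + x) \<partial>lborel) = (\<integral>x. f x \<partial>lborel)"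
proof -
  have "(\<integral>x. f x \<partial>lborel) = (\<integral>x. f x \<partial>distr lborel borel ((+) c))"
    by (simp add: lborel_distr_plus)
  also have "\<dots> = (\<integral>x. f (c + x) \<partial>lborel)"
    by (subst integral_distr) auto
  finally show ?thesis by simp
qed

text \<open>Translating by \<open>z\<close> turns \<open>herm z w - (norm w)\<^sup>2\<close> into \<open>- herm v z - (norm v)\<^sup>2\<close>, where
  \<open>herm v z\<close> is holomorphic in \<open>v\<close>, so that the mean value property applies on each circle.\<close>

lemma hom_part_gaussian_reproducing:
  fixes G :: "complex ^ 'n \<Rightarrow> complex"
  assumes G: "entire G"
  shows "(\<integral>w. hom_part G k w * herm z w ^ k * of_real (exp (- (norm w)\<^sup>2)) \<partial>lborel)
    = fact k * hom_part G k z * of_real (\<integral>(w :: complex ^ 'n). exp (- (norm w)\<^sup>2) \<partial>lborel)"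
proof -
  define g where "g = hom_part G k"
  have [measurable]: "g \<in> borel_measurable borel" unfolding g_def by (rule borel_measurable_hom_part[OF G])
  have [measurable]: "(\<lambda>w :: complex ^ 'n. herm z w) \<in> borel_measurable borel" "(\<lambda>w :: complex ^ 'n. herm w z) \<in> borel_measurable borel" for z
    by (intro borel_measurable_continuous_onI continuous_intros)+
  obtain K where K: "K \<ge> 0" "\<And>w. norm (g w) \<le> K * norm w ^ k"
    using hom_part_bound[OF G, of k] unfolding g_def by blast
  \<comment> \<open>\<open>exp (herm z w)\<close> is the reproducing kernel of the classical Fock
    space. The integral of \<open>f\<close> is evaluated twice: by the mean value property, and by
    rotation averaging, which retains only the term of degree k of the exponential.\<close>
  define f where "f w = g w * exp (herm z w) * of_real (exp (- (norm w)\<^sup>2))" for w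
  have [measurable]: "f \<in> borel_measurable borel" unfolding f_def by measurable
  have gauss: "integrable lborel (\<lambda>w :: complex ^ 'n. exp (- 1 * (norm w)\<^sup>2))" by (rule integrable_gaussian) simp
  have int: "integrable lborel f"
  proof (rule Bochner_Integration.integrable_bound)
    show "integrable lborel (\<lambda>w :: complex ^ 'n. K * exp ((norm z)\<^sup>2) * ((1 + norm w) powr real k * exp (- (3/4) * norm w powr (2 * 1))))"
      by (intro integrable_mult_right integrable_weight) auto
    show "AE w in lborel. norm (f w) \<le> norm (K * exp ((norm z)\<^sup>2) * ((1 + norm w) powr real k * exp (- (3/4) * norm w powr (2 * 1))))"
    proof (rule AE_I2)
      fix w
      have "norm (g w) \<le> K * (1 + norm w) powr real k"
      proof -
        have "norm w ^ k \<le> (1 + norm w) ^ k" by (intro power_mono) auto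
        also have "(1 + norm w) ^ k = (1 + norm w) powr real k" by (subst powr_realpow) (auto intro: add_pos_nonneg)
        finally show ?thesis using K(2)[of w] K(1) mult_left_mono by (meson order_trans)
      qed
      \<comment> \<open>|z| |w| <= |z|^2 + |w|^2 / 4 leaves three quarters of the Gaussian.\<close>
      moreover have "norm (exp (herm z w)) * exp (- (norm w)\<^sup>2) \<le> exp ((norm z)\<^sup>2) * exp (- (3/4) * norm w powr (2 * 1))"
      proof -
        have "norm (exp (herm z w)) \<le> exp (norm z * norm w)"
          using norm_herm_le[of z w] complex_Re_le_cmod[of "herm z w"] by simp
        then have "norm (exp (herm z w)) * exp (- (norm w)\<^sup>2) \<le> exp (norm z * norm w) * exp (- (norm w)\<^sup>2)"
          by (intro mult_right_mono) auto
        also have "\<dots> = exp (norm z * norm w - (norm w)\<^sup>2)" by (simp add: exp_add[symmetric])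
        also have "\<dots> \<le> exp ((norm z)\<^sup>2 - (3/4) * (norm w)\<^sup>2)"
        proof -
          have "0 \<le> (norm z - norm w / 2)\<^sup>2" by simp
          then show ?thesis by (simp add: power2_eq_square algebra_simps)
        qed
        also have "\<dots> = exp ((norm z)\<^sup>2) * exp (- (3/4) * (norm w)\<^sup>2)" by (simp add: exp_add[symmetric])
        finally show ?thesis by simp
      qed
      ultimately have "norm (g w) * (norm (exp (herm z w)) * exp (- (norm w)\<^sup>2))
         \<le> (K * (1 + norm w) powr real k) * (exp ((norm z)\<^sup>2) * exp (- (3/4) * norm w powr (2 * 1)))"
        by (rule mult_mono) (use K(1) in auto)
      then show "norm (f w) \<le> norm (K * exp ((norm z)\<^sup>2) * ((1 + norm w) powr real k * exp (- (3/4) * norm w powr (2 * 1))))"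
        using K(1) by (simp add: f_def norm_mult abs_mult mult_ac)
    qed
  qed measurable
  have 1: "(\<integral>w. f w \<partial>lborel) = g z * of_real (\<integral>(w :: complex ^ 'n). exp (- (norm w)\<^sup>2) \<partial>lborel)"
  proof -
    have ft: "f (z + v) = g (z + v) * exp (- herm v z) * of_real (exp (- (norm v)\<^sup>2))" for v
    proof -
      have "of_real ((norm (z + v))\<^sup>2) = herm z z + herm z v + herm v z + herm v v"
        unfolding herm_self[symmetric] by (simp add: herm_add_left herm_add_right)
      then have "herm z (z + v) + of_real (- (norm (z + v))\<^sup>2) = - herm v z + of_real (- (norm v)\<^sup>2)"
        by (simp add: herm_add_right herm_self)
      then have "exp (herm z (z + v)) * exp (of_real (- (norm (z + v))\<^sup>2)) = exp (- herm v z) * exp (of_real (- (norm v)\<^sup>2) :: complex)"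
        by (simp only: exp_add[symmetric])
      then show ?thesis by (simp only: f_def exp_of_real mult.assoc)
    qed
    have intt: "integrable lborel (\<lambda>v. f (z + v))"
    proof -
      have "integrable (distr lborel borel ((+) z)) f" using int by (simp add: lborel_distr_plus)
      then show ?thesis by (subst (asm) integrable_distr_eq) auto
    qed
    have "(\<integral>w. f w \<partial>lborel) = (\<integral>v. f (z + v) \<partial>lborel)"
      by (rule integral_lborel_translate[symmetric]) simp
    also have "\<dots> = (\<integral>v. (\<integral>t. f (z + circ t *s v) \<partial>unit_interval) \<partial>lborel)"
      by (rule integral_rotation_average[OF intt])
    also have "\<dots> = (\<integral>(v :: complex ^ 'n). g z * of_real (exp (- (norm v)\<^sup>2)) \<partial>lborel)"
    proof (rule Bochner_Integration.integral_cong[OF refl])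
      fix v
      have "(\<integral>t. f (z + circ t *s v) \<partial>unit_interval)
        = (\<integral>t. g (z + circ t *s v) * exp (- (circ t * herm v z)) * of_real (exp (- (norm v)\<^sup>2)) \<partial>unit_interval)"
        by (simp only: ft herm_smult_left norm_vector_smult norm_circ mult_1_left)
      also have "\<dots> = (\<integral>t. g (z + circ t *s v) * exp (- (circ t * herm v z)) \<partial>unit_interval) * of_real (exp (- (norm v)\<^sup>2))"
        by (rule integral_mult_left_zero)
      also have "(\<integral>t. g (z + circ t *s v) * exp (- (circ t * herm v z)) \<partial>unit_interval) = g z"
        unfolding g_def by (rule hom_part_mean_value[OF G])
      finally show "(\<integral>t. f (z + circ t *s v) \<partial>unit_interval) = g z * of_real (exp (- (norm v)\<^sup>2))" .
    qed
    also have "\<dots> = g z * (\<integral>(v :: complex ^ 'n). of_real (exp (- (norm v)\<^sup>2)) \<partial>lborel)" by (rule integral_mult_right_zero)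
    finally show ?thesis by (simp only: integral_complex_of_real)
  qed
  have 2: "(\<integral>w. f w \<partial>lborel) = (\<integral>w. g w * herm z w ^ k * of_real (exp (- (norm w)\<^sup>2)) \<partial>lborel) / fact k"
  proof -
    have ck: "cnj (circ t) * circ t = 1" for t using complex_norm_square[of "circ t"] by (simp add: mult.commute)
    \<comment> \<open>A Taylor coefficient of the exponential function; conjugation exchanges
      \<open>circ t\<close> with \<open>cnj (circ t)\<close> to match
      \<open>circle_integral_higher_deriv\<close>.\<close>
    have e: "(\<integral>t. circ t ^ k * exp (cnj (circ t) * h) \<partial>unit_interval) = h ^ k / fact k" for h
    proof -
      have "(\<integral>t. exp (circ t * cnj h) * cnj (circ t) ^ k \<partial>unit_interval) = (deriv ^^ k) (\<lambda>\<zeta>. exp (\<zeta> * cnj h)) 0 / fact k"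
        by (rule circle_integral_higher_deriv) (intro holomorphic_intros)
      also have "(deriv ^^ k) (\<lambda>\<zeta>. exp (\<zeta> * cnj h)) 0 = (deriv ^^ k) (\<lambda>\<zeta>. exp (cnj h * \<zeta>)) 0" by (simp add: mult.commute)
      also have "\<dots> = cnj h ^ k * (deriv ^^ k) exp (cnj h * 0)"
        by (rule higher_deriv_compose_linear[of exp UNIV UNIV]) (auto intro: holomorphic_intros)
      also have "(deriv ^^ k) exp = (exp :: complex \<Rightarrow> complex)"
      proof (induction k)
        case (Suc k)
        have "deriv exp = (exp :: complex \<Rightarrow> complex)" using DERIV_imp_deriv[OF DERIV_exp] by blast
        then show ?case using Suc by simp
      qed simp
      finally have "(\<integral>t. exp (circ t * cnj h) * cnj (circ t) ^ k \<partial>unit_interval) = cnj h ^ k / fact k" by simp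
      then have "cnj (\<integral>t. exp (circ t * cnj h) * cnj (circ t) ^ k \<partial>unit_interval) = h ^ k / fact k" by simp
      moreover have "cnj (\<integral>t. exp (circ t * cnj h) * cnj (circ t) ^ k \<partial>unit_interval)
         = (\<integral>t. cnj (exp (circ t * cnj h) * cnj (circ t) ^ k) \<partial>unit_interval)"
        by (rule Bochner_Integration.integral_cnj[symmetric])
      ultimately show ?thesis by (simp add: exp_cnj mult.commute)
    qed
    have "(\<integral>w. f w \<partial>lborel) = (\<integral>w. (\<integral>t. f (circ t *s w) \<partial>unit_interval) \<partial>lborel)"
      by (rule integral_rotation_average[OF int])
    also have "\<dots> = (\<integral>w. g w * herm z w ^ k * of_real (exp (- (norm w)\<^sup>2)) / fact k \<partial>lborel)"
    proof (rule Bochner_Integration.integral_cong[OF refl])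
      fix w
      have "(\<integral>t. f (circ t *s w) \<partial>unit_interval)
         = (\<integral>t. (g w * of_real (exp (- (norm w)\<^sup>2))) * (circ t ^ k * exp (cnj (circ t) * herm z w)) \<partial>unit_interval)"
        by (intro Bochner_Integration.integral_cong refl)
           (simp add: f_def g_def hom_part_smult[OF G] herm_smult_right norm_vector_smult mult_ac)
      also have "\<dots> = (g w * of_real (exp (- (norm w)\<^sup>2))) * (herm z w ^ k / fact k)"
        by (simp only: integral_mult_right_zero e)
      finally show "(\<integral>t. f (circ t *s w) \<partial>unit_interval) = g w * herm z w ^ k * of_real (exp (- (norm w)\<^sup>2)) / fact k"
        by simp
    qed
    finally show ?thesis by simp
  qed
  show ?thesis using 1 unfolding 2 g_def by (simp add: field_simps)
qed

text \<open>The integrand \<open>q\<close> is homogeneous of degree 2k under positive dilations, so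
  its integrals against all radial weights are known multiples of its integral \<open>Q\<close> over
  the unit ball. The Gaussian case l = 1 determines \<open>Q\<close>. The total mass n! V of the
  Gaussian brings in the volume V, which the normalization of \<open>dV\<close> removes.\<close>

lemma hom_part_reproducing:
  fixes G :: "complex ^ 'n \<Rightarrow> complex" and k :: nat
  assumes G: "entire G" and l: "l \<ge> 1" and \<alpha>: "\<alpha> > 0"
  defines "s \<equiv> real (k + CARD('n)) / l"
  shows "dV_const TYPE('n) *\<^sub>R (\<integral>w. hom_part G k w * herm z w ^ k * of_real (exp (- \<alpha> * norm w powr (2 * l))) \<partial>lborel)
    = of_real (\<alpha> powr (- s) * Gamma (s + 1) * fact k * fact CARD('n) / fact (CARD('n) + k)) * hom_part G k z"
proof -
  define n where "n = CARD('n)"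
  define q where "q w = hom_part G k w * herm z w ^ k" for w
  have [measurable]: "hom_part G k \<in> borel_measurable borel" by (rule borel_measurable_hom_part[OF G])
  have [measurable]: "(\<lambda>w :: complex ^ 'n. herm z w) \<in> borel_measurable borel"
    by (intro borel_measurable_continuous_onI continuous_intros)
  have qm: "q \<in> borel_measurable borel" unfolding q_def by measurable
  obtain K where K: "K \<ge> 0" "\<And>w. norm (hom_part G k w) \<le> K * norm w ^ k"
    using hom_part_bound[OF G, of k] by blast
  have sm: "t *\<^sub>R w = of_real t *s w" for t and w :: "complex ^ 'n"
    unfolding vec_eq_iff by (simp add: scaleR_conv_of_real[where 'a=complex])
  have hom: "q (t *\<^sub>R w) = of_real (t ^ (2 * k)) * q w" if "t > 0" for t w
    by (simp add: q_def sm hom_part_smult[OF G] herm_smult_right power_mult_distrib mult_2 power_add)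
  have bnd: "norm (q w) \<le> (K * norm z ^ k) * norm w ^ (2 * k)" for w
  proof -
    have "norm (q w) \<le> (K * norm w ^ k) * (norm z * norm w) ^ k"
      unfolding q_def norm_mult norm_power using K norm_herm_le[of z w] by (intro mult_mono power_mono) auto
    then show ?thesis by (simp add: power_mult_distrib mult_2 mult_2_right power_add mult_ac)
  qed
  define Q where "Q = (\<integral>w. q w * indicator (cball 0 1) w \<partial>lborel)"
  have s1: "(2 * real CARD('n) + real (2 * k)) / (2 * l) = s" using l by (simp add: s_def field_simps)
  have s2: "(2 * real CARD('n) + real (2 * k)) / (2 * 1) = real (n + k)" by (simp add: n_def)
  have A: "(\<integral>w. q w * of_real (exp (- \<alpha> * norm w powr (2 * l))) \<partial>lborel) = of_real (\<alpha> powr (- s) * Gamma (s + 1)) * Q"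
    using integral_homogeneous_exp(2)[OF qm hom bnd l \<alpha>] unfolding s1 Q_def .
  have B: "(\<integral>w. q w * of_real (exp (- (norm w)\<^sup>2)) \<partial>lborel) = fact (n + k) * Q"
  proof -
    have "(\<integral>w. q w * of_real (exp (- 1 * norm w powr (2 * 1))) \<partial>lborel) = of_real (1 powr (- real (n + k)) * Gamma (real (n + k) + 1)) * Q"
      using integral_homogeneous_exp(2)[OF qm hom bnd order_refl zero_less_one] unfolding s2 Q_def .
    moreover have "Gamma (real (n + k) + 1) = fact (n + k)" using Gamma_fact[of "n + k", where 'a=real] by (simp add: add_ac)
    ultimately show ?thesis by simp
  qed
  define V where "V = measure lborel (cball (0 :: complex ^ 'n) 1)"
  have V: "V > 0" unfolding V_def by (simp add: content_cball_pos)
  have C: "(\<integral>(w :: complex ^ 'n). exp (- (norm w)\<^sup>2) \<partial>lborel) = fact n * V"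
  proof -
    have "(\<integral>w. (1 :: complex) * of_real (exp (- 1 * norm w powr (2 * 1))) \<partial>(lborel :: (complex ^ 'n) measure))
       = of_real (1 powr (- ((2 * real CARD('n) + real 0) / (2 * 1))) * Gamma ((2 * real CARD('n) + real 0) / (2 * 1) + 1)) * (\<integral>w. 1 * indicator (cball (0 :: complex ^ 'n) 1) w \<partial>lborel)"
      by (rule integral_homogeneous_exp(2)[where q = "\<lambda>_. 1" and m = 0 and K = 1]) auto
    moreover have "Gamma (real n + 1) = fact n" using Gamma_fact[of n, where 'a=real] by (simp add: add_ac)
    moreover have "(\<integral>w. indicator (cball (0 :: complex ^ 'n) 1) w \<partial>lborel) = complex_of_real V"
    proof -
      have "(\<lambda>w. indicator (cball (0 :: complex ^ 'n) 1) w) = (\<lambda>w. complex_of_real (indicator (cball 0 1) w))"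
        by (auto simp: indicator_def)
      then show ?thesis unfolding V_def by (simp only: integral_complex_of_real Bochner_Integration.integral_indicator) simp
    qed
    ultimately have "(\<integral>(w :: complex ^ 'n). complex_of_real (exp (- (norm w)\<^sup>2)) \<partial>lborel) = of_real (fact n * V)"
      by (simp add: n_def)
    then show ?thesis by (simp only: integral_complex_of_real of_real_eq_iff)
  qed
  have "fact (n + k) * Q = fact k * hom_part G k z * of_real (fact n * V)"
    using hom_part_gaussian_reproducing[OF G, of k z] unfolding C B[symmetric] q_def .
  then have Q: "Q = of_real (fact k * fact n / fact (n + k) * V) * hom_part G k z"
    by (simp add: field_simps)
  have "dV_const TYPE('n) = 1 / V"
  proof -
    have "measure lebesgue (ball (0 :: complex ^ 'n) 1) = V" unfolding V_def
      by (simp add: content_ball content_cball)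
    then show ?thesis by (simp add: dV_const_def)
  qed
  then have "dV_const TYPE('n) *\<^sub>R (\<integral>w. hom_part G k w * herm z w ^ k * of_real (exp (- \<alpha> * norm w powr (2 * l))) \<partial>lborel)
    = of_real (1 / V) * (of_real (\<alpha> powr (- s) * Gamma (s + 1)) * Q)"
    using A unfolding q_def by (simp only: scaleR_conv_of_real)
  also have "\<dots> = of_real (\<alpha> powr (- s) * Gamma (s + 1) * fact k * fact n / fact (n + k)) * hom_part G k z"
    unfolding Q using V by simp
  finally show ?thesis by (simp only: n_def)
qed

section \<open>The projection and its reproducing property\<close>

lemma card_ge_1: "CARD('n::finite) \<ge> 1"
  by (simp add: Suc_leI)

definition kernel_const :: "nat \<Rightarrow> real \<Rightarrow> real \<Rightarrow> real" where
  "kernel_const n l \<alpha> = l * \<alpha> powr (real n / l) / fact n"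

lemma kernel_const_pos: "l \<ge> 1 \<Longrightarrow> \<alpha> > 0 \<Longrightarrow> kernel_const n l \<alpha> > 0"
  by (simp add: kernel_const_def)

lemma bergman_H_eq:
  assumes "\<alpha> > 0"
  shows "bergman_H n l \<alpha> x = of_real (kernel_const n l \<alpha>) * fock_series n l (of_real (\<alpha> powr (1 / l)) * x)"
proof -
  have "of_real (fact (n - 1 + k) / fact k * \<alpha> powr (real k / l) / Gamma (real (k + n) / l)) * x ^ k
      = of_real (fock_coeff n l k) * (of_real (\<alpha> powr (1 / l)) * x) ^ k" for k
  proof -
    have "\<alpha> powr (real k / l) = (\<alpha> powr (1 / l)) ^ k"
      using assms by (simp add: powr_realpow[symmetric] powr_powr)
    then show ?thesis by (simp add: fock_coeff_def power_mult_distrib)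
  qed
  then show ?thesis by (simp only: bergman_H_def fock_series_def kernel_const_def)
qed

lemma bergman_kernel_eq:
  fixes z w :: "complex ^ 'n"
  assumes "\<alpha> > 0"
  shows "bergman_kernel l \<alpha> z w
     = of_real (kernel_const CARD('n) l \<alpha>) * fock_series CARD('n) l (of_real (\<alpha> powr (1 / l)) * herm z w)"
  by (simp only: bergman_kernel_def herm_def[symmetric] bergman_H_eq[OF assms])

lemma fock_weight_pos: "fock_weight l \<alpha> \<rho> z > 0"
proof -
  have "1 + norm z > 0" by (simp add: add_pos_nonneg)
  then have "1 + norm z \<noteq> 0" by simp
  then show ?thesis by (simp add: fock_weight_def)
qed

lemma borel_measurable_fock_weight [measurable]:
  "fock_weight l \<alpha> \<rho> \<in> borel_measurable (borel :: (complex ^ 'n) measure)"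
  unfolding fock_weight_def[abs_def] by measurable

lemma borel_measurable_fock_series [measurable]:
  "n \<ge> 1 \<Longrightarrow> l \<ge> 1 \<Longrightarrow> fock_series n l \<in> borel_measurable borel"
  by (intro borel_measurable_continuous_onI continuous_on_fock_series)

lemma borel_measurable_fock_growth_norm:
  assumes "n \<ge> 1" "l \<ge> 1" "R \<ge> 0"
  shows "(\<lambda>w :: complex ^ 'n. fock_growth n l (R * norm w)) \<in> borel_measurable borel"
  using assms by (intro borel_measurable_continuous_onI continuous_on_compose2[OF continuous_on_fock_growth] continuous_intros) auto

lemma borel_measurable_herm [measurable]:
  "(\<lambda>w :: complex ^ 'n. herm z w) \<in> borel_measurable borel"
  by (intro borel_measurable_continuous_onI continuous_intros)

text \<open>Hoelder's inequality is not needed here: \<open>x \<le> 1 + x powr q\<close> and the remaining factor is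
  both bounded and integrable.\<close>

lemma integrable_L_space_growth:
  fixes f :: "complex ^ 'n \<Rightarrow> complex"
  assumes l: "l \<ge> 1" and p: "1 \<le> p" and \<beta>: "\<beta> < 2 * \<alpha>" and f: "f \<in> L_space l p \<beta> \<rho>" and R: "R \<ge> 0"
  shows "integrable dV (\<lambda>w. cmod (f w) * fock_growth CARD('n) l (R * norm w) * exp (- \<alpha> * norm w powr (2 * l)))"
proof -
  define n where "n = CARD('n)"
  have n: "n \<ge> 1" unfolding n_def by (rule card_ge_1)
  have fm[measurable]: "f \<in> borel_measurable dV" using f by (simp add: L_space_def)
  \<comment> \<open>The hypothesis on beta says that c is positive: e^(-alpha |w|^(2l)) decays
    faster than the weight of f by this rate. One half of c absorbs the growth of the kernel, by
    completing the square, with the constant \<open>D\<close>; the other half makes \<open>h\<close>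
    integrable.\<close>
  define c where "c = \<alpha> - \<beta> / 2"
  have c: "c > 0" using \<beta> by (simp add: c_def)
  obtain A B where AB: "A > 0" "B > 0" "\<And>r. r \<ge> 0 \<Longrightarrow> fock_growth n l r \<le> A * exp (B * r powr l)"
    using fock_growth_bound[OF n l] by blast
  define D where "D = A * exp ((B * R powr l)\<^sup>2 / (2 * c))"
  have D: "D > 0" using AB by (simp add: D_def)
  define h where "h w = D * ((1 + norm w) powr (- \<rho>) * exp (- (c / 2) * norm w powr (2 * l)))" for w :: "complex ^ 'n"
  define W where "W = (fock_weight l \<beta> \<rho> :: complex ^ 'n \<Rightarrow> real)"
  have W: "W w > 0" for w unfolding W_def by (rule fock_weight_pos)
  have hn: "h w \<ge> 0" for w using D by (simp add: h_def)
  have [measurable]: "W \<in> borel_measurable borel" unfolding W_def by measurable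
  have [measurable]: "h \<in> borel_measurable borel" unfolding h_def by measurable
  have hint: "integrable dV h"
  proof -
    have "integrable lborel h" unfolding h_def using c l by (intro integrable_mult_right integrable_weight) auto
    then show ?thesis by (subst integrable_dV_iff) auto
  qed
  have le: "fock_growth n l (R * norm w) * exp (- \<alpha> * norm w powr (2 * l)) \<le> W w * h w" for w :: "complex ^ 'n"
  proof -
    define v where "v = norm w powr l"
    have v2: "norm w powr (2 * l) = v\<^sup>2" by (simp add: v_def powr_double)
    have "fock_growth n l (R * norm w) \<le> A * exp (B * (R * norm w) powr l)" using R by (intro AB) auto
    also have "(R * norm w) powr l = R powr l * v" using R by (simp add: powr_mult v_def)
    finally have "fock_growth n l (R * norm w) * exp (- \<alpha> * v\<^sup>2) \<le> A * exp (B * (R powr l * v)) * exp (- \<alpha> * v\<^sup>2)"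
      by (intro mult_right_mono) auto
    also have "\<dots> = A * exp (B * R powr l * v - \<alpha> * v\<^sup>2)" by (simp add: exp_add[symmetric] mult.assoc)
    also have "\<dots> \<le> A * exp ((B * R powr l)\<^sup>2 / (2 * c) + (- (\<beta> / 2) * v\<^sup>2 + - (c / 2) * v\<^sup>2))"
    proof -
      have "0 \<le> (B * R powr l - c * v)\<^sup>2 / (2 * c)" using c by simp
      also have "\<dots> = (B * R powr l)\<^sup>2 / (2 * c) - B * R powr l * v + c / 2 * v\<^sup>2"
        using c by (simp add: power2_diff field_simps power2_eq_square)
      finally have "B * R powr l * v - \<alpha> * v\<^sup>2 \<le> (B * R powr l)\<^sup>2 / (2 * c) + (- (\<beta> / 2) * v\<^sup>2 + - (c / 2) * v\<^sup>2)"
      proof -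
        assume h: "0 \<le> (B * R powr l)\<^sup>2 / (2 * c) - B * R powr l * v + c / 2 * v\<^sup>2"
        have "\<alpha> * v\<^sup>2 = c * v\<^sup>2 + \<beta> / 2 * v\<^sup>2" by (simp add: c_def algebra_simps)
        then show ?thesis using h by simp
      qed
      then show ?thesis using AB by simp
    qed
    also have "\<dots> = D * (exp (- (\<beta> / 2) * v\<^sup>2) * exp (- (c / 2) * v\<^sup>2))"
      by (simp only: D_def exp_add mult.assoc)
    also have "\<dots> = W w * h w"
    proof -
      have "(1 + norm w) powr \<rho> * (1 + norm w) powr (- \<rho>) = 1"
        by (simp add: powr_add[symmetric] add_pos_nonneg) (metis add_pos_nonneg less_irrefl norm_ge_zero zero_less_one)
      then have "D * (exp (- (\<beta> / 2) * v\<^sup>2) * exp (- (c / 2) * v\<^sup>2))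
        = ((1 + norm w) powr \<rho> * (1 + norm w) powr (- \<rho>)) * (D * (exp (- (\<beta> / 2) * v\<^sup>2) * exp (- (c / 2) * v\<^sup>2)))" by simp
      then show ?thesis unfolding W_def h_def fock_weight_def v2 by (simp only: mult_ac)
    qed
    finally show ?thesis by (simp only: v2)
  qed
  have bound: "norm (cmod (f w) * fock_growth n l (R * norm w) * exp (- \<alpha> * norm w powr (2 * l))) \<le> (cmod (f w) * W w) * h w" for w
  proof -
    have "norm (cmod (f w) * fock_growth n l (R * norm w) * exp (- \<alpha> * norm w powr (2 * l)))
       = cmod (f w) * (fock_growth n l (R * norm w) * exp (- \<alpha> * norm w powr (2 * l)))"
      using fock_growth_nonneg[OF n l, of "R * norm w"] R by (simp add: abs_mult)
    also have "\<dots> \<le> cmod (f w) * (W w * h w)" using le[of w] by (intro mult_left_mono) auto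
    finally show ?thesis by (simp add: mult_ac)
  qed
  have [measurable]: "(\<lambda>w :: complex ^ 'n. fock_growth n l (R * norm w)) \<in> borel_measurable borel"
    using n l R by (rule borel_measurable_fock_growth_norm)
  have meas: "(\<lambda>w. cmod (f w) * fock_growth n l (R * norm w) * exp (- \<alpha> * norm w powr (2 * l))) \<in> borel_measurable dV"
    by measurable
  have "integrable dV (\<lambda>w. cmod (f w) * fock_growth n l (R * norm w) * exp (- \<alpha> * norm w powr (2 * l)))"
  proof (cases "p = \<infinity>")
    case True
    define S where "S = fock_modular l p \<beta> \<rho> f"
    have S: "S < \<infinity>" using f by (simp add: L_space_def S_def)
    then have Se: "S = ennreal (enn2real S)" by simp
    have AE: "AE w in dV. cmod (f w) * W w \<le> enn2real S"
    proof -
      have "AE w in dV. ennreal (cmod (f w) * fock_weight l \<beta> \<rho> w) \<le> S"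
        using esssup_AE[where f = "\<lambda>w. ennreal (cmod (f w) * fock_weight l \<beta> \<rho> w)" and M = dV] True
        by (simp add: S_def fock_modular_def)
      then show ?thesis
      proof eventually_elim
        case (elim w)
        then have "ennreal (cmod (f w) * W w) \<le> ennreal (enn2real S)" using Se by (simp add: W_def)
        then show ?case by (subst (asm) ennreal_le_iff) auto
      qed
    qed
    show ?thesis
    proof (rule Bochner_Integration.integrable_bound[OF _ meas])
      show "integrable dV (\<lambda>w. enn2real S * h w)" using hint by simp
      show "AE w in dV. norm (cmod (f w) * fock_growth n l (R * norm w) * exp (- \<alpha> * norm w powr (2 * l))) \<le> norm (enn2real S * h w)"
        using AE
      proof eventually_elim
        case (elim w)
        have "(cmod (f w) * W w) * h w \<le> enn2real S * h w" using elim hn by (intro mult_right_mono)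
        then show ?case using bound[of w] hn[of w] by (simp add: abs_mult)
      qed
    qed
  next
    case False
    define q where "q = enn2real p"
    have q: "q \<ge> 1"
      using p False by (cases p) (auto simp: q_def)
    obtain C where C: "C > 0" "\<And>v. v \<ge> 0 \<Longrightarrow> (1 + v) powr (-\<rho>) * exp (- (c/2) * v powr (2 * l)) \<le> C * exp (- (c / 2 / 2) * v\<^sup>2)"
      using weight_le_gaussian[of "c/2" l "- \<rho>"] c l by auto
    have hC: "h w \<le> D * C" for w
    proof -
      have "h w \<le> D * (C * exp (- (c / 2 / 2) * (norm w)\<^sup>2))" unfolding h_def using D by (intro mult_left_mono C) auto
      also have "\<dots> \<le> D * (C * 1)" using D C(1) c by (intro mult_left_mono) auto
      finally show ?thesis by simp
    qed
    have pint: "integrable dV (\<lambda>w. (cmod (f w) * W w) powr q)"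
    proof (rule integrableI_bounded)
      show "(\<integral>\<^sup>+w. ennreal (norm ((cmod (f w) * W w) powr q)) \<partial>dV) < \<infinity>"
        using f False by (simp add: L_space_def fock_modular_def W_def q_def)
    qed measurable
    show ?thesis
    proof (rule Bochner_Integration.integrable_bound[OF _ meas])
      show "integrable dV (\<lambda>w. h w + D * C * (cmod (f w) * W w) powr q)" using hint pint by simp
      show "AE w in dV. norm (cmod (f w) * fock_growth n l (R * norm w) * exp (- \<alpha> * norm w powr (2 * l))) \<le> norm (h w + D * C * (cmod (f w) * W w) powr q)"
      proof (rule AE_I2)
        fix w
        define x where "x = cmod (f w) * W w"
        have x: "x \<ge> 0" using W[of w] by (simp add: x_def)
        have "x \<le> 1 + x powr q"
        proof (cases "x \<le> 1")
          case False
          then have "x powr 1 \<le> x powr q" using q by (intro powr_mono) auto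
          then show ?thesis using False by simp
        qed (simp add: add_increasing2)
        then have "x * h w \<le> (1 + x powr q) * h w" using hn by (intro mult_right_mono)
        also have "\<dots> \<le> h w + D * C * x powr q"
          using mult_right_mono[OF hC[of w], of "x powr q"] by (simp add: algebra_simps)
        finally have "x * h w \<le> h w + D * C * x powr q" .
        then show "norm (cmod (f w) * fock_growth n l (R * norm w) * exp (- \<alpha> * norm w powr (2 * l))) \<le> norm (h w + D * C * (cmod (f w) * W w) powr q)"
          using bound[of w] by (simp add: x_def)
      qed
    qed
  qed
  then show ?thesis by (simp add: n_def)
qed

lemma integrable_bergman_integrand:
  fixes f :: "complex ^ 'n \<Rightarrow> complex"
  assumes l: "l \<ge> 1" and p: "1 \<le> p" and \<alpha>: "\<alpha> > 0" and \<beta>: "\<beta> < 2 * \<alpha>" and f: "f \<in> L_space l p \<beta> \<rho>"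
  shows "integrable dV (bergman_integrand l \<alpha> f z)"
proof -
  define n where "n = CARD('n)"
  have n: "n \<ge> 1" unfolding n_def by (rule card_ge_1)
  define a where "a = \<alpha> powr (1 / l)"
  have a: "a \<ge> 0" by (simp add: a_def)
  have [measurable]: "f \<in> borel_measurable dV" using f by (simp add: L_space_def)
  have [measurable]: "fock_series n l \<in> borel_measurable borel" using n l by measurable
  have K: "bergman_kernel l \<alpha> z w = of_real (kernel_const n l \<alpha>) * fock_series n l (of_real a * herm z w)" for w :: "complex ^ 'n"
    by (simp add: bergman_kernel_eq[OF \<alpha>] n_def a_def)
  show ?thesis
  proof (rule Bochner_Integration.integrable_bound)
    show "integrable dV (\<lambda>w. kernel_const n l \<alpha> * (cmod (f w) * fock_growth n l ((a * norm z) * norm w) * exp (- \<alpha> * norm w powr (2 * l))))"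
      using integrable_L_space_growth[OF l p \<beta> f, of "a * norm z"] a unfolding n_def by (intro integrable_mult_right) simp
    show "bergman_integrand l \<alpha> f z \<in> borel_measurable dV"
      unfolding bergman_integrand_def[abs_def] K by measurable
    show "AE w in dV. norm (bergman_integrand l \<alpha> f z w) \<le> norm (kernel_const n l \<alpha> * (cmod (f w) * fock_growth n l ((a * norm z) * norm w) * exp (- \<alpha> * norm w powr (2 * l))))"
    proof (rule AE_I2)
      fix w
      have "cmod (fock_series n l (of_real a * herm z w)) \<le> fock_growth n l (norm (of_real a * herm z w))"
        by (rule norm_fock_series_le[OF n l])
      also have "\<dots> \<le> fock_growth n l ((a * norm z) * norm w)"
        using norm_herm_le[of z w] a by (intro fock_growth_mono[OF n l]) (auto simp: norm_mult mult.assoc intro: mult_left_mono)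
      finally have 1: "cmod (fock_series n l (of_real a * herm z w)) \<le> fock_growth n l ((a * norm z) * norm w)" .
      have k: "kernel_const n l \<alpha> > 0" by (rule kernel_const_pos[OF l \<alpha>])
      have g: "fock_growth n l ((a * norm z) * norm w) \<ge> 0" using a by (intro fock_growth_nonneg[OF n l]) auto
      have "norm (bergman_integrand l \<alpha> f z w)
         = kernel_const n l \<alpha> * (cmod (f w) * cmod (fock_series n l (of_real a * herm z w)) * exp (- \<alpha> * norm w powr (2 * l)))"
        using k by (simp add: bergman_integrand_def K norm_mult)
      also have "\<dots> \<le> kernel_const n l \<alpha> * (cmod (f w) * fock_growth n l ((a * norm z) * norm w) * exp (- \<alpha> * norm w powr (2 * l)))"
        using 1 k by (intro mult_left_mono mult_right_mono) auto
      also have "\<dots> = norm \<dots>" using k g by (simp add: abs_mult)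
      finally show "norm (bergman_integrand l \<alpha> f z w) \<le> norm (kernel_const n l \<alpha> * (cmod (f w) * fock_growth n l ((a * norm z) * norm w) * exp (- \<alpha> * norm w powr (2 * l))))" .
    qed
  qed
qed

lemma bergman_projection_linear:
  fixes f g :: "complex ^ 'n \<Rightarrow> complex"
  assumes l: "l \<ge> 1" and p: "1 \<le> p" and \<alpha>: "\<alpha> > 0" and \<beta>: "\<beta> < 2 * \<alpha>"
    and f: "f \<in> L_space l p \<beta> \<rho>" and g: "g \<in> L_space l p \<beta> \<rho>"
  shows "bergman_projection l \<alpha> (\<lambda>w. a * f w + b * g w) z
     = a * bergman_projection l \<alpha> f z + b * bergman_projection l \<alpha> g z"
proof -
  have "bergman_integrand l \<alpha> (\<lambda>w. a * f w + b * g w) z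
     = (\<lambda>w. a * bergman_integrand l \<alpha> f z w + b * bergman_integrand l \<alpha> g z w)"
    by (simp add: bergman_integrand_def fun_eq_iff algebra_simps)
  then show ?thesis
    using integrable_bergman_integrand[OF l p \<alpha> \<beta> f, of z] integrable_bergman_integrand[OF l p \<alpha> \<beta> g, of z]
    by (simp add: bergman_projection_def)
qed

text \<open>Termwise integration, dominated by \<open>fock_growth\<close>, separates the degrees. In
  the k-th term a rotation of w multiplies the kernel part by \<open>cnj (circ t) ^ k\<close>, so
  averaging replaces G by \<open>hom_part G k\<close>; this is reproduced with the constant 1, and
  the homogeneous parts sum to G.\<close>

theorem bergman_projection_reproducing:
  fixes G :: "complex ^ 'n \<Rightarrow> complex"
  assumes l: "l \<ge> 1" and p: "1 \<le> p" and \<alpha>: "\<alpha> > 0" and \<beta>: "\<beta> < 2 * \<alpha>"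
    and L: "G \<in> L_space l p \<beta> \<rho>" and G: "entire G"
  shows "bergman_projection l \<alpha> G z = G z"
proof -
  define n where "n = CARD('n)"
  have n: "n \<ge> 1" unfolding n_def by (rule card_ge_1)
  define a where "a = \<alpha> powr (1 / l)"
  have a: "a \<ge> 0" by (simp add: a_def)
  define \<kappa> where "\<kappa> = kernel_const n l \<alpha>"
  have \<kappa>: "\<kappa> > 0" unfolding \<kappa>_def by (rule kernel_const_pos[OF l \<alpha>])
  have cpos: "fock_coeff n l k > 0" for k by (rule fock_coeff_pos[OF n l])
  define e where "e w = exp (- \<alpha> * norm w powr (2 * l))" for w :: "complex ^ 'n"
  define x where "x w = of_real a * herm z w" for w :: "complex ^ 'n"
  define u where "u k w = of_real \<kappa> * (G w * (of_real (fock_coeff n l k) * x w ^ k)) * of_real (e w)" for k w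
  have [measurable]: "G \<in> borel_measurable borel"
    by (intro borel_measurable_continuous_onI entire_continuous[OF G])
  have [measurable]: "e \<in> borel_measurable borel" unfolding e_def by measurable
  have [measurable]: "x \<in> borel_measurable borel" unfolding x_def by measurable
  have [measurable]: "u k \<in> borel_measurable borel" for k unfolding u_def by measurable
  have xle: "norm (x w) \<le> (a * norm z) * norm w" for w
    using norm_herm_le[of z w] a by (auto simp: x_def norm_mult mult.assoc intro: mult_left_mono)
  define B where "B w = \<kappa> * (cmod (G w) * fock_growth n l ((a * norm z) * norm w) * e w)" for w
  have Bint: "integrable dV B"
    using integrable_L_space_growth[OF l p \<beta> L, of "a * norm z"] a unfolding n_def B_def e_def by (intro integrable_mult_right) simp
  have nu: "norm (u k w) = \<kappa> * (cmod (G w) * (fock_coeff n l k * norm (x w) ^ k) * e w)" for k w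
    using \<kappa> cpos[of k] by (simp add: u_def norm_mult norm_power e_def mult_ac)
  have sm: "summable (\<lambda>k. fock_coeff n l k * norm (x w) ^ k)" for w
    by (rule summable_fock_growth[OF n l]) simp
  have sums_norm: "(\<lambda>k. norm (u k w)) sums (\<kappa> * (cmod (G w) * fock_growth n l (norm (x w)) * e w))" for w
    unfolding nu fock_growth_def by (intro sums_mult sums_mult2 summable_sums sm)
  have part: "(\<Sum>k<m. norm (u k w)) \<le> B w" for m w
  proof -
    have "(\<Sum>k<m. norm (u k w)) \<le> \<kappa> * (cmod (G w) * fock_growth n l (norm (x w)) * e w)"
      using sum_le_suminf[OF sums_summable[OF sums_norm[of w]], of "{..<m}"] sums_unique[OF sums_norm[of w]] by simp
    also have "\<dots> \<le> B w" unfolding B_def using \<kappa> xle[of w]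
      by (intro mult_left_mono mult_right_mono fock_growth_mono[OF n l]) (auto simp: e_def)
    finally show ?thesis .
  qed
  have uint: "integrable dV (u k)" for k
  proof (rule Bochner_Integration.integrable_bound[OF Bint])
    show "AE w in dV. norm (u k w) \<le> norm (B w)"
    proof (rule AE_I2)
      fix w
      have "norm (u k w) \<le> (\<Sum>k<Suc k. norm (u k w))" by (simp add: sum_nonneg)
      also have "\<dots> \<le> B w" by (rule part)
      finally show "norm (u k w) \<le> norm (B w)" by simp
    qed
  qed measurable
  have usum: "summable (\<lambda>k. \<integral>w. norm (u k w) \<partial>dV)"
  proof (rule bounded_imp_summable)
    fix m
    have "(\<Sum>k\<le>m. \<integral>w. norm (u k w) \<partial>dV) = (\<integral>w. (\<Sum>k\<le>m. norm (u k w)) \<partial>dV)"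
      using uint by (subst Bochner_Integration.integral_sum) auto
    also have "\<dots> \<le> (\<integral>w. B w \<partial>dV)"
      using uint Bint part[where m = "Suc m"] by (intro integral_mono) (auto simp: lessThan_Suc_atMost)
    finally show "(\<Sum>k\<le>m. \<integral>w. norm (u k w) \<partial>dV) \<le> (\<integral>w. B w \<partial>dV)" .
  qed simp
  have "(\<lambda>k. \<integral>w. u k w \<partial>dV) sums (\<integral>w. (\<Sum>k. u k w) \<partial>dV)"
    by (rule sums_integral[OF uint _ usum]) (auto intro: sums_summable[OF sums_norm])
  moreover have "(\<Sum>k. u k w) = bergman_integrand l \<alpha> G z w" for w
  proof -
    have "(\<lambda>k. u k w) sums (of_real \<kappa> * (G w * fock_series n l (x w)) * of_real (e w))"
      unfolding u_def fock_series_def by (intro sums_mult sums_mult2 summable_sums summable_fock_series[OF n l])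
    then show ?thesis
      by (simp add: sums_iff bergman_integrand_def bergman_kernel_eq[OF \<alpha>] n_def \<kappa>_def x_def a_def e_def mult_ac)
  qed
  moreover have "(\<integral>w. u k w \<partial>dV) = hom_part G k z" for k
  proof -
    have ul: "integrable lborel (u k)" using uint[of k] by (subst (asm) integrable_dV_iff) auto
    define C where "C = \<kappa> * fock_coeff n l k * a ^ k"
    define s where "s = real (k + n) / l"
    have s: "s > 0" using n l by (simp add: s_def)
    have "(\<integral>w. u k w \<partial>lborel) = (\<integral>w. (\<integral>t. u k (circ t *s w) \<partial>unit_interval) \<partial>lborel)"
      by (rule integral_rotation_average[OF ul])
    also have "\<dots> = (\<integral>w. of_real C * (hom_part G k w * herm z w ^ k * of_real (e w)) \<partial>lborel)"
    proof (rule Bochner_Integration.integral_cong[OF refl])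
      fix w
      have "(\<integral>t. u k (circ t *s w) \<partial>unit_interval)
         = (\<integral>t. (of_real C * herm z w ^ k * of_real (e w)) * (G (circ t *s w) * cnj (circ t) ^ k) \<partial>unit_interval)"
        by (intro Bochner_Integration.integral_cong refl)
           (simp add: u_def C_def x_def e_def herm_smult_right norm_vector_smult power_mult_distrib mult_ac)
      also have "\<dots> = (of_real C * herm z w ^ k * of_real (e w)) * hom_part G k w"
        unfolding hom_part_def by (rule integral_mult_right_zero)
      finally show "(\<integral>t. u k (circ t *s w) \<partial>unit_interval) = of_real C * (hom_part G k w * herm z w ^ k * of_real (e w))"
        by (simp add: mult_ac)
    qed
    also have "\<dots> = of_real C * (\<integral>w. hom_part G k w * herm z w ^ k * of_real (e w) \<partial>lborel)"
      by (rule integral_mult_right_zero)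
    finally have "(\<integral>w. u k w \<partial>dV) = of_real C * (dV_const TYPE('n) *\<^sub>R (\<integral>w. hom_part G k w * herm z w ^ k * of_real (e w) \<partial>lborel))"
      by (simp add: integral_dV)
    also have "\<dots> = of_real (C * (\<alpha> powr (- s) * Gamma (s + 1) * fact k * fact n / fact (n + k))) * hom_part G k z"
      unfolding e_def s_def n_def by (subst hom_part_reproducing[OF G l \<alpha>]) simp
    \<comment> \<open>\<open>Gamma (s + 1) = s * Gamma s\<close> cancels the Gamma value in the
      coefficient, and l s = n + k cancels the last factor of (n + k)!. The algebra is done with
      real variables in place of powers and factorials.\<close>
    also have "C * (\<alpha> powr (- s) * Gamma (s + 1) * fact k * fact n / fact (n + k)) = 1"
    proof -
      have "Gamma (s + 1) = s * Gamma s"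
        using s by (simp add: Gamma_real_plus1)
      moreover have "Gamma s > 0" using s by simp
      moreover have "a ^ k = \<alpha> powr (real k / l)" using \<alpha> by (simp add: a_def powr_realpow[symmetric] powr_powr)
      moreover have "\<alpha> powr (real n / l) * \<alpha> powr (real k / l) * \<alpha> powr (- s) = 1"
        using \<alpha> by (simp add: powr_add[symmetric] s_def add_divide_distrib[symmetric] add.commute)
      moreover have "(fact (n + k) :: real) = real (n + k) * fact (n - 1 + k)"
        using n by (cases n) auto
      moreover have "l * s = real (n + k)" using l by (simp add: s_def)
      moreover have "(l * A / fn * (N / fk / g) * Bk) * (S * (s * g) * fk * fn / (M * N)) = (A * Bk * S) * ((l * s) / M)"
        if "g \<noteq> 0" "fn \<noteq> 0" "fk \<noteq> 0" "N \<noteq> 0" "M \<noteq> 0" for A fn N fk g Bk S M :: real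
        using that by (simp add: field_simps)
      from this[of "Gamma s" "fact n" "fact k" "fact (n - 1 + k)" "real (n + k)" "\<alpha> powr (real n / l)" "\<alpha> powr (real k / l)" "\<alpha> powr (- s)"]
      have "(l * \<alpha> powr (real n / l) / fact n * (fact (n - 1 + k) / fact k / Gamma s) * \<alpha> powr (real k / l))
          * (\<alpha> powr (- s) * (s * Gamma s) * fact k * fact n / (real (n + k) * fact (n - 1 + k)))
        = (\<alpha> powr (real n / l) * \<alpha> powr (real k / l) * \<alpha> powr (- s)) * ((l * s) / real (n + k))"
        using n \<open>Gamma s > 0\<close> by simp
      moreover have "fock_coeff n l k = fact (n - 1 + k) / fact k / Gamma s" by (simp add: fock_coeff_def s_def)
      moreover have "real (n + k) \<noteq> 0" using n by simp
      ultimately show ?thesis by (simp only: C_def \<kappa>_def kernel_const_def) simp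
    qed
    finally show ?thesis by simp
  qed
  ultimately have "(\<lambda>k. hom_part G k z) sums bergman_projection l \<alpha> G z"
    by (simp add: bergman_projection_def)
  then show ?thesis using hom_part_sums[OF G, of z] by (rule sums_unique2)
qed

section \<open>Boundedness and surjectivity\<close>

text \<open>Every binomial term of degree at least 2 in h carries a factor
  \<open>\<epsilon>\<^sup>2\<close>, and what is left is a part of (A + B)^k. The bound has the same
  shape for all k and can be summed against the coefficients.\<close>

lemma power_remainder_le:
  fixes x h :: complex
  assumes x: "norm x \<le> A" and h: "norm h \<le> \<epsilon> * B" and B: "B \<ge> 0" and \<epsilon>: "0 \<le> \<epsilon>" "\<epsilon> \<le> 1"
  shows "norm ((x + h) ^ k - x ^ k - of_nat k * x ^ (k - 1) * h) \<le> \<epsilon>\<^sup>2 * (A + B) ^ k"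
proof (cases k)
  case 0
  then show ?thesis by simp
next
  case (Suc m)
  have A: "A \<ge> 0" using x norm_ge_zero order_trans by blast
  define t where "t j = of_nat (k choose j) * h ^ j * x ^ (k - j)" for j
  have "(x + h) ^ k = (\<Sum>j\<le>k. t j)" unfolding t_def by (subst add.commute) (rule binomial_ring)
  also have "{..k} = insert 0 (insert 1 {2..k})" using Suc by auto
  also have "sum t \<dots> = t 0 + (t 1 + (\<Sum>j\<in>{2..k}. t j))" by simp
  finally have "(x + h) ^ k - x ^ k - of_nat k * x ^ (k - 1) * h = (\<Sum>j\<in>{2..k}. t j)"
    by (simp add: t_def mult_ac)
  also have "norm \<dots> \<le> (\<Sum>j\<in>{2..k}. \<epsilon>\<^sup>2 * (of_nat (k choose j) * B ^ j * A ^ (k - j)))"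
  proof (rule sum_norm_le)
    fix j assume j: "j \<in> {2..k}"
    have "norm (t j) = of_nat (k choose j) * norm h ^ j * norm x ^ (k - j)"
      by (simp add: t_def norm_mult norm_power)
    also have "\<dots> \<le> of_nat (k choose j) * (\<epsilon> * B) ^ j * A ^ (k - j)"
      using x h A B \<epsilon> by (intro mult_mono power_mono mult_left_mono) auto
    also have "\<dots> = \<epsilon> ^ j * (of_nat (k choose j) * B ^ j * A ^ (k - j))" by (simp add: power_mult_distrib mult_ac)
    also have "\<dots> \<le> \<epsilon>\<^sup>2 * (of_nat (k choose j) * B ^ j * A ^ (k - j))"
      using j \<epsilon> A B by (intro mult_right_mono power_decreasing) auto
    finally show "norm (t j) \<le> \<epsilon>\<^sup>2 * (of_nat (k choose j) * B ^ j * A ^ (k - j))" .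
  qed
  also have "\<dots> \<le> (\<Sum>j\<le>k. \<epsilon>\<^sup>2 * (of_nat (k choose j) * B ^ j * A ^ (k - j)))"
    using A B by (intro sum_mono2) auto
  also have "\<dots> = \<epsilon>\<^sup>2 * (B + A) ^ k" unfolding binomial_ring[of B A k] by (simp add: sum_distrib_left)
  finally show ?thesis by (simp add: add.commute)
qed

text \<open>The left-hand side is, in modulus, the term linear in |h| of the binomial expansion on
  the right.\<close>

lemma power_derivative_le:
  fixes x h :: complex
  shows "norm (of_nat k * x ^ (k - 1) * h) \<le> (norm x + norm h) ^ k"
proof (cases k)
  case (Suc m)
  have "norm (of_nat k * x ^ (k - 1) * h) = of_nat (k choose 1) * norm h ^ 1 * norm x ^ (k - 1)"
    by (simp add: norm_mult norm_power)
  also have "\<dots> \<le> (\<Sum>j\<le>k. of_nat (k choose j) * norm h ^ j * norm x ^ (k - j))"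
    using Suc by (intro member_le_sum) auto
  also have "\<dots> = (norm x + norm h) ^ k" by (subst add.commute) (rule binomial_ring[symmetric])
  finally show ?thesis .
qed simp

definition fock_deriv :: "nat \<Rightarrow> real \<Rightarrow> complex \<Rightarrow> complex" where
  "fock_deriv n l x = (\<Sum>k. of_real (fock_coeff n l k) * (of_nat k * x ^ (k - 1)))"

context
  fixes n :: nat and l :: real
  assumes n: "n \<ge> 1" and l: "l \<ge> 1"
begin

lemma fock_deriv_sums:
  "(\<lambda>k. of_real (fock_coeff n l k) * (of_nat k * x ^ (k - 1) * h)) sums (fock_deriv n l x * h)"
proof -
  have "summable (\<lambda>k. of_real (fock_coeff n l k) * (of_nat k * x ^ (k - 1)))"
  proof (rule summable_comparison_test')
    show "summable (\<lambda>k. fock_coeff n l k * (norm x + norm (1::complex)) ^ k)"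
      by (rule summable_fock_growth[OF n l]) simp
    fix k
    show "norm (of_real (fock_coeff n l k) * (of_nat k * x ^ (k - 1))) \<le> fock_coeff n l k * (norm x + norm (1::complex)) ^ k"
      using mult_left_mono[OF power_derivative_le[of k x 1], of "fock_coeff n l k"] fock_coeff_pos[OF n l, of k]
      by (simp add: norm_mult)
  qed
  from sums_mult2[OF summable_sums[OF this], of h] show ?thesis by (simp add: fock_deriv_def mult.assoc)
qed

lemma norm_fock_deriv_le: "norm (fock_deriv n l x * h) \<le> fock_growth n l (norm x + norm h)"
proof -
  have "norm (\<Sum>k. of_real (fock_coeff n l k) * (of_nat k * x ^ (k - 1) * h)) \<le> fock_growth n l (norm x + norm h)"
    unfolding fock_growth_def
  proof (rule norm_suminf_le)
    fix k
    show "norm (of_real (fock_coeff n l k) * (of_nat k * x ^ (k - 1) * h)) \<le> fock_coeff n l k * (norm x + norm h) ^ k"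
      using mult_left_mono[OF power_derivative_le[of k x h], of "fock_coeff n l k"] fock_coeff_pos[OF n l, of k]
      by (simp add: norm_mult)
  qed (rule summable_fock_growth[OF n l], simp)
  then show ?thesis using sums_unique[OF fock_deriv_sums[of x h]] by simp
qed

lemma fock_series_remainder:
  assumes x: "norm x \<le> A" and h: "norm h \<le> \<epsilon> * B" and B: "B \<ge> 0" and \<epsilon>: "0 \<le> \<epsilon>" "\<epsilon> \<le> 1"
  shows "norm (fock_series n l (x + h) - fock_series n l x - fock_deriv n l x * h) \<le> \<epsilon>\<^sup>2 * fock_growth n l (A + B)"
proof -
  have AB: "A + B \<ge> 0" using x B norm_ge_zero[of x] by linarith
  let ?t = "\<lambda>k. of_real (fock_coeff n l k) * ((x + h) ^ k - x ^ k - of_nat k * x ^ (k - 1) * h)"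
  have "(\<lambda>k. of_real (fock_coeff n l k) * (x + h) ^ k - of_real (fock_coeff n l k) * x ^ k - of_real (fock_coeff n l k) * (of_nat k * x ^ (k - 1) * h))
    sums (fock_series n l (x + h) - fock_series n l x - fock_deriv n l x * h)"
    unfolding fock_series_def by (intro sums_diff summable_sums summable_fock_series[OF n l] fock_deriv_sums)
  then have "?t sums (fock_series n l (x + h) - fock_series n l x - fock_deriv n l x * h)"
    by (simp add: right_diff_distrib)
  moreover have "norm (suminf ?t) \<le> (\<Sum>k. \<epsilon>\<^sup>2 * (fock_coeff n l k * (A + B) ^ k))"
  proof (rule norm_suminf_le)
    fix k
    show "norm (?t k) \<le> \<epsilon>\<^sup>2 * (fock_coeff n l k * (A + B) ^ k)"
      using mult_left_mono[OF power_remainder_le[OF x h B \<epsilon>, of k], of "fock_coeff n l k"] fock_coeff_pos[OF n l, of k]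
      by (simp add: norm_mult mult_ac)
  qed (intro summable_mult summable_fock_growth[OF n l] AB)
  moreover have "(\<Sum>k. \<epsilon>\<^sup>2 * (fock_coeff n l k * (A + B) ^ k)) = \<epsilon>\<^sup>2 * fock_growth n l (A + B)"
    unfolding fock_growth_def by (intro suminf_mult summable_fock_growth[OF n l] AB)
  ultimately show ?thesis by (simp add: sums_iff)
qed

lemma borel_measurable_fock_deriv: "fock_deriv n l \<in> borel_measurable borel"
  unfolding fock_deriv_def[abs_def] by (intro borel_measurable_suminf) measurable

end

text \<open>The kernel's remainder of second order in the increment v is at most |v|^2 times a
  function of w that is integrable against f. The derivative is complex linear because
  \<open>herm v w\<close> is complex linear in v.\<close>

lemma entire_bergman_projection:
  fixes f :: "complex ^ 'n \<Rightarrow> complex"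
  assumes l: "l \<ge> 1" and p: "1 \<le> p" and \<alpha>: "\<alpha> > 0" and \<beta>: "\<beta> < 2 * \<alpha>" and f: "f \<in> L_space l p \<beta> \<rho>"
  shows "entire (bergman_projection l \<alpha> f)"
  unfolding entire_def
proof (intro allI)
  fix z :: "complex ^ 'n"
  define n where "n = CARD('n)"
  have n: "n \<ge> 1" unfolding n_def by (rule card_ge_1)
  define a where "a = \<alpha> powr (1 / l)"
  have a: "a > 0" using \<alpha> by (simp add: a_def)
  define \<kappa> where "\<kappa> = kernel_const n l \<alpha>"
  have \<kappa>: "\<kappa> > 0" unfolding \<kappa>_def by (rule kernel_const_pos[OF l \<alpha>])
  define \<phi> where "\<phi> w = of_real \<kappa> * (f w * of_real (exp (- \<alpha> * norm w powr (2 * l))))" for w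
  have [measurable]: "f \<in> borel_measurable dV" using f by (simp add: L_space_def)
  have [measurable]: "\<phi> \<in> borel_measurable dV" unfolding \<phi>_def by measurable
  have [measurable]: "fock_deriv n l \<in> borel_measurable borel" by (rule borel_measurable_fock_deriv[OF n l])
  have n\<phi>: "norm (\<phi> w) = \<kappa> * (cmod (f w) * exp (- \<alpha> * norm w powr (2 * l)))" for w
    using \<kappa> by (simp add: \<phi>_def norm_mult)
  have gint: "integrable dV (\<lambda>w. norm (\<phi> w) * fock_growth n l (R * norm w))" if "R \<ge> 0" for R
    using integrable_mult_right[OF integrable_L_space_growth[OF l p \<beta> f that], of \<kappa>]
    by (simp add: n\<phi> n_def mult_ac)
  have I: "bergman_integrand l \<alpha> f y w = \<phi> w * fock_series n l (of_real a * herm y w)" for y w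
    by (simp add: bergman_integrand_def bergman_kernel_eq[OF \<alpha>] \<phi>_def \<kappa>_def n_def a_def mult_ac)
  have Iint: "integrable dV (\<lambda>w. \<phi> w * fock_series n l (of_real a * herm y w))" for y
    using integrable_bergman_integrand[OF l p \<alpha> \<beta> f, of y] by (simp add: I[abs_def])
  define d where "d v w = \<phi> w * (fock_deriv n l (of_real a * herm z w) * (of_real a * herm v w))" for v w
  have nh: "norm (of_real a * herm y w) \<le> (a * norm y) * norm w" for y w
    using norm_herm_le[of y w] a by (auto simp: norm_mult mult.assoc intro: mult_left_mono)
  have dint: "integrable dV (d v)" for v
  proof (rule Bochner_Integration.integrable_bound[OF gint[of "a * norm z + a * norm v"]])
    show "a * norm z + a * norm v \<ge> 0" using a by simp
    show "d v \<in> borel_measurable dV" unfolding d_def by measurable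
    show "AE w in dV. norm (d v w) \<le> norm (norm (\<phi> w) * fock_growth n l ((a * norm z + a * norm v) * norm w))"
    proof (rule AE_I2)
      fix w
      have "norm (fock_deriv n l (of_real a * herm z w) * (of_real a * herm v w))
         \<le> fock_growth n l (norm (of_real a * herm z w) + norm (of_real a * herm v w))"
        by (rule norm_fock_deriv_le[OF n l])
      also have "\<dots> \<le> fock_growth n l ((a * norm z + a * norm v) * norm w)"
        using nh[of z w] nh[of v w] unfolding distrib_right by (intro fock_growth_mono[OF n l] add_mono) auto
      finally have "norm (d v w) \<le> norm (\<phi> w) * fock_growth n l ((a * norm z + a * norm v) * norm w)"
        unfolding d_def norm_mult[of "\<phi> w"] by (intro mult_left_mono) auto
      then show "norm (d v w) \<le> norm (norm (\<phi> w) * fock_growth n l ((a * norm z + a * norm v) * norm w))"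
        unfolding real_norm_def by (rule order_trans[OF _ abs_ge_self])
    qed
  qed
  define D where "D v = (\<integral>w. d v w \<partial>dV)" for v
  have Dadd: "D (v + v') = D v + D v'" for v v'
  proof -
    have "d (v + v') = (\<lambda>w. d v w + d v' w)" by (simp add: d_def fun_eq_iff herm_add_left algebra_simps)
    then show ?thesis using dint by (simp add: D_def)
  qed
  have Dsm: "D (c *s v) = c * D v" for c v
  proof -
    have "d (c *s v) = (\<lambda>w. c * d v w)" by (simp add: d_def fun_eq_iff herm_smult_left mult_ac)
    then show ?thesis using dint by (simp add: D_def)
  qed
  have Dlin: "linear D"
  proof (rule linearI)
    fix r :: real and v :: "complex ^ 'n"
    have "r *\<^sub>R v = of_real r *s v" unfolding vec_eq_iff by (simp add: scaleR_conv_of_real[where 'a=complex])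
    then show "D (r *\<^sub>R v) = r *\<^sub>R D v" by (simp add: Dsm scaleR_conv_of_real)
  qed (rule Dadd)
  \<comment> \<open>The remainder estimate is applied with epsilon = |v| and B = a |w|, so that the
    radius \<open>R * norm w\<close> does not depend on v.\<close>
  define R where "R = a * norm z + a"
  have R: "R \<ge> 0" using a by (simp add: R_def)
  define M where "M = (\<integral>w. norm (\<phi> w) * fock_growth n l (R * norm w) \<partial>dV)"
  have rem: "norm ((bergman_projection l \<alpha> f y - bergman_projection l \<alpha> f z) - D (y - z)) / norm (y - z) \<le> norm (y - z) * M"
    if "y \<noteq> z" "dist y z < 1" for y
  proof -
    define v where "v = y - z"
    have v: "v \<noteq> 0" "norm v \<le> 1" using that by (auto simp: v_def dist_norm)
    have y: "y = z + v" by (simp add: v_def)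
    have eq: "(bergman_projection l \<alpha> f y - bergman_projection l \<alpha> f z) - D v
       = (\<integral>w. \<phi> w * fock_series n l (of_real a * herm y w) - \<phi> w * fock_series n l (of_real a * herm z w) - d v w \<partial>dV)"
      unfolding bergman_projection_def I D_def by (simp add: Iint dint)
    have "norm ((bergman_projection l \<alpha> f y - bergman_projection l \<alpha> f z) - D v)
      \<le> (\<integral>w. (norm v)\<^sup>2 * (norm (\<phi> w) * fock_growth n l (R * norm w)) \<partial>dV)"
      unfolding eq
    proof (rule Bochner_Integration.integral_norm_bound_integral)
      show "integrable dV (\<lambda>w. \<phi> w * fock_series n l (of_real a * herm y w) - \<phi> w * fock_series n l (of_real a * herm z w) - d v w)"
        by (intro Bochner_Integration.integrable_diff Iint dint)
      show "integrable dV (\<lambda>w. (norm v)\<^sup>2 * (norm (\<phi> w) * fock_growth n l (R * norm w)))"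
        by (intro integrable_mult_right gint R)
      fix w
      have "norm (fock_series n l (of_real a * herm z w + of_real a * herm v w) - fock_series n l (of_real a * herm z w)
          - fock_deriv n l (of_real a * herm z w) * (of_real a * herm v w))
        \<le> (norm v)\<^sup>2 * fock_growth n l ((a * norm z) * norm w + a * norm w)"
        using nh[of v w] a v(2) by (intro fock_series_remainder[OF n l nh]) (auto simp: mult_ac)
      then have "norm (\<phi> w) * norm (fock_series n l (of_real a * herm z w + of_real a * herm v w) - fock_series n l (of_real a * herm z w)
          - fock_deriv n l (of_real a * herm z w) * (of_real a * herm v w))
        \<le> norm (\<phi> w) * ((norm v)\<^sup>2 * fock_growth n l ((a * norm z) * norm w + a * norm w))"
        by (intro mult_left_mono) auto
      then show "norm (\<phi> w * fock_series n l (of_real a * herm y w) - \<phi> w * fock_series n l (of_real a * herm z w) - d v w)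
         \<le> (norm v)\<^sup>2 * (norm (\<phi> w) * fock_growth n l (R * norm w))"
        unfolding norm_mult[symmetric] d_def y herm_add_left R_def by (simp add: algebra_simps)
    qed
    also have "\<dots> = (norm v)\<^sup>2 * M" unfolding M_def by (rule integral_mult_right_zero)
    finally show ?thesis using v(1) unfolding v_def[symmetric] by (simp add: field_simps power2_eq_square)
  qed
  have "(bergman_projection l \<alpha> f has_derivative D) (at z)"
  proof (rule has_derivativeI_sandwich[of 1])
    show "bounded_linear D" using Dlin by (simp add: linear_conv_bounded_linear)
    show "((\<lambda>y. norm (y - z) * M) \<longlongrightarrow> 0) (at z)" by (auto intro!: tendsto_eq_intros)
  qed (use rem in auto)
  then show "\<exists>D. (bergman_projection l \<alpha> f has_derivative D) (at z) \<and> (\<forall>c v. D (c *s v) = c * D v)"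
    using Dsm by blast
qed

section \<open>Jensen's inequality and the Schur test\<close>

text \<open>The graph of \<open>powr q\<close> lies above its tangent at y. Multiplied out, this is
  Young's inequality for g and y^(q - 1).\<close>

lemma powr_tangent_le:
  fixes q g y :: real
  assumes q: "q \<ge> 1" and g: "g \<ge> 0" and y: "y > 0"
  shows "q * y powr (q - 1) * g \<le> g powr q + (q - 1) * y powr q"
proof (cases "q = 1 \<or> g = 0")
  case True
  then show ?thesis using assms by auto
next
  case False
  define r where "r = q / (q - 1)"
  have q1: "q > 1" and g0: "g > 0" using False q g by auto
  have r: "r > 1" "1 / q + 1 / r = 1" using q1 by (auto simp: r_def field_simps)
  have "g * y powr (q - 1) \<le> g powr q / q + (y powr (q - 1)) powr r / r"
    using q1 r g by (intro Youngs_inequality) auto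
  also have "(y powr (q - 1)) powr r = y powr q" using q1 by (simp add: powr_powr r_def)
  also have "y powr q / r = (q - 1) * y powr q / q" using q1 by (simp add: r_def field_simps)
  finally have "g * y powr (q - 1) \<le> (g powr q + (q - 1) * y powr q) / q" by (simp add: add_divide_distrib)
  then show ?thesis using q1 by (simp add: field_simps)
qed

text \<open>Jensen's inequality for the measure with density \<open>T\<close>, of total mass at most \<open>C\<close>, obtained by
  integrating the tangent inequality of \<open>powr q\<close> at \<open>y = u / C\<close>.\<close>

lemma kernel_Jensen:
  fixes T g :: "'a \<Rightarrow> real" and u C q :: real
  assumes [measurable]: "T \<in> borel_measurable M" "g \<in> borel_measurable M"
    and T: "\<And>w. T w \<ge> 0" and g: "\<And>w. g w \<ge> 0" and q: "q \<ge> 1" and C: "C > 0" and u: "u \<ge> 0"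
    and TC: "(\<integral>\<^sup>+w. ennreal (T w) \<partial>M) \<le> ennreal C"
    and uT: "ennreal u \<le> (\<integral>\<^sup>+w. ennreal (T w * g w) \<partial>M)"
  shows "ennreal (u powr q) \<le> ennreal (C powr (q - 1)) * (\<integral>\<^sup>+w. ennreal (T w * g w powr q) \<partial>M)"
proof (cases "u = 0")
  case True
  then show ?thesis by simp
next
  case False
  define y where "y = u / C"
  have y: "y > 0" using False u C by (simp add: y_def)
  have uy: "u = C * y" using C by (simp add: y_def)
  let ?J = "\<integral>\<^sup>+w. ennreal (T w * g w powr q) \<partial>M"
  have "ennreal (q * y powr (q - 1) * u) = ennreal (q * y powr (q - 1)) * ennreal u"
    using q u by (simp add: ennreal_mult)
  also have "\<dots> \<le> ennreal (q * y powr (q - 1)) * (\<integral>\<^sup>+w. ennreal (T w * g w) \<partial>M)"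
    by (intro mult_left_mono uT) auto
  also have "\<dots> = (\<integral>\<^sup>+w. ennreal (q * y powr (q - 1)) * ennreal (T w * g w) \<partial>M)"
    by (simp add: nn_integral_cmult)
  also have "\<dots> \<le> (\<integral>\<^sup>+w. ennreal (T w * g w powr q) + ennreal ((q - 1) * y powr q) * ennreal (T w) \<partial>M)"
  proof (rule nn_integral_mono)
    fix w
    have "q * y powr (q - 1) * g w \<le> g w powr q + (q - 1) * y powr q"
      by (rule powr_tangent_le[OF q g y])
    then have "T w * (q * y powr (q - 1) * g w) \<le> T w * (g w powr q + (q - 1) * y powr q)"
      by (intro mult_left_mono T)
    then have "ennreal ((q * y powr (q - 1)) * (T w * g w)) \<le> ennreal (T w * g w powr q + (q - 1) * y powr q * T w)"
      by (intro ennreal_leI) (simp add: algebra_simps)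
    then show "ennreal (q * y powr (q - 1)) * ennreal (T w * g w) \<le> ennreal (T w * g w powr q) + ennreal ((q - 1) * y powr q) * ennreal (T w)"
      using q T[of w] g[of w] by (simp add: ennreal_mult)
  qed
  also have "\<dots> = ?J + ennreal ((q - 1) * y powr q) * (\<integral>\<^sup>+w. ennreal (T w) \<partial>M)"
    by (simp add: nn_integral_add nn_integral_cmult)
  also have "\<dots> \<le> ?J + ennreal ((q - 1) * y powr q) * ennreal C"
    by (intro add_mono mult_left_mono TC) auto
  also have "ennreal ((q - 1) * y powr q) * ennreal C = ennreal ((q - 1) * y powr q * C)"
    using q C by (simp add: ennreal_mult)
  finally have main: "ennreal (q * y powr (q - 1) * u) \<le> ?J + ennreal ((q - 1) * y powr q * C)" .
  have "q * y powr (q - 1) * u = C * y powr q + (q - 1) * y powr q * C"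
  proof -
    have "y powr q = y powr (q - 1) * y" using y by (simp add: powr_diff)
    then show ?thesis by (simp add: uy algebra_simps)
  qed
  then have "ennreal (C * y powr q) + ennreal ((q - 1) * y powr q * C) \<le> ?J + ennreal ((q - 1) * y powr q * C)"
    using main q C by (simp add: ennreal_plus[symmetric] del: ennreal_plus)
  then have J: "ennreal (C * y powr q) \<le> ?J"
    by (simp add: ennreal_add_left_cancel_le add.commute)
  have "u powr q = C powr (q - 1) * (C * y powr q)"
    using C y unfolding uy by (simp add: powr_mult powr_diff)
  then have "ennreal (u powr q) = ennreal (C powr (q - 1)) * ennreal (C * y powr q)"
    using C by (simp add: ennreal_mult)
  also have "\<dots> \<le> ennreal (C powr (q - 1)) * ?J" by (intro mult_left_mono J) auto
  finally show ?thesis .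
qed

text \<open>The test with constant functions: Jensen's inequality in w uses \<open>T1\<close> and
  gives the factor C^(q - 1), Tonelli's theorem with \<open>T2\<close> gives the last factor C. The
  case q = 1 is included.\<close>

lemma Schur_test:
  fixes T :: "'a \<Rightarrow> 'a \<Rightarrow> real" and g u :: "'a \<Rightarrow> real"
  assumes M: "sigma_finite_measure M"
    and Tm: "(\<lambda>(z, w). T z w) \<in> borel_measurable (M \<Otimes>\<^sub>M M)" and gm[measurable]: "g \<in> borel_measurable M"
    and T: "\<And>z w. T z w \<ge> 0" and g: "\<And>w. g w \<ge> 0" and q: "q \<ge> 1" and C: "C > 0" and u: "\<And>z. u z \<ge> 0"
    and T1: "\<And>z. (\<integral>\<^sup>+w. ennreal (T z w) \<partial>M) \<le> ennreal C"
    and T2: "\<And>w. (\<integral>\<^sup>+z. ennreal (T z w) \<partial>M) \<le> ennreal C"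
    and uT: "\<And>z. ennreal (u z) \<le> (\<integral>\<^sup>+w. ennreal (T z w * g w) \<partial>M)"
  shows "(\<integral>\<^sup>+z. ennreal (u z powr q) \<partial>M) \<le> ennreal (C powr q) * (\<integral>\<^sup>+w. ennreal (g w powr q) \<partial>M)"
proof -
  interpret P: pair_sigma_finite M M using M by (simp add: pair_sigma_finite_def)
  have uq: "ennreal (u z powr q) \<le> ennreal (C powr (q - 1)) * (\<integral>\<^sup>+w. ennreal (T z w * g w powr q) \<partial>M)"
    if z: "z \<in> space M" for z
  proof (rule kernel_Jensen)
    show "T z \<in> borel_measurable M" using measurable_Pair2[OF Tm z] by simp
  qed (use T g q C u T1 uT in auto)
  note [measurable] = Tm
  have "(\<integral>\<^sup>+z. ennreal (u z powr q) \<partial>M) \<le> (\<integral>\<^sup>+z. ennreal (C powr (q - 1)) * (\<integral>\<^sup>+w. ennreal (T z w * g w powr q) \<partial>M) \<partial>M)"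
    by (intro nn_integral_mono uq)
  also have "\<dots> = ennreal (C powr (q - 1)) * (\<integral>\<^sup>+z. (\<integral>\<^sup>+w. ennreal (T z w * g w powr q) \<partial>M) \<partial>M)"
    by (rule nn_integral_cmult) measurable
  also have "(\<integral>\<^sup>+z. (\<integral>\<^sup>+w. ennreal (T z w * g w powr q) \<partial>M) \<partial>M) = (\<integral>\<^sup>+w. (\<integral>\<^sup>+z. ennreal (T z w * g w powr q) \<partial>M) \<partial>M)"
    by (rule P.Fubini'[symmetric]) measurable
  also have "\<dots> \<le> (\<integral>\<^sup>+w. ennreal C * ennreal (g w powr q) \<partial>M)"
  proof (rule nn_integral_mono)
    fix w assume w: "w \<in> space M"
    have [measurable]: "(\<lambda>z. T z w) \<in> borel_measurable M" using measurable_Pair1[OF Tm w] by simp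
    have "(\<integral>\<^sup>+z. ennreal (T z w * g w powr q) \<partial>M) = (\<integral>\<^sup>+z. ennreal (T z w) * ennreal (g w powr q) \<partial>M)"
      using T by (simp add: ennreal_mult)
    also have "\<dots> = (\<integral>\<^sup>+z. ennreal (T z w) \<partial>M) * ennreal (g w powr q)" by (rule nn_integral_multc) measurable
    also have "\<dots> \<le> ennreal C * ennreal (g w powr q)" by (intro mult_right_mono T2) auto
    finally show "(\<integral>\<^sup>+z. ennreal (T z w * g w powr q) \<partial>M) \<le> ennreal C * ennreal (g w powr q)" .
  qed
  also have "\<dots> = ennreal C * (\<integral>\<^sup>+w. ennreal (g w powr q) \<partial>M)" by (rule nn_integral_cmult) measurable
  also have "ennreal (C powr (q - 1)) * (ennreal C * (\<integral>\<^sup>+w. ennreal (g w powr q) \<partial>M)) = ennreal (C powr q) * (\<integral>\<^sup>+w. ennreal (g w powr q) \<partial>M)"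
    using C by (simp add: mult.assoc[symmetric] ennreal_mult[symmetric] powr_diff)
  finally show ?thesis by (simp add: mult_left_mono)
qed

section \<open>The kernel between the weighted spaces\<close>

lemma nn_integral_lborel_scale':
  fixes f :: "'a::euclidean_space \<Rightarrow> ennreal"
  assumes [measurable]: "f \<in> borel_measurable borel" and c: "c > 0"
  shows "(\<integral>\<^sup>+x. f (c *\<^sub>R x) \<partial>lborel) = ennreal (1 / c ^ DIM('a)) * (\<integral>\<^sup>+x. f x \<partial>lborel)"
proof -
  have "ennreal (1 / c ^ DIM('a)) * ennreal (c ^ DIM('a)) = 1"
    using c by (simp add: ennreal_mult[symmetric])
  then show ?thesis
    unfolding nn_integral_lborel_scale[OF assms] by (simp add: mult.assoc[symmetric])
qed

lemma one_plus_scale_comparable: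
  fixes c v :: real assumes "c > 0" "v \<ge> 0"
  shows "1 + v \<le> (1 + c + 1 / c) * (1 + c * v)" "1 + c * v \<le> (1 + c + 1 / c) * (1 + v)"
proof -
  have "(1 + c + 1 / c) * (1 + c * v) = (1 + v) + (c + 1 / c + c * v + c * c * v)"
    using assms by (simp add: field_simps)
  moreover have "0 \<le> c + 1 / c + c * v + c * c * v" using assms by simp
  ultimately show "1 + v \<le> (1 + c + 1 / c) * (1 + c * v)" by linarith
  have "(1 + c + 1 / c) * (1 + v) = (1 + c * v) + (v + c + (1 / c) * (1 + v))"
    by (simp add: algebra_simps)
  moreover have "0 \<le> v + c + (1 / c) * (1 + v)" using assms by simp
  ultimately show "1 + c * v \<le> (1 + c + 1 / c) * (1 + v)" by linarith
qed

lemma herm_scaleR: "herm (r *\<^sub>R z) (s *\<^sub>R w) = of_real (r * s) * herm z w"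
  unfolding herm_def by (simp add: sum_distrib_left scaleR_conv_of_real[where 'a=complex] mult_ac)

text \<open>The modulus of the kernel of the projection after conjugation with the weights: it maps
  |f| times the source weight to a majorant of the projection times the target weight, so the
  problem becomes one about unweighted Lebesgue spaces.\<close>

definition Schur_kernel ::
    "real \<Rightarrow> real \<Rightarrow> real \<Rightarrow> real \<Rightarrow> complex ^ 'n \<Rightarrow> complex ^ 'n \<Rightarrow> real" where
  "Schur_kernel l \<alpha> \<beta> \<rho> z w = cmod (bergman_kernel l \<alpha> z w) * exp (- \<alpha> * norm w powr (2 * l))
     * fock_weight l (\<alpha>\<^sup>2 / (2 * \<alpha> - \<beta>)) \<rho> z / fock_weight l \<beta> \<rho> w"

text \<open>The dilations by \<open>\<gamma> powr (1 / (2 * l))\<close> and \<open>\<delta> powr (1 / (2 * l))\<close> in the two variables reduce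
  the estimate to the unweighted exponent of \<open>fock_kernel_L1_bound\<close>, because
  \<open>\<gamma> * \<delta> = \<alpha>\<^sup>2\<close>; this is what singles out the exponent \<open>\<gamma> = \<alpha>\<^sup>2 / (2 * \<alpha> - \<beta>)\<close>.\<close>

lemma Schur_kernel_le:
  assumes l: "l \<ge> 1" and \<beta>: "0 < \<beta>" "\<beta> < 2 * \<alpha>"
  defines "\<delta> \<equiv> 2 * \<alpha> - \<beta>" and "\<gamma> \<equiv> \<alpha>\<^sup>2 / (2 * \<alpha> - \<beta>)"
  shows "\<exists>K>0. \<forall>z w :: complex ^ 'n. Schur_kernel l \<alpha> \<beta> \<rho> z w \<le> K *
     (norm (fock_series CARD('n) l (herm ((\<gamma> powr (1 / (2 * l))) *\<^sub>R z) ((\<delta> powr (1 / (2 * l))) *\<^sub>R w)))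
      * exp (- (1/2) * (norm ((\<gamma> powr (1 / (2 * l))) *\<^sub>R z) powr (2 * l) + norm ((\<delta> powr (1 / (2 * l))) *\<^sub>R w) powr (2 * l)))
      * ((1 + norm ((\<gamma> powr (1 / (2 * l))) *\<^sub>R z)) / (1 + norm ((\<delta> powr (1 / (2 * l))) *\<^sub>R w))) powr \<rho>)"
proof -
  have \<alpha>: "\<alpha> > 0" using \<beta> by simp
  have pos: "\<delta> > 0" "\<gamma> > 0" using \<beta> \<alpha> by (auto simp: \<delta>_def \<gamma>_def)
  define r where "r = \<gamma> powr (1 / (2 * l))"
  define s where "s = \<delta> powr (1 / (2 * l))"
  have rs: "r > 0" "s > 0" using pos by (auto simp: r_def s_def)
  have rs2: "r powr (2 * l) = \<gamma>" "s powr (2 * l) = \<delta>" using pos l by (auto simp: r_def s_def powr_powr)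
  have "r * s = \<alpha> powr (1 / l)"
  proof -
    have "r * s = (\<gamma> * \<delta>) powr (1 / (2 * l))" using pos by (simp add: r_def s_def powr_mult)
    also have "\<gamma> * \<delta> = \<alpha> powr 2" using pos \<alpha> by (simp add: \<gamma>_def \<delta>_def)
    finally show ?thesis by (simp add: powr_powr)
  qed
  then have h: "of_real (\<alpha> powr (1 / l)) * herm z w = herm (r *\<^sub>R z) (s *\<^sub>R w)" for z w :: "complex ^ 'n"
    by (simp only: herm_scaleR)
  define kr where "kr = 1 + r + 1 / r"
  define ks where "ks = 1 + s + 1 / s"
  have k1: "kr \<ge> 1" "ks \<ge> 1" using rs by (auto simp: kr_def ks_def)
  define \<kappa> where "\<kappa> = kernel_const CARD('n) l \<alpha>"
  have \<kappa>: "\<kappa> > 0" unfolding \<kappa>_def by (rule kernel_const_pos[OF l \<alpha>])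
  define K where "K = \<kappa> * (kr * ks) powr \<bar>\<rho>\<bar>"
  have "Schur_kernel l \<alpha> \<beta> \<rho> z w \<le> K *
     (norm (fock_series CARD('n) l (herm (r *\<^sub>R z) (s *\<^sub>R w)))
      * exp (- (1/2) * (norm (r *\<^sub>R z) powr (2 * l) + norm (s *\<^sub>R w) powr (2 * l)))
      * ((1 + norm (r *\<^sub>R z)) / (1 + norm (s *\<^sub>R w))) powr \<rho>)" for z w :: "complex ^ 'n"
  proof -
    have p1: "1 + norm z > 0" "1 + norm w > 0" "1 + r * norm z > 0" "1 + s * norm w > 0"
      using rs by (auto intro!: add_pos_nonneg)
    have c: "((1 + norm z) / (1 + norm w)) powr \<rho> \<le> (kr * ks) powr \<bar>\<rho>\<bar> * ((1 + r * norm z) / (1 + s * norm w)) powr \<rho>"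
    proof (rule powr_comparable)
      show "1 \<le> kr * ks" using k1 mult_mono[of 1 kr 1 ks] by simp
      have "(1 + norm z) * (1 + s * norm w) \<le> (kr * (1 + r * norm z)) * (ks * (1 + norm w))"
        unfolding kr_def ks_def using rs p1 k1 by (intro mult_mono one_plus_scale_comparable) (auto intro!: mult_nonneg_nonneg add_nonneg_nonneg)
      then show "(1 + norm z) / (1 + norm w) \<le> kr * ks * ((1 + r * norm z) / (1 + s * norm w))"
        using p1 by (simp add: field_simps)
      have "(1 + r * norm z) * (1 + norm w) \<le> (kr * (1 + norm z)) * (ks * (1 + s * norm w))"
        unfolding kr_def ks_def using rs p1 k1 by (intro mult_mono one_plus_scale_comparable) (auto intro!: mult_nonneg_nonneg add_nonneg_nonneg)
      then show "(1 + r * norm z) / (1 + s * norm w) \<le> kr * ks * ((1 + norm z) / (1 + norm w))"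
        using p1 by (simp add: field_simps)
    qed (use p1 in auto)
    \<comment> \<open>Dividing by the source weight turns the rate alpha into alpha - beta / 2 =
      delta / 2. The dilations then reduce both rates, gamma / 2 and delta / 2, to 1/2.\<close>
    have e: "exp (- \<alpha> * norm w powr (2 * l)) * exp (- (\<gamma> / 2) * norm z powr (2 * l)) / exp (- (\<beta> / 2) * norm w powr (2 * l))
       = exp (- (1/2) * (norm (r *\<^sub>R z) powr (2 * l) + norm (s *\<^sub>R w) powr (2 * l)))"
    proof -
      have "norm (r *\<^sub>R z) powr (2 * l) = \<gamma> * norm z powr (2 * l)" "norm (s *\<^sub>R w) powr (2 * l) = \<delta> * norm w powr (2 * l)"
        using rs rs2 by (simp_all add: powr_mult)
      then have "- (1/2) * (norm (r *\<^sub>R z) powr (2 * l) + norm (s *\<^sub>R w) powr (2 * l))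
        = - \<alpha> * norm w powr (2 * l) + - (\<gamma> / 2) * norm z powr (2 * l) - - (\<beta> / 2) * norm w powr (2 * l)"
        by (simp only: \<delta>_def) (simp add: algebra_simps)
      then show ?thesis by (simp only: exp_add exp_diff)
    qed
    define H where "H = norm (fock_series CARD('n) l (herm (r *\<^sub>R z) (s *\<^sub>R w)))"
    define E where "E = exp (- (1/2) * (norm (r *\<^sub>R z) powr (2 * l) + norm (s *\<^sub>R w) powr (2 * l)))"
    have "cmod (bergman_kernel l \<alpha> z w) = \<kappa> * H"
      using \<kappa> by (simp add: bergman_kernel_eq[OF \<alpha>] h norm_mult H_def \<kappa>_def[symmetric])
    then have "Schur_kernel l \<alpha> \<beta> \<rho> z w = \<kappa> * H * (exp (- \<alpha> * norm w powr (2 * l)) * exp (- (\<gamma> / 2) * norm z powr (2 * l)) / exp (- (\<beta> / 2) * norm w powr (2 * l)))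
        * ((1 + norm z) powr \<rho> / (1 + norm w) powr \<rho>)"
      by (simp add: Schur_kernel_def fock_weight_def \<gamma>_def mult_ac)
    also have "\<dots> = \<kappa> * H * E * ((1 + norm z) / (1 + norm w)) powr \<rho>"
      using p1 unfolding e E_def by (simp add: powr_divide)
    also have "\<dots> \<le> \<kappa> * H * E * ((kr * ks) powr \<bar>\<rho>\<bar> * ((1 + r * norm z) / (1 + s * norm w)) powr \<rho>)"
      using c \<kappa> by (intro mult_left_mono) (auto simp: H_def E_def)
    also have "\<dots> = K * (H * E * ((1 + norm (r *\<^sub>R z)) / (1 + norm (s *\<^sub>R w))) powr \<rho>)"
      using rs by (simp add: K_def mult_ac)
    finally show ?thesis unfolding H_def E_def .
  qed
  moreover have "K > 0" using \<kappa> k1 by (auto simp: K_def)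
  ultimately show ?thesis unfolding r_def s_def by blast
qed

lemma borel_measurable_fock_series_herm:
  assumes "l \<ge> 1"
  shows "(\<lambda>w :: complex ^ 'n. norm (fock_series CARD('n) l (herm z w))) \<in> borel_measurable borel"
  using continuous_on_fock_series[OF card_ge_1 assms]
  by (intro borel_measurable_continuous_onI continuous_intros continuous_on_compose2[OF continuous_on_fock_series[OF card_ge_1 assms]]) auto

text \<open>The integrand \<open>T\<close> is symmetric under exchange of z and w together with a
  change of sign of sigma, so \<open>fock_kernel_L1_bound\<close> for rho and for its negative
  covers both integrals. The dilations contribute constant Jacobians.\<close>

lemma Schur_kernel_integrals:
  assumes l: "l \<ge> 1" and \<beta>: "0 < \<beta>" "\<beta> < 2 * \<alpha>"
  shows "\<exists>C>0. (\<forall>z :: complex ^ 'n. (\<integral>\<^sup>+w. ennreal (Schur_kernel l \<alpha> \<beta> \<rho> z w) \<partial>dV) \<le> ennreal C)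
     \<and> (\<forall>w :: complex ^ 'n. (\<integral>\<^sup>+z. ennreal (Schur_kernel l \<alpha> \<beta> \<rho> z w) \<partial>dV) \<le> ennreal C)"
proof -
  define \<delta> where "\<delta> = 2 * \<alpha> - \<beta>"
  define \<gamma> where "\<gamma> = \<alpha>\<^sup>2 / (2 * \<alpha> - \<beta>)"
  have pos: "\<delta> > 0" "\<gamma> > 0" using \<beta> by (auto simp: \<delta>_def \<gamma>_def)
  define r where "r = \<gamma> powr (1 / (2 * l))"
  define s where "s = \<delta> powr (1 / (2 * l))"
  have rs: "r > 0" "s > 0" using pos by (auto simp: r_def s_def)
  define T where "T \<sigma> z w = norm (fock_series CARD('n) l (herm z w))
      * exp (- (1/2) * (norm z powr (2 * l) + norm w powr (2 * l))) * ((1 + norm z) / (1 + norm w)) powr \<sigma>"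
    for \<sigma> and z w :: "complex ^ 'n"
  have [measurable]: "(\<lambda>w :: complex ^ 'n. norm (fock_series CARD('n) l (herm z w))) \<in> borel_measurable borel" for z
    by (rule borel_measurable_fock_series_herm[OF l])
  have Tm[measurable]: "T \<sigma> z \<in> borel_measurable borel" for \<sigma> z unfolding T_def by measurable
  have Tn: "T \<sigma> z w \<ge> 0" for \<sigma> z w by (simp add: T_def)
  have Tsym: "T \<sigma> z w = T (- \<sigma>) w z" for \<sigma> z w
  proof -
    have "norm (fock_series CARD('n) l (herm z w)) = norm (fock_series CARD('n) l (herm w z))"
      by (subst herm_commute) (simp add: fock_series_cnj[OF card_ge_1 l])
    moreover have "1 + norm z > 0" "1 + norm w > 0" by (auto intro: add_pos_nonneg)
    then have "((1 + norm z) / (1 + norm w)) powr \<sigma> = ((1 + norm w) / (1 + norm z)) powr (- \<sigma>)"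
      by (simp add: powr_divide powr_minus)
    ultimately show ?thesis by (simp add: T_def add.commute)
  qed
  obtain C1 where C1: "C1 > 0" "\<And>z. (\<integral>\<^sup>+w. ennreal (T \<rho> z w) \<partial>lborel) \<le> ennreal C1"
    using fock_kernel_L1_bound[OF l, of \<rho>] unfolding T_def by blast
  obtain C2 where C2: "C2 > 0" "\<And>w. (\<integral>\<^sup>+z. ennreal (T (- \<rho>) w z) \<partial>lborel) \<le> ennreal C2"
    using fock_kernel_L1_bound[OF l, of "- \<rho>"] unfolding T_def by blast
  obtain K where K: "K > 0" "\<And>z w :: complex ^ 'n. Schur_kernel l \<alpha> \<beta> \<rho> z w \<le> K * T \<rho> (r *\<^sub>R z) (s *\<^sub>R w)"
    using Schur_kernel_le[OF l \<beta>, of \<rho>] unfolding T_def r_def s_def \<delta>_def \<gamma>_def by blast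
  define V where "V = dV_const TYPE('n)"
  have V: "V > 0" unfolding V_def by (rule dV_const_pos)
  define D where "D = DIM(complex ^ 'n)"
  have gen: "(\<integral>\<^sup>+w. ennreal (K * f (c *\<^sub>R w)) \<partial>dV) \<le> ennreal (V * K * (1 / c ^ D) * C)"
    if [measurable]: "f \<in> borel_measurable borel" and "\<And>w. f w \<ge> 0" "c > 0" "C > 0" "(\<integral>\<^sup>+w. ennreal (f w) \<partial>lborel) \<le> ennreal C"
    for f :: "complex ^ 'n \<Rightarrow> real" and c C
  proof -
    have "(\<integral>\<^sup>+w. ennreal (K * f (c *\<^sub>R w)) \<partial>dV) = ennreal V * (\<integral>\<^sup>+w. ennreal (K * f (c *\<^sub>R w)) \<partial>lborel)"
      unfolding V_def by (rule nn_integral_dV) measurable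
    also have "(\<integral>\<^sup>+w. ennreal (K * f (c *\<^sub>R w)) \<partial>lborel) = ennreal K * (\<integral>\<^sup>+w. ennreal (f (c *\<^sub>R w)) \<partial>lborel)"
      using K(1) that(2) by (simp add: ennreal_mult nn_integral_cmult)
    also have "(\<integral>\<^sup>+w. ennreal (f (c *\<^sub>R w)) \<partial>lborel) = ennreal (1 / c ^ D) * (\<integral>\<^sup>+w. ennreal (f w) \<partial>lborel)"
      unfolding D_def by (rule nn_integral_lborel_scale') (measurable, rule that)
    also have "ennreal V * (ennreal K * \<dots>) \<le> ennreal V * (ennreal K * (ennreal (1 / c ^ D) * ennreal C))"
      by (intro mult_left_mono that) auto
    also have "\<dots> = ennreal (V * K * (1 / c ^ D) * C)"
      using V K(1) that(3,4) by (simp add: ennreal_mult[symmetric] mult.assoc)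
    finally show ?thesis .
  qed
  define C where "C = V * K * (1 / s ^ D) * C1 + V * K * (1 / r ^ D) * C2"
  have Cpos: "0 < V * K * (1 / s ^ D) * C1" "0 < V * K * (1 / r ^ D) * C2"
    using V K(1) rs C1(1) C2(1) by (auto intro!: mult_pos_pos divide_pos_pos)
  have 1: "(\<integral>\<^sup>+w. ennreal (Schur_kernel l \<alpha> \<beta> \<rho> z w) \<partial>dV) \<le> ennreal C" for z :: "complex ^ 'n"
  proof -
    have "(\<integral>\<^sup>+w. ennreal (Schur_kernel l \<alpha> \<beta> \<rho> z w) \<partial>dV) \<le> (\<integral>\<^sup>+w. ennreal (K * T \<rho> (r *\<^sub>R z) (s *\<^sub>R w)) \<partial>dV)"
      by (intro nn_integral_mono ennreal_leI K)
    also have "\<dots> \<le> ennreal (V * K * (1 / s ^ D) * C1)"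
      by (rule gen[OF Tm Tn rs(2) C1])
    also have "\<dots> \<le> ennreal C" using Cpos by (intro ennreal_leI) (simp add: C_def)
    finally show ?thesis .
  qed
  have 2: "(\<integral>\<^sup>+z. ennreal (Schur_kernel l \<alpha> \<beta> \<rho> z w) \<partial>dV) \<le> ennreal C" for w :: "complex ^ 'n"
  proof -
    have "(\<integral>\<^sup>+z. ennreal (Schur_kernel l \<alpha> \<beta> \<rho> z w) \<partial>dV) \<le> (\<integral>\<^sup>+z. ennreal (K * T (- \<rho>) (s *\<^sub>R w) (r *\<^sub>R z)) \<partial>dV)"
      using K(2) by (intro nn_integral_mono ennreal_leI) (simp add: Tsym[symmetric])
    also have "\<dots> \<le> ennreal (V * K * (1 / r ^ D) * C2)"
      by (rule gen[OF Tm Tn rs(1) C2])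
    also have "\<dots> \<le> ennreal C" using Cpos by (intro ennreal_leI) (simp add: C_def)
    finally show ?thesis .
  qed
  have "C > 0" using Cpos by (simp add: C_def)
  then show ?thesis using 1 2 by blast
qed

lemma borel_measurable_Schur_kernel:
  assumes l: "l \<ge> 1" and \<alpha>: "\<alpha> > 0"
  shows "(\<lambda>(z, w :: complex ^ 'n). Schur_kernel l \<alpha> \<beta> \<rho> z w) \<in> borel_measurable (dV \<Otimes>\<^sub>M dV)"
proof -
  have "continuous_on UNIV (\<lambda>x :: (complex ^ 'n) \<times> (complex ^ 'n). cmod (fock_series CARD('n) l (of_real (\<alpha> powr (1 / l)) * herm (fst x) (snd x))))"
    by (intro continuous_intros continuous_on_compose2[OF continuous_on_fock_series[OF card_ge_1 l]]) auto
  then have [measurable]: "(\<lambda>x :: (complex ^ 'n) \<times> (complex ^ 'n). cmod (fock_series CARD('n) l (of_real (\<alpha> powr (1 / l)) * herm (fst x) (snd x)))) \<in> borel_measurable (borel \<Otimes>\<^sub>M borel)"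
    by (simp add: borel_prod borel_measurable_continuous_onI)
  have m: "(\<lambda>x :: (complex ^ 'n) \<times> (complex ^ 'n). Schur_kernel l \<alpha> \<beta> \<rho> (fst x) (snd x)) \<in> borel_measurable (borel \<Otimes>\<^sub>M borel)"
    unfolding Schur_kernel_def bergman_kernel_eq[OF \<alpha>] norm_mult by measurable
  have i: "(\<lambda>x. x) \<in> measurable (dV :: (complex ^ 'n) measure) borel"
    by (rule measurableI) (auto simp: sets_dV)
  from borel_measurable_pair[OF m[unfolded borel_prod] i i] show ?thesis by (simp add: case_prod_unfold)
qed

lemma enn2real_ge_1: "1 \<le> p \<Longrightarrow> p \<noteq> \<infinity> \<Longrightarrow> 1 \<le> enn2real p"
  by (cases p) auto

text \<open>For infinite p the integral of the kernel over w is enough; finite p takes the Schur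
  test. The inequality is stated for \<open>ennreal\<close> values because \<open>fock_norm\<close>
  sends an infinite modular to 0, so an inequality of norms would not show that the image lies in
  the target space.\<close>

lemma fock_modular_bergman_projection:
  assumes l: "l \<ge> 1" and p: "1 \<le> p" and \<beta>: "0 < \<beta>" "\<beta> < 2 * \<alpha>"
  shows "\<exists>C>0. \<forall>f :: complex ^ 'n \<Rightarrow> complex. f \<in> L_space l p \<beta> \<rho> \<longrightarrow>
     fock_modular l p (\<alpha>\<^sup>2 / (2 * \<alpha> - \<beta>)) \<rho> (bergman_projection l \<alpha> f)
       \<le> ennreal (if p = \<infinity> then C else C powr enn2real p) * fock_modular l p \<beta> \<rho> f"
proof -
  define \<gamma> where "\<gamma> = \<alpha>\<^sup>2 / (2 * \<alpha> - \<beta>)"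
  have \<alpha>: "\<alpha> > 0" using \<beta> by simp
  obtain C where C: "C > 0"
    "\<And>z :: complex ^ 'n. (\<integral>\<^sup>+w. ennreal (Schur_kernel l \<alpha> \<beta> \<rho> z w) \<partial>dV) \<le> ennreal C"
    "\<And>w :: complex ^ 'n. (\<integral>\<^sup>+z. ennreal (Schur_kernel l \<alpha> \<beta> \<rho> z w) \<partial>dV) \<le> ennreal C"
    using Schur_kernel_integrals[OF l \<beta>, of \<rho>] by blast
  have Tn: "Schur_kernel l \<alpha> \<beta> \<rho> z w \<ge> 0" for z w :: "complex ^ 'n"
    using fock_weight_pos[of l \<gamma> \<rho> z] fock_weight_pos[of l \<beta> \<rho> w]
    by (simp add: Schur_kernel_def \<gamma>_def[symmetric])
  have "fock_modular l p \<gamma> \<rho> (bergman_projection l \<alpha> f)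
       \<le> ennreal (if p = \<infinity> then C else C powr enn2real p) * fock_modular l p \<beta> \<rho> f"
    if f: "f \<in> L_space l p \<beta> \<rho>" for f :: "complex ^ 'n \<Rightarrow> complex"
  proof -
    have [measurable]: "f \<in> borel_measurable dV" using f by (simp add: L_space_def)
    have [measurable]: "bergman_projection l \<alpha> f \<in> borel_measurable borel"
      by (intro borel_measurable_continuous_onI entire_continuous entire_bergman_projection[OF l p \<alpha> \<beta>(2) f])
    define g where "g w = cmod (f w) * fock_weight l \<beta> \<rho> w" for w
    define u where "u z = cmod (bergman_projection l \<alpha> f z) * fock_weight l \<gamma> \<rho> z" for z
    have gm[measurable]: "g \<in> borel_measurable dV" unfolding g_def by measurable
    have gn: "g w \<ge> 0" for w using fock_weight_pos[of l \<beta> \<rho> w] by (simp add: g_def)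
    have un: "u z \<ge> 0" for z using fock_weight_pos[of l \<gamma> \<rho> z] by (simp add: u_def)
    have uT: "ennreal (u z) \<le> (\<integral>\<^sup>+w. ennreal (Schur_kernel l \<alpha> \<beta> \<rho> z w * g w) \<partial>dV)" for z
    proof -
      note int = integrable_bergman_integrand[OF l p \<alpha> \<beta>(2) f, of z]
      have [measurable]: "bergman_integrand l \<alpha> f z \<in> borel_measurable dV" using int by auto
      have "ennreal (u z) = ennreal (fock_weight l \<gamma> \<rho> z) * ennreal (norm (\<integral>w. bergman_integrand l \<alpha> f z w \<partial>dV))"
        using fock_weight_pos[of l \<gamma> \<rho> z] by (simp add: u_def bergman_projection_def ennreal_mult mult.commute)
      also have "\<dots> \<le> ennreal (fock_weight l \<gamma> \<rho> z) * (\<integral>\<^sup>+w. ennreal (norm (bergman_integrand l \<alpha> f z w)) \<partial>dV)"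
        by (intro mult_left_mono integral_norm_bound_ennreal[OF int]) auto
      also have "\<dots> = (\<integral>\<^sup>+w. ennreal (fock_weight l \<gamma> \<rho> z) * ennreal (norm (bergman_integrand l \<alpha> f z w)) \<partial>dV)"
        by (rule nn_integral_cmult[symmetric]) measurable
      also have "\<dots> = (\<integral>\<^sup>+w. ennreal (Schur_kernel l \<alpha> \<beta> \<rho> z w * g w) \<partial>dV)"
      proof (rule nn_integral_cong)
        fix w
        have "Schur_kernel l \<alpha> \<beta> \<rho> z w * g w = fock_weight l \<gamma> \<rho> z * norm (bergman_integrand l \<alpha> f z w)"
          using fock_weight_pos[of l \<beta> \<rho> w]
          by (simp add: Schur_kernel_def g_def bergman_integrand_def norm_mult \<gamma>_def[symmetric])
        then show "ennreal (fock_weight l \<gamma> \<rho> z) * ennreal (norm (bergman_integrand l \<alpha> f z w)) = ennreal (Schur_kernel l \<alpha> \<beta> \<rho> z w * g w)"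
          using fock_weight_pos[of l \<gamma> \<rho> z] by (simp add: ennreal_mult)
      qed
      finally show ?thesis .
    qed
    have Tm: "(\<lambda>(z, w :: complex ^ 'n). Schur_kernel l \<alpha> \<beta> \<rho> z w) \<in> borel_measurable (dV \<Otimes>\<^sub>M dV)"
      by (rule borel_measurable_Schur_kernel[OF l \<alpha>])
    show ?thesis
    proof (cases "p = \<infinity>")
      case True
      define S where "S = fock_modular l p \<beta> \<rho> f"
      have S: "AE w in dV. ennreal (g w) \<le> S"
        using esssup_AE[where f = "\<lambda>w. ennreal (g w)" and M = dV] True by (simp add: S_def fock_modular_def g_def)
      have "ennreal (u z) \<le> ennreal C * S" for z
      proof -
        have [measurable]: "Schur_kernel l \<alpha> \<beta> \<rho> z \<in> borel_measurable dV"
          using measurable_Pair2[OF Tm, of z] by simp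
        note uT[of z]
        also have "(\<integral>\<^sup>+w. ennreal (Schur_kernel l \<alpha> \<beta> \<rho> z w * g w) \<partial>dV) \<le> (\<integral>\<^sup>+w. ennreal (Schur_kernel l \<alpha> \<beta> \<rho> z w) * S \<partial>dV)"
        proof (rule nn_integral_mono_AE)
          show "AE w in dV. ennreal (Schur_kernel l \<alpha> \<beta> \<rho> z w * g w) \<le> ennreal (Schur_kernel l \<alpha> \<beta> \<rho> z w) * S"
            using S by eventually_elim (simp add: ennreal_mult Tn gn mult_left_mono)
        qed
        also have "\<dots> = (\<integral>\<^sup>+w. ennreal (Schur_kernel l \<alpha> \<beta> \<rho> z w) \<partial>dV) * S" by (rule nn_integral_multc) measurable
        also have "\<dots> \<le> ennreal C * S" by (intro mult_right_mono C) auto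
        finally show ?thesis .
      qed
      then have "esssup dV (\<lambda>z. ennreal (u z)) \<le> ennreal C * S"
        by (intro esssup_I) (auto simp: u_def)
      then show ?thesis using True by (simp add: fock_modular_def u_def S_def)
    next
      case False
      have "(\<integral>\<^sup>+z. ennreal (u z powr enn2real p) \<partial>dV) \<le> ennreal (C powr enn2real p) * (\<integral>\<^sup>+w. ennreal (g w powr enn2real p) \<partial>dV)"
        by (rule Schur_test[OF sigma_finite_dV Tm gm Tn gn enn2real_ge_1[OF p False] C(1) un C(2,3) uT])
      then show ?thesis using False by (simp add: fock_modular_def u_def g_def)
    qed
  qed
  then show ?thesis using C(1) unfolding \<gamma>_def by blast
qed

lemma fock_norm_le:
  assumes p: "1 \<le> p" and C: "C > 0" and fin: "fock_modular l p \<beta> \<rho> f < \<infinity>"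
    and le: "fock_modular l p \<gamma> \<rho> g \<le> ennreal (if p = \<infinity> then C else C powr enn2real p) * fock_modular l p \<beta> \<rho> f"
  shows "fock_norm l p \<gamma> \<rho> g \<le> C * fock_norm l p \<beta> \<rho> f"
proof -
  let ?K = "if p = \<infinity> then C else C powr enn2real p"
  have K: "?K \<ge> 0" using C by simp
  have "enn2real (fock_modular l p \<gamma> \<rho> g) \<le> enn2real (ennreal ?K * fock_modular l p \<beta> \<rho> f)"
    using le fin by (intro enn2real_mono) (auto simp: ennreal_mult_less_top)
  then have m: "enn2real (fock_modular l p \<gamma> \<rho> g) \<le> ?K * enn2real (fock_modular l p \<beta> \<rho> f)"
    using K by (simp add: enn2real_mult)
  show ?thesis
  proof (cases "p = \<infinity>")
    case True
    then show ?thesis using m by (simp add: fock_norm_def)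
  next
    case False
    define q where "q = enn2real p"
    have q: "q \<ge> 1" unfolding q_def by (rule enn2real_ge_1[OF p False])
    have "enn2real (fock_modular l p \<gamma> \<rho> g) powr (1 / q) \<le> (C powr q * enn2real (fock_modular l p \<beta> \<rho> f)) powr (1 / q)"
      using m False q by (intro powr_mono2) (auto simp: q_def)
    also have "\<dots> = C * enn2real (fock_modular l p \<beta> \<rho> f) powr (1 / q)"
      using C q by (simp add: powr_mult powr_powr)
    finally show ?thesis using False by (simp add: fock_norm_def q_def)
  qed
qed

section \<open>Dilations and the preimage\<close>

lemma entire_scale:
  fixes F :: "complex ^ 'n \<Rightarrow> complex"
  assumes "entire F"
  shows "entire (\<lambda>w. F (r *\<^sub>R w))"
  unfolding entire_def
proof
  fix z :: "complex ^ 'n"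
  obtain D where D: "(F has_derivative D) (at (r *\<^sub>R z))" "\<And>c v. D (c *s v) = c * D v"
    using assms unfolding entire_def by blast
  have "((\<lambda>w. r *\<^sub>R w) has_derivative (\<lambda>v. r *\<^sub>R v)) (at z)" by (auto intro!: derivative_eq_intros)
  from has_derivative_compose[OF this D(1)]
  have "((\<lambda>w. F (r *\<^sub>R w)) has_derivative (\<lambda>v. D (r *\<^sub>R v))) (at z)" .
  moreover have "D (r *\<^sub>R (c *s v)) = c * D (r *\<^sub>R v)" for c v
  proof -
    have "r *\<^sub>R (c *s v) = c *s (r *\<^sub>R v)" by (simp add: vec_eq_iff)
    then show ?thesis by (simp only: D(2))
  qed
  ultimately show "\<exists>D. ((\<lambda>w. F (r *\<^sub>R w)) has_derivative D) (at z) \<and> (\<forall>c v. D (c *s v) = c * D v)" by blast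
qed

text \<open>For infinite p, continuity makes the essential bound hold at every point, because the
  set where it holds is closed and of full measure; the dilated function is then bounded pointwise.
  For finite p it is a change of variables.\<close>

lemma L_space_scale:
  fixes F :: "complex ^ 'n \<Rightarrow> complex"
  assumes l: "l \<ge> 1" and p: "1 \<le> p" and r: "r > 0" and F: "F \<in> L_space l p \<gamma> \<rho>" and c: "continuous_on UNIV F"
  shows "(\<lambda>w. F (r *\<^sub>R w)) \<in> L_space l p (\<gamma> * r powr (2 * l)) \<rho>"
proof -
  define k where "k = (1 + r + 1 / r) powr \<bar>\<rho>\<bar>"
  have k: "k > 0" using r by (simp add: k_def) (smt (verit) divide_pos_pos)
  define \<phi> where "\<phi> z = cmod (F z) * fock_weight l \<gamma> \<rho> z" for z
  have wc: "continuous_on UNIV (fock_weight l \<gamma> \<rho> :: complex ^ 'n \<Rightarrow> real)"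
  proof -
    have "continuous_on UNIV (\<lambda>z :: complex ^ 'n. (1 + norm z) powr \<rho>)"
      by (intro continuous_on_powr continuous_intros ballI) (metis add_pos_nonneg less_irrefl norm_ge_zero zero_less_one)
    moreover have "continuous_on UNIV (\<lambda>z :: complex ^ 'n. norm z powr (2 * l))"
      using l by (intro continuous_on_powr' continuous_intros) auto
    ultimately show ?thesis unfolding fock_weight_def[abs_def]
      by (intro continuous_on_mult continuous_on_exp continuous_on_const)
  qed
  have \<phi>c: "continuous_on UNIV \<phi>" unfolding \<phi>_def using c wc by (intro continuous_intros)
  have [measurable]: "\<phi> \<in> borel_measurable borel" "F \<in> borel_measurable borel"
    using \<phi>c c by (auto intro: borel_measurable_continuous_onI)
  have le: "cmod (F (r *\<^sub>R w)) * fock_weight l (\<gamma> * r powr (2 * l)) \<rho> w \<le> k * \<phi> (r *\<^sub>R w)" for w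
  proof -
    have p1: "1 + norm w > 0" "1 + r * norm w > 0" using r by (auto intro!: add_pos_nonneg)
    have "(1 + norm w) powr \<rho> \<le> k * (1 + r * norm w) powr \<rho>"
      unfolding k_def using r p1 by (intro powr_comparable one_plus_scale_comparable) auto
    moreover have "exp (- (\<gamma> * r powr (2 * l) / 2) * norm w powr (2 * l)) = exp (- (\<gamma> / 2) * norm (r *\<^sub>R w) powr (2 * l))"
      using r by (simp add: powr_mult mult_ac)
    ultimately have "fock_weight l (\<gamma> * r powr (2 * l)) \<rho> w \<le> k * fock_weight l \<gamma> \<rho> (r *\<^sub>R w)"
      unfolding fock_weight_def using r by (simp only: mult.assoc[symmetric]) (intro mult_right_mono, auto)
    then have "cmod (F (r *\<^sub>R w)) * fock_weight l (\<gamma> * r powr (2 * l)) \<rho> w \<le> cmod (F (r *\<^sub>R w)) * (k * fock_weight l \<gamma> \<rho> (r *\<^sub>R w))"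
      by (intro mult_left_mono) auto
    then show ?thesis by (simp add: \<phi>_def mult_ac)
  qed
  have fin: "fock_modular l p \<gamma> \<rho> F < \<infinity>" using F by (simp add: L_space_def)
  have "fock_modular l p (\<gamma> * r powr (2 * l)) \<rho> (\<lambda>w. F (r *\<^sub>R w)) < \<infinity>"
  proof (cases "p = \<infinity>")
    case True
    define S where "S = enn2real (fock_modular l p \<gamma> \<rho> F)"
    have S: "fock_modular l p \<gamma> \<rho> F = ennreal S" using fin by (simp add: S_def)
    have "AE z in dV. ennreal (\<phi> z) \<le> ennreal S"
      using esssup_AE[where f = "\<lambda>w. ennreal (\<phi> w)" and M = dV] True S by (simp add: fock_modular_def \<phi>_def)
    then have "AE z in dV. z \<in> {z. \<phi> z \<le> S}"
      by eventually_elim (simp add: S_def)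
    then have AE: "AE z in lebesgue. z \<in> {z. \<phi> z \<le> S}"
      unfolding dV_def by (subst (asm) AE_density) (auto simp: content_ball_pos)
    have "closed {z. \<phi> z \<le> S}" using \<phi>c by (intro closed_Collect_le continuous_intros) auto
    then have all: "\<phi> z \<le> S" for z using mem_closed_if_AE_lebesgue[OF _ AE] by blast
    have "esssup dV (\<lambda>w. ennreal (cmod (F (r *\<^sub>R w)) * fock_weight l (\<gamma> * r powr (2 * l)) \<rho> w)) \<le> ennreal (k * S)"
    proof (rule esssup_I)
      show "(\<lambda>w. ennreal (cmod (F (r *\<^sub>R w)) * fock_weight l (\<gamma> * r powr (2 * l)) \<rho> w)) \<in> borel_measurable dV"
        by measurable
      show "AE w in dV. ennreal (cmod (F (r *\<^sub>R w)) * fock_weight l (\<gamma> * r powr (2 * l)) \<rho> w) \<le> ennreal (k * S)"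
      proof (intro AE_I2 ennreal_leI)
        fix w
        have "k * \<phi> (r *\<^sub>R w) \<le> k * S" using all k by (intro mult_left_mono) auto
        then show "cmod (F (r *\<^sub>R w)) * fock_weight l (\<gamma> * r powr (2 * l)) \<rho> w \<le> k * S" using le[of w] by linarith
      qed
    qed
    also have "\<dots> < \<infinity>" by simp
    finally show ?thesis using True by (simp add: fock_modular_def)
  next
    case False
    define q where "q = enn2real p"
    have q: "q \<ge> 1" unfolding q_def by (rule enn2real_ge_1[OF p False])
    have \<phi>n: "\<phi> z \<ge> 0" for z using fock_weight_pos[of l \<gamma> \<rho> z] by (simp add: \<phi>_def)
    have "(\<integral>\<^sup>+w. ennreal ((cmod (F (r *\<^sub>R w)) * fock_weight l (\<gamma> * r powr (2 * l)) \<rho> w) powr q) \<partial>dV)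
       \<le> (\<integral>\<^sup>+w. ennreal (k powr q) * ennreal (\<phi> (r *\<^sub>R w) powr q) \<partial>dV)"
    proof (rule nn_integral_mono)
      fix w
      have "(cmod (F (r *\<^sub>R w)) * fock_weight l (\<gamma> * r powr (2 * l)) \<rho> w) powr q \<le> (k * \<phi> (r *\<^sub>R w)) powr q"
        using le[of w] fock_weight_pos[of l "\<gamma> * r powr (2 * l)" \<rho> w] q by (intro powr_mono2) (auto simp: less_imp_le)
      also have "\<dots> = k powr q * \<phi> (r *\<^sub>R w) powr q" using k \<phi>n by (simp add: powr_mult)
      finally show "ennreal ((cmod (F (r *\<^sub>R w)) * fock_weight l (\<gamma> * r powr (2 * l)) \<rho> w) powr q) \<le> ennreal (k powr q) * ennreal (\<phi> (r *\<^sub>R w) powr q)"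
        by (simp add: ennreal_mult[symmetric] ennreal_leI)
    qed
    also have "\<dots> = ennreal (dV_const TYPE('n)) * (\<integral>\<^sup>+w. ennreal (k powr q) * ennreal (\<phi> (r *\<^sub>R w) powr q) \<partial>lborel)"
      by (rule nn_integral_dV) measurable
    also have "(\<integral>\<^sup>+w. ennreal (k powr q) * ennreal (\<phi> (r *\<^sub>R w) powr q) \<partial>lborel)
      = ennreal (1 / r ^ DIM(complex ^ 'n)) * (\<integral>\<^sup>+w. ennreal (k powr q) * ennreal (\<phi> w powr q) \<partial>lborel)"
      by (rule nn_integral_lborel_scale'[where f = "\<lambda>w. ennreal (k powr q) * ennreal (\<phi> w powr q)"]) (measurable, rule r)
    also have "(\<integral>\<^sup>+w. ennreal (k powr q) * ennreal (\<phi> w powr q) \<partial>lborel) = ennreal (k powr q) * (\<integral>\<^sup>+w. ennreal (\<phi> w powr q) \<partial>lborel)"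
      by (rule nn_integral_cmult) measurable
    also have "ennreal (dV_const TYPE('n)) * (ennreal (1 / r ^ DIM(complex ^ 'n)) * (ennreal (k powr q) * (\<integral>\<^sup>+w. ennreal (\<phi> w powr q) \<partial>lborel))) < \<infinity>"
    proof -
      have "ennreal (dV_const TYPE('n)) * (\<integral>\<^sup>+w. ennreal (\<phi> w powr q) \<partial>lborel) < top"
        using fin False by (simp add: fock_modular_def \<phi>_def[symmetric] q_def nn_integral_dV)
      then have "(\<integral>\<^sup>+w. ennreal (\<phi> w powr q) \<partial>lborel) < top"
        using dV_const_pos[where 'n='n] by (auto simp: ennreal_mult_less_top)
      then show ?thesis by (simp add: ennreal_mult_less_top)
    qed
    finally show ?thesis using False by (simp add: fock_modular_def q_def)
  qed
  then show ?thesis by (simp add: L_space_def)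
qed

text \<open>The preimage of \<open>F\<close> is \<open>\<kappa> * F (\<lambda> * w) * exp ((\<alpha> - \<delta>) * \<bar>w\<bar> powr (2 * l))\<close> with
  \<open>\<delta> = 2 * \<alpha> - \<beta>\<close>: the exponential turns \<open>P\<^sub>\<alpha>\<close> into a dilation of \<open>P\<^sub>\<delta>\<close>, which reproduces
  \<open>F (\<lambda> * w)\<close>.\<close>

lemma bergman_projection_surj:
  fixes F :: "complex ^ 'n \<Rightarrow> complex"
  assumes l: "l \<ge> 1" and p: "1 \<le> p" and \<beta>: "0 < \<beta>" "\<beta> < 2 * \<alpha>"
    and F: "F \<in> F_space l p (\<alpha>\<^sup>2 / (2 * \<alpha> - \<beta>)) \<rho>"
  shows "\<exists>f \<in> L_space l p \<beta> \<rho>. bergman_projection l \<alpha> f = F"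
proof -
  define n where "n = CARD('n)"
  have \<alpha>: "\<alpha> > 0" using \<beta> by simp
  define \<delta> where "\<delta> = 2 * \<alpha> - \<beta>"
  have \<delta>: "\<delta> > 0" using \<beta> by (simp add: \<delta>_def)
  \<comment> \<open>This value satisfies two demands: gamma r^(2l) = delta with gamma = alpha^2 / (2
    alpha - beta), which puts the dilate of F in the space with exponent delta, and r alpha^(1/l) =
    delta^(1/l), which turns the kernel of P_alpha at z into that of P_delta at z / r.\<close>
  define r where "r = (\<delta> / \<alpha>) powr (1 / l)"
  have r: "r > 0" using \<delta> \<alpha> by (simp add: r_def)
  have r2: "\<alpha>\<^sup>2 / (2 * \<alpha> - \<beta>) * r powr (2 * l) = \<delta>"
  proof -
    have "r powr (2 * l) = (\<delta> / \<alpha>)\<^sup>2" using \<delta> \<alpha> l by (simp add: r_def powr_powr)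
    then show ?thesis using \<delta> \<alpha> by (simp add: \<delta>_def[symmetric] power2_eq_square)
  qed
  \<comment> \<open>The quotient of \<open>kernel_const n l \<delta>\<close> by
    \<open>kernel_const n l \<alpha>\<close>.\<close>
  define k where "k = (\<delta> / \<alpha>) powr (real n / l)"
  have k: "k > 0" using \<delta> \<alpha> by (simp add: k_def)
  have Fe: "entire F" and FL: "F \<in> L_space l p (\<alpha>\<^sup>2 / (2 * \<alpha> - \<beta>)) \<rho>" using F by (auto simp: F_space_def)
  define G where "G w = F (r *\<^sub>R w)" for w
  have Ge: "entire G" unfolding G_def by (rule entire_scale[OF Fe])
  have GL: "G \<in> L_space l p \<delta> \<rho>"
    using L_space_scale[OF l p r FL entire_continuous[OF Fe]] unfolding r2 G_def .
  define f where "f w = of_real k * G w * of_real (exp ((\<alpha> - \<delta>) * norm w powr (2 * l)))" for w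
  have [measurable]: "G \<in> borel_measurable borel" by (intro borel_measurable_continuous_onI entire_continuous[OF Ge])
  have fm[measurable]: "f \<in> borel_measurable borel" unfolding f_def by measurable
  \<comment> \<open>Since beta = 2 alpha - delta, alpha - delta - beta / 2 = - delta / 2: the
    exponential carries the weight with exponent delta exactly to the one with exponent
    beta.\<close>
  have fw: "cmod (f w) * fock_weight l \<beta> \<rho> w = k * (cmod (G w) * fock_weight l \<delta> \<rho> w)" for w
  proof -
    have "(\<alpha> - \<delta>) * norm w powr (2 * l) + - (\<beta> / 2) * norm w powr (2 * l) = - (\<delta> / 2) * norm w powr (2 * l)"
      by (simp add: \<delta>_def field_simps)
    then have "exp ((\<alpha> - \<delta>) * norm w powr (2 * l)) * exp (- (\<beta> / 2) * norm w powr (2 * l)) = exp (- (\<delta> / 2) * norm w powr (2 * l))"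
      by (simp only: exp_add[symmetric])
    moreover have "cmod (f w) * fock_weight l \<beta> \<rho> w
       = k * (cmod (G w) * ((1 + norm w) powr \<rho> * (exp ((\<alpha> - \<delta>) * norm w powr (2 * l)) * exp (- (\<beta> / 2) * norm w powr (2 * l)))))"
      using k by (simp add: f_def fock_weight_def norm_mult)
    ultimately show ?thesis by (simp only: fock_weight_def)
  qed
  have fL: "f \<in> L_space l p \<beta> \<rho>"
  proof -
    have fin: "fock_modular l p \<delta> \<rho> G < \<infinity>" using GL by (simp add: L_space_def)
    have "fock_modular l p \<beta> \<rho> f < \<infinity>"
    proof (cases "p = \<infinity>")
      case True
      have "esssup dV (\<lambda>w. ennreal (cmod (f w) * fock_weight l \<beta> \<rho> w)) \<le> ennreal k * fock_modular l p \<delta> \<rho> G"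
      proof (rule esssup_I)
        show "(\<lambda>w. ennreal (cmod (f w) * fock_weight l \<beta> \<rho> w)) \<in> borel_measurable dV" by measurable
        have "AE w in dV. ennreal (cmod (G w) * fock_weight l \<delta> \<rho> w) \<le> fock_modular l p \<delta> \<rho> G"
          using esssup_AE[where f = "\<lambda>w. ennreal (cmod (G w) * fock_weight l \<delta> \<rho> w)" and M = dV] True
          by (simp add: fock_modular_def)
        then show "AE w in dV. ennreal (cmod (f w) * fock_weight l \<beta> \<rho> w) \<le> ennreal k * fock_modular l p \<delta> \<rho> G"
          by eventually_elim (use k in \<open>simp add: fw ennreal_mult' mult_left_mono\<close>)
      qed
      also have "\<dots> < \<infinity>" using fin by (simp add: ennreal_mult_less_top)
      finally show ?thesis using True by (simp add: fock_modular_def)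
    next
      case False
      define q where "q = enn2real p"
      have "(\<integral>\<^sup>+w. ennreal ((cmod (f w) * fock_weight l \<beta> \<rho> w) powr q) \<partial>dV)
        = (\<integral>\<^sup>+w. ennreal (k powr q) * ennreal ((cmod (G w) * fock_weight l \<delta> \<rho> w) powr q) \<partial>dV)"
        using k fock_weight_pos[of l \<delta> \<rho>] unfolding fw
        by (intro nn_integral_cong) (simp add: powr_mult ennreal_mult less_imp_le)
      also have "\<dots> = ennreal (k powr q) * (\<integral>\<^sup>+w. ennreal ((cmod (G w) * fock_weight l \<delta> \<rho> w) powr q) \<partial>dV)"
        by (rule nn_integral_cmult) measurable
      also have "\<dots> < \<infinity>" using fin False by (simp add: fock_modular_def q_def ennreal_mult_less_top)
      finally show ?thesis using False by (simp add: fock_modular_def q_def)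
    qed
    then show ?thesis by (simp add: L_space_def borel_measurable_dV)
  qed
  have "bergman_projection l \<alpha> f z = F z" for z
  proof -
    define y where "y = (1 / r) *\<^sub>R z"
    have rd: "r * \<alpha> powr (1 / l) = \<delta> powr (1 / l)"
      using \<alpha> \<delta> by (simp add: r_def powr_divide)
    have "of_real (\<alpha> powr (1 / l)) * herm z w = of_real (\<delta> powr (1 / l)) * herm y w" for w
    proof -
      have "herm y w = of_real (1 / r) * herm z w" using herm_scaleR[of "1 / r" z 1 w] by (simp add: y_def)
      then show ?thesis using r unfolding rd[symmetric] by simp
    qed
    moreover have "k * kernel_const CARD('n) l \<alpha> = kernel_const CARD('n) l \<delta>"
      using \<alpha> \<delta> by (simp add: k_def kernel_const_def n_def powr_divide)
    ultimately have K: "of_real k * bergman_kernel l \<alpha> z w = bergman_kernel l \<delta> y w" for w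
      by (simp add: bergman_kernel_eq[OF \<alpha>] bergman_kernel_eq[OF \<delta>] mult.assoc[symmetric] flip: of_real_mult)
    have "bergman_integrand l \<alpha> f z w = bergman_integrand l \<delta> G y w" for w
    proof -
      have "exp ((\<alpha> - \<delta>) * norm w powr (2 * l)) * exp (- \<alpha> * norm w powr (2 * l)) = exp (- \<delta> * norm w powr (2 * l))"
        unfolding exp_add[symmetric] by (simp add: algebra_simps)
      then have e: "complex_of_real (exp ((\<alpha> - \<delta>) * norm w powr (2 * l))) * of_real (exp (- \<alpha> * norm w powr (2 * l))) = of_real (exp (- \<delta> * norm w powr (2 * l)))"
        by (simp only: of_real_mult[symmetric])
      have "bergman_integrand l \<alpha> f z w = G w * (of_real k * bergman_kernel l \<alpha> z w)
         * (complex_of_real (exp ((\<alpha> - \<delta>) * norm w powr (2 * l))) * of_real (exp (- \<alpha> * norm w powr (2 * l))))"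
        unfolding bergman_integrand_def f_def by (simp only: mult_ac)
      then show ?thesis unfolding K e by (simp only: bergman_integrand_def)
    qed
    then have "bergman_projection l \<alpha> f z = bergman_projection l \<delta> G y" by (simp add: bergman_projection_def)
    also have "\<dots> = G y"
      \<comment> \<open>The exponent of the projection and that of the space are both delta here, so
        the hypothesis to check is delta < 2 delta.\<close>
      by (rule bergman_projection_reproducing[OF l p \<delta> _ GL Ge]) (use \<delta> in simp)
    also have "\<dots> = F z" using r by (simp add: G_def y_def)
    finally show ?thesis .
  qed
  then show ?thesis using fL by blast
qed

theorem proposition4p2:
  fixes l \<rho> \<alpha> \<beta> :: real and p :: ennreal
  assumes "1 \<le> l" and "1 \<le> p" and "0 < \<beta>" and "\<beta> < 2 * \<alpha>"
  shows "(\<forall>f :: complex ^ 'n \<Rightarrow> complex. f \<in> L_space l p \<beta> \<rho> \<longrightarrow>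
           (\<forall>z. integrable dV (bergman_integrand l \<alpha> f z)))
    \<and> (\<forall>f \<in> L_space l p \<beta> \<rho>. \<forall>g \<in> L_space l p \<beta> \<rho>. \<forall>a b. \<forall>z :: complex ^ 'n.
           bergman_projection l \<alpha> (\<lambda>w. a * f w + b * g w) z
             = a * bergman_projection l \<alpha> f z + b * bergman_projection l \<alpha> g z)
    \<and> (\<exists>C. \<forall>f :: complex ^ 'n \<Rightarrow> complex. f \<in> L_space l p \<beta> \<rho> \<longrightarrow>
           fock_norm l p (\<alpha>\<^sup>2 / (2 * \<alpha> - \<beta>)) \<rho> (bergman_projection l \<alpha> f)
             \<le> C * fock_norm l p \<beta> \<rho> f)
    \<and> bergman_projection l \<alpha> ` L_space l p \<beta> \<rho>
         = (F_space l p (\<alpha>\<^sup>2 / (2 * \<alpha> - \<beta>)) \<rho> :: (complex ^ 'n \<Rightarrow> complex) set)"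
proof (intro conjI)
  have \<alpha>: "\<alpha> > 0" using assms by simp
  obtain C where C: "C > 0" "\<And>f :: complex ^ 'n \<Rightarrow> complex. f \<in> L_space l p \<beta> \<rho> \<Longrightarrow>
     fock_modular l p (\<alpha>\<^sup>2 / (2 * \<alpha> - \<beta>)) \<rho> (bergman_projection l \<alpha> f)
       \<le> ennreal (if p = \<infinity> then C else C powr enn2real p) * fock_modular l p \<beta> \<rho> f"
    using fock_modular_bergman_projection[OF assms] by blast
  show "\<forall>f :: complex ^ 'n \<Rightarrow> complex. f \<in> L_space l p \<beta> \<rho> \<longrightarrow> (\<forall>z. integrable dV (bergman_integrand l \<alpha> f z))"
    using integrable_bergman_integrand[OF assms(1,2) \<alpha> assms(4)] by blast
  show "\<forall>f \<in> L_space l p \<beta> \<rho>. \<forall>g \<in> L_space l p \<beta> \<rho>. \<forall>a b. \<forall>z :: complex ^ 'n.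
           bergman_projection l \<alpha> (\<lambda>w. a * f w + b * g w) z
             = a * bergman_projection l \<alpha> f z + b * bergman_projection l \<alpha> g z"
    using bergman_projection_linear[OF assms(1,2) \<alpha> assms(4)] by blast
  have "fock_norm l p (\<alpha>\<^sup>2 / (2 * \<alpha> - \<beta>)) \<rho> (bergman_projection l \<alpha> f) \<le> C * fock_norm l p \<beta> \<rho> f"
    if "f \<in> L_space l p \<beta> \<rho>" for f :: "complex ^ 'n \<Rightarrow> complex"
    using that C(2)[OF that] by (intro fock_norm_le[OF assms(2) C(1)]) (auto simp: L_space_def)
  then show "\<exists>C. \<forall>f :: complex ^ 'n \<Rightarrow> complex. f \<in> L_space l p \<beta> \<rho> \<longrightarrow>
           fock_norm l p (\<alpha>\<^sup>2 / (2 * \<alpha> - \<beta>)) \<rho> (bergman_projection l \<alpha> f) \<le> C * fock_norm l p \<beta> \<rho> f"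
    by blast
  have "bergman_projection l \<alpha> f \<in> F_space l p (\<alpha>\<^sup>2 / (2 * \<alpha> - \<beta>)) \<rho>"
    if f: "f \<in> L_space l p \<beta> \<rho>" for f :: "complex ^ 'n \<Rightarrow> complex"
  proof -
    have e: "entire (bergman_projection l \<alpha> f)" by (rule entire_bergman_projection[OF assms(1,2) \<alpha> assms(4) f])
    then have "bergman_projection l \<alpha> f \<in> borel_measurable dV"
      by (intro borel_measurable_dV borel_measurable_continuous_onI entire_continuous)
    moreover have "fock_modular l p (\<alpha>\<^sup>2 / (2 * \<alpha> - \<beta>)) \<rho> (bergman_projection l \<alpha> f) < \<infinity>"
      by (rule le_less_trans[OF C(2)[OF f]]) (use f in \<open>auto simp: L_space_def ennreal_mult_less_top\<close>)
    ultimately show ?thesis using e by (simp add: F_space_def L_space_def)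
  qed
  then show "bergman_projection l \<alpha> ` L_space l p \<beta> \<rho>
         = (F_space l p (\<alpha>\<^sup>2 / (2 * \<alpha> - \<beta>)) \<rho> :: (complex ^ 'n \<Rightarrow> complex) set)"
    using bergman_projection_surj[OF assms, of _ \<rho>, where 'n='n] by (intro equalityI subsetI) blast+
qed

end
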